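(* Let $n\ge 2$, $m\ge 1$ and fix $\nu=(\nu_1,\dots,\nu_m)$ with all $\nu_a\in\{1,\dots,n-1\}$. Let $\mu\in\mathbb C^m$ vary and put $\lambda=\mu+\nu$. For every generic $\mu$ let $I(\mu)$ be the non-zero $Y(\mathfrak{gl}_n)$-intertwining operator, unique up to a multiplier from $\mathbb C\setminus\{0\}$, $$\Phi^{\nu_1}_{\mu_1+\rho_1+\frac12}\otimes\cdots\otimes\Phi^{\nu_m}_{\mu_m+\rho_m+\frac12}\ \to\ \Phi^{\nu_m}_{\mu_m+\rho_m+\frac12}\otimes\cdots\otimes\Phi^{\nu_1}_{\mu_1+\rho_1+\frac12}.$$ Then the multipliers from $\mathbb C\setminus\{0\}$ of the operators $I(\mu)$ for all generic $\mu$ can be chosen so that $I(\mu)$ becomes a rational function of $\mu$ which is regular and non-zero at every $\mu$ such that $\lambda+\rho$ is dominant. With such a choice, for any $\mu$ such that $\lambda+\rho$ is dominant, the quotient of $\Phi^{\nu_1}_{\mu_1+\rho_1+\frac12}\otimes\cdots\otimes\Phi^{\nu_m}_{\mu_m+\rho_m+\frac12}$ by the kernel of $I(\mu)$ is an irreducible $Y(\mathfrak{gl}_n)$-module whose Drinfeld polynomials are $$P_i(x)=\prod_{a:\ \nu_a=i}(x-\mu_a-\rho_a),\qquad i=1,\dots,n-1 .$$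
   Context: The Yangian $Y(\mathfrak{gl}_n)$ is the unital associative $\mathbb C$-algebra with generators $T_{ij}^{(1)},T_{ij}^{(2)},\ldots$ ($1\le i,j\le n$) and relations $(x-y)[T_{ij}(x),T_{kl}(y)]=T_{kj}(x)T_{il}(y)-T_{kj}(y)T_{il}(x)$, where $T_{ij}(x)=\delta_{ij}+T_{ij}^{(1)}x^{-1}+T_{ij}^{(2)}x^{-2}+\cdots$. Tensor products of modules are taken via the comultiplication $\Delta(T_{ij}(x))=\sum_{k}T_{ik}(x)\otimes T_{kj}(x)$. For $0\le k\le n$ and $t\in\mathbb C$, $\Phi^k_t$ is the $Y(\mathfrak{gl}_n)$-module with underlying space $\Lambda^k(\mathbb C^n)$ on which $T_{ij}(x)$ acts as $\delta_{ij}+E_{ij}/(x-t)$ (expanded in $x^{-1}$), where the matrix units $E_{ij}$ act by the natural action of $\mathfrak{gl}_n$ on $\Lambda^k(\mathbb C^n)$. Weights of $\mathfrak{gl}_m$ are identified with their sequences of labels in $\mathbb C^m$; $\rho_a=m/2-a+1/2$ for $a=1,\dots,m$. The weight $\mu$ is generic if $\mu_a-\mu_b\notin\mathbb Z$ whenever $a\ne b$. For generic $\mu$ the source and target modules above are irreducible and equivalent. The weight $\lambda+\rho$ is dominant if $\lambda_a+\rho_a-\lambda_b-\rho_b\notin\{-1,-2,\ldots\}$ whenever $a<b$. For all generic $\mu$ the operators $I(\mu)$ act between the same vector spaces $\Lambda^{\nu_1}(\mathbb C^n)\otimes\cdots\otimes\Lambda^{\nu_m}(\mathbb C^n)\to\Lambda^{\nu_m}(\mathbb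 C^n)\otimes\cdots\otimes\Lambda^{\nu_1}(\mathbb C^n)$; rationality and regularity refer to this operator-valued function of $\mu\in\mathbb C^m$, and at non-generic points of regularity $I(\mu)$ denotes the value of the rational function. Drinfeld polynomials: a finite-dimensional irreducible $Y(\mathfrak{gl}_n)$-module contains a vector $v\neq0$, unique up to scalar, with $T_{ij}(x)v=0$ for $i<j$; then $T_{ii}(x)v=\Lambda_i(x)v$ for some $\Lambda_i(x)\in 1+x^{-1}\mathbb C[[x^{-1}]]$. Its Drinfeld polynomials are the monic polynomials $P_1(x),\dots,P_{n-1}(x)$ with $\Lambda_i(x)/\Lambda_{i+1}(x)=P_i(x+\tfrac12)/P_i(x-\tfrac12)$ for $i=1,\dots,n-1$. *)

theory Defs
  imports
    "HOL-Computational_Algebra.Polynomial"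
    "HOL-Computational_Algebra.Formal_Laurent_Series"
    "HOL-Algebra.AbelCoset"
    "HOL-Algebra.Module"
begin

section \<open>Modules over the Yangian of gl(n)\<close>

definition complex_ring :: "complex ring" where
  "complex_ring = \<lparr>carrier = UNIV, mult = (*), one = 1, zero = 0, add = (+)\<rparr>"

text \<open>
  The Yangian is given by generators and relations, so a module over it is a complex vector space
  with operators satisfying the relations. \<open>gen M i j r\<close> is the action of the coefficient
  of \<open>x^(-r)\<close> in \<open>T_ij(x)\<close>, for \<open>i, j\<close> in \<open>{1..n}\<close>; for \<open>r = 0\<close> it is the Kronecker delta.
  The fields \<open>mult\<close> and \<open>one\<close> inherited from the ring record play no role.
\<close>

record 'v yangian_space = "(complex, 'v) module" +
  gen :: "nat \<Rightarrow> nat \<Rightarrow> nat \<Rightarrow> 'v \<Rightarrow> 'v"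

definition linear_map ::
    "(complex, 'v, 'x) module_scheme \<Rightarrow> (complex, 'w, 'y) module_scheme \<Rightarrow> ('v \<Rightarrow> 'w) \<Rightarrow> bool" where
  "linear_map M N f \<longleftrightarrow>
     f \<in> carrier M \<rightarrow> carrier N \<and>
     (\<forall>u\<in>carrier M. \<forall>v\<in>carrier M. f (u \<oplus>\<^bsub>M\<^esub> v) = f u \<oplus>\<^bsub>N\<^esub> f v) \<and>
     (\<forall>c. \<forall>v\<in>carrier M. f (c \<odot>\<^bsub>M\<^esub> v) = c \<odot>\<^bsub>N\<^esub> f v)"

text \<open>
  The last clause is the coefficient of \<open>x^(-r) y^(-s)\<close> in
  \<open>(x - y) [T_ij(x), T_kl(y)] = T_kj(x) T_il(y) - T_kj(y) T_il(x)\<close>.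
  The remaining coefficients, those involving \<open>x\<close> or \<open>y\<close> to the first power, say that the
  scalars \<open>gen M i j 0\<close> commute with everything.
\<close>

definition yangian_module :: "nat \<Rightarrow> 'v yangian_space \<Rightarrow> bool" where
  "yangian_module n M \<longleftrightarrow>
     module complex_ring M \<and>
     (\<forall>i\<in>{1..n}. \<forall>j\<in>{1..n}. \<forall>r. linear_map M M (gen M i j r)) \<and>
     (\<forall>i\<in>{1..n}. \<forall>j\<in>{1..n}. \<forall>v\<in>carrier M.
        gen M i j 0 v = (if i = j then v else \<zero>\<^bsub>M\<^esub>)) \<and>
     (\<forall>i\<in>{1..n}. \<forall>j\<in>{1..n}. \<forall>k\<in>{1..n}. \<forall>l\<in>{1..n}. \<forall>r s. \<forall>v\<in>carrier M.
        (gen M i j (Suc r) (gen M k l s v) \<ominus>\<^bsub>M\<^esub> gen M k l s (gen M i j (Suc r) v)) \<ominus>\<^bsub>M\<^esub>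
        (gen M i j r (gen M k l (Suc s) v) \<ominus>\<^bsub>M\<^esub> gen M k l (Suc s) (gen M i j r v))
        = gen M k j r (gen M i l s v) \<ominus>\<^bsub>M\<^esub> gen M k j s (gen M i l r v))"

definition yangian_submodule :: "nat \<Rightarrow> 'v set \<Rightarrow> 'v yangian_space \<Rightarrow> bool" where
  "yangian_submodule n N M \<longleftrightarrow>
     submodule N complex_ring M \<and>
     (\<forall>i\<in>{1..n}. \<forall>j\<in>{1..n}. \<forall>r. \<forall>v\<in>N. gen M i j r v \<in> N)"

definition irreducible_yangian_module :: "nat \<Rightarrow> 'v yangian_space \<Rightarrow> bool" where
  "irreducible_yangian_module n M \<longleftrightarrow>
     yangian_module n M \<and> carrier M \<noteq> {\<zero>\<^bsub>M\<^esub>} \<and>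
     (\<forall>N. yangian_submodule n N M \<longrightarrow> N = {\<zero>\<^bsub>M\<^esub>} \<or> N = carrier M)"

definition intertwiner :: "nat \<Rightarrow> 'v yangian_space \<Rightarrow> 'w yangian_space \<Rightarrow> ('v \<Rightarrow> 'w) \<Rightarrow> bool" where
  "intertwiner n M N f \<longleftrightarrow>
     linear_map M N f \<and>
     (\<forall>i\<in>{1..n}. \<forall>j\<in>{1..n}. \<forall>r. \<forall>v\<in>carrier M. f (gen M i j r v) = gen N i j r (f v))"

definition nonzero_map ::
    "(complex, 'v, 'x) module_scheme \<Rightarrow> (complex, 'w, 'y) module_scheme \<Rightarrow> ('v \<Rightarrow> 'w) \<Rightarrow> bool" where
  "nonzero_map M N f \<longleftrightarrow> (\<exists>v\<in>carrier M. f v \<noteq> \<zero>\<^bsub>N\<^esub>)"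

definition nonzero_intertwiner ::
    "nat \<Rightarrow> 'v yangian_space \<Rightarrow> 'w yangian_space \<Rightarrow> ('v \<Rightarrow> 'w) \<Rightarrow> bool" where
  "nonzero_intertwiner n M N f \<longleftrightarrow> intertwiner n M N f \<and> nonzero_map M N f"

text \<open>
  The quotient by a subspace \<open>K\<close>, on the set of cosets. An operator sends the coset of \<open>v\<close> to
  the coset of the image of \<open>v\<close>; the union over representatives is this coset exactly when it
  does not depend on the representative, i.e. when \<open>K\<close> is invariant.
\<close>

definition quotient_space :: "'v yangian_space \<Rightarrow> 'v set \<Rightarrow> 'v set yangian_space" where
  "quotient_space M K =
     \<lparr>carrier = a_rcosets\<^bsub>M\<^esub> K, mult = (\<lambda>_ _. undefined), one = undefined,
      zero = K, add = set_add M,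
      smult = (\<lambda>c A. \<Union>v\<in>A. K +>\<^bsub>M\<^esub> (c \<odot>\<^bsub>M\<^esub> v)),
      gen = (\<lambda>i j r A. \<Union>v\<in>A. K +>\<^bsub>M\<^esub> gen M i j r v)\<rparr>"

section \<open>Drinfeld polynomials\<close>

text \<open>
  Series in \<open>x^(-1)\<close> are formal Laurent series in the variable \<open>fls_X\<close>, which stands for
  \<open>x^(-1)\<close>; thus \<open>x\<close> itself is \<open>fls_X_inv\<close>.
\<close>

definition poly_in_x :: "complex poly \<Rightarrow> complex fls" where
  "poly_in_x p = poly (map_poly fls_const p) fls_X_inv"

text \<open>
  For an irreducible finite-dimensional module the vector \<open>v\<close> is unique up to a scalar factor,
  so that this determines the polynomials \<open>P 1, ..., P (n - 1)\<close>.
\<close>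

definition drinfeld_polynomials :: "nat \<Rightarrow> 'v yangian_space \<Rightarrow> (nat \<Rightarrow> complex poly) \<Rightarrow> bool" where
  "drinfeld_polynomials n M P \<longleftrightarrow>
     (\<exists>v\<in>carrier M. \<exists>\<Lambda> :: nat \<Rightarrow> complex fps.
        v \<noteq> \<zero>\<^bsub>M\<^esub> \<and>
        (\<forall>i\<in>{1..n}. \<forall>j\<in>{1..n}. \<forall>r. i < j \<longrightarrow> gen M i j r v = \<zero>\<^bsub>M\<^esub>) \<and>
        (\<forall>i\<in>{1..n}. \<forall>r. gen M i i r v = fps_nth (\<Lambda> i) r \<odot>\<^bsub>M\<^esub> v) \<and>
        (\<forall>i\<in>{1..<n}. lead_coeff (P i) = 1 \<and>
           fps_to_fls (\<Lambda> i) / fps_to_fls (\<Lambda> (Suc i)) =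
             poly_in_x (P i \<circ>\<^sub>p [:1/2, 1:]) / poly_in_x (P i \<circ>\<^sub>p [:-1/2, 1:])))"

section \<open>Tensor products of the modules on exterior powers\<close>

text \<open>
  The modules used below are given with a basis. \<open>coef i j r x y\<close> is the coefficient of the basis
  vector \<open>x\<close> in the image of the basis vector \<open>y\<close> under \<open>T_ij^(r)\<close>.
\<close>

record 'b based_space =
  basis :: "'b set"
  coef :: "nat \<Rightarrow> nat \<Rightarrow> nat \<Rightarrow> 'b \<Rightarrow> 'b \<Rightarrow> complex"

definition space_of :: "'b based_space \<Rightarrow> ('b \<Rightarrow> complex) yangian_space" where
  "space_of B =
     \<lparr>carrier = {f. \<forall>x. x \<notin> basis B \<longrightarrow> f x = 0},
      mult = (\<lambda>_ _. undefined), one = undefined,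
      zero = (\<lambda>_. 0), add = (\<lambda>f g x. f x + g x),
      smult = (\<lambda>c f x. c * f x),
      gen = (\<lambda>i j r f x. if x \<in> basis B then (\<Sum>y\<in>basis B. coef B i j r x y * f y) else 0)\<rparr>"

definition basis_vector :: "'b \<Rightarrow> 'b \<Rightarrow> complex" where
  "basis_vector y = (\<lambda>x. if x = y then 1 else 0)"

text \<open>
  The exterior power has the basis \<open>e_S = e_(s1) \<and> ... \<and> e_(sk)\<close> for
  \<open>S = {s1 < ... < sk}\<close>. On it \<open>E_ij\<close> is contraction with the \<open>j\<close>-th coordinate function
  followed by exterior multiplication by \<open>e_i\<close> on the left. \<open>ext_E i j S' S\<close> is the
  coefficient of \<open>e_S'\<close> in \<open>E_ij e_S\<close>.
\<close>

definition ext_E :: "nat \<Rightarrow> nat \<Rightarrow> nat set \<Rightarrow> nat set \<Rightarrow> complex" where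
  "ext_E i j S' S =
     (if j \<in> S \<and> i \<notin> S - {j} \<and> S' = insert i (S - {j})
      then (-1) ^ card {s \<in> S. s < j} * (-1) ^ card {s \<in> S - {j}. s < i}
      else 0)"

text \<open>\<open>1 / (x - t)\<close> expands as the sum of \<open>t^(r-1) x^(-r)\<close> over \<open>r \<ge> 1\<close>.\<close>

definition Phi :: "nat \<Rightarrow> nat \<Rightarrow> complex \<Rightarrow> nat set based_space" where
  "Phi n k t =
     \<lparr>basis = {S. S \<subseteq> {1..n} \<and> card S = k},
      coef = (\<lambda>i j r S' S.
        if r = 0 then (if i = j \<and> S' = S then 1 else 0) else t ^ (r - 1) * ext_E i j S' S)\<rparr>"

text \<open>
  The tensor product of a list of modules, with the tensor products of basis vectors as basis.
  The second equation is \<open>T_ij(x) \<mapsto> \<Sum>k. T_ik(x) \<otimes> T_kj(x)\<close>; the empty tensor product is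
  the trivial module, on which \<open>T_ij(x)\<close> acts as the Kronecker delta.
\<close>

fun tensor_coef :: "nat \<Rightarrow> 'b based_space list \<Rightarrow> nat \<Rightarrow> nat \<Rightarrow> nat \<Rightarrow> 'b list \<Rightarrow> 'b list \<Rightarrow> complex" where
  "tensor_coef n [] i j r xs ys = (if i = j \<and> r = 0 then 1 else 0)"
| "tensor_coef n (B # Bs) i j r xs ys =
     (\<Sum>k = 1..n. \<Sum>s = 0..r.
        coef B i k s (hd xs) (hd ys) * tensor_coef n Bs k j (r - s) (tl xs) (tl ys))"

definition tensor :: "nat \<Rightarrow> 'b based_space list \<Rightarrow> 'b list based_space" where
  "tensor n Bs = \<lparr>basis = listset (map basis Bs), coef = tensor_coef n Bs\<rparr>"

text \<open>A point of \<open>\<complex>^m\<close> is a function on \<open>nat\<close>, only the values at \<open>1, ..., m\<close> being used.\<close>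

definition rho :: "nat \<Rightarrow> nat \<Rightarrow> complex" where
  "rho m a = of_nat m / 2 - of_nat a + 1 / 2"

definition factor :: "nat \<Rightarrow> nat \<Rightarrow> (nat \<Rightarrow> nat) \<Rightarrow> (nat \<Rightarrow> complex) \<Rightarrow> nat \<Rightarrow> nat set based_space" where
  "factor n m \<nu> \<mu> a = Phi n (\<nu> a) (\<mu> a + rho m a + 1 / 2)"

definition source :: "nat \<Rightarrow> nat \<Rightarrow> (nat \<Rightarrow> nat) \<Rightarrow> (nat \<Rightarrow> complex) \<Rightarrow> nat set list based_space" where
  "source n m \<nu> \<mu> = tensor n (map (factor n m \<nu> \<mu>) [1..<Suc m])"

definition target :: "nat \<Rightarrow> nat \<Rightarrow> (nat \<Rightarrow> nat) \<Rightarrow> (nat \<Rightarrow> complex) \<Rightarrow> nat set list based_space" where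
  "target n m \<nu> \<mu> = tensor n (map (factor n m \<nu> \<mu>) (rev [1..<Suc m]))"

abbreviation Source ::
    "nat \<Rightarrow> nat \<Rightarrow> (nat \<Rightarrow> nat) \<Rightarrow> (nat \<Rightarrow> complex) \<Rightarrow> (nat set list \<Rightarrow> complex) yangian_space" where
  "Source n m \<nu> \<mu> \<equiv> space_of (source n m \<nu> \<mu>)"

abbreviation Target ::
    "nat \<Rightarrow> nat \<Rightarrow> (nat \<Rightarrow> nat) \<Rightarrow> (nat \<Rightarrow> complex) \<Rightarrow> (nat set list \<Rightarrow> complex) yangian_space" where
  "Target n m \<nu> \<mu> \<equiv> space_of (target n m \<nu> \<mu>)"

section \<open>Weights and rational functions\<close>

definition generic :: "nat \<Rightarrow> (nat \<Rightarrow> complex) \<Rightarrow> bool" where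
  "generic m \<mu> \<longleftrightarrow> (\<forall>a\<in>{1..m}. \<forall>b\<in>{1..m}. a \<noteq> b \<longrightarrow> \<mu> a - \<mu> b \<notin> \<int>)"

definition dominant :: "nat \<Rightarrow> (nat \<Rightarrow> complex) \<Rightarrow> bool" where
  "dominant m \<kappa> \<longleftrightarrow>
     (\<forall>a\<in>{1..m}. \<forall>b\<in>{1..m}. a < b \<longrightarrow> (\<forall>k::nat. k \<ge> 1 \<longrightarrow> \<kappa> a - \<kappa> b \<noteq> - of_nat k))"

definition shifted_dominant :: "nat \<Rightarrow> (nat \<Rightarrow> nat) \<Rightarrow> (nat \<Rightarrow> complex) \<Rightarrow> bool" where
  "shifted_dominant m \<nu> \<mu> \<longleftrightarrow> 
     (let lam = (\<lambda>a. \<mu> a + of_nat (\<nu> a)) in dominant m (\<lambda>a. lam a + rho m a))"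

inductive polynomial_fun :: "nat \<Rightarrow> ((nat \<Rightarrow> complex) \<Rightarrow> complex) \<Rightarrow> bool" for m :: nat where
  const: "polynomial_fun m (\<lambda>_. c)"
| coord: "a \<in> {1..m} \<Longrightarrow> polynomial_fun m (\<lambda>\<mu>. \<mu> a)"
| add: "polynomial_fun m p \<Longrightarrow> polynomial_fun m q \<Longrightarrow> polynomial_fun m (\<lambda>\<mu>. p \<mu> + q \<mu>)"
| mult: "polynomial_fun m p \<Longrightarrow> polynomial_fun m q \<Longrightarrow> polynomial_fun m (\<lambda>\<mu>. p \<mu> * q \<mu>)"

text \<open>
  The rational function \<open>p / q\<close> in \<open>m\<close> variables is regular at \<open>\<mu>\<close> with value \<open>c\<close> there:
  some fraction equal to \<open>p / q\<close> has non-vanishing denominator at \<open>\<mu>\<close>.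
\<close>

definition regular_with_value ::
    "nat \<Rightarrow> ((nat \<Rightarrow> complex) \<Rightarrow> complex) \<Rightarrow> ((nat \<Rightarrow> complex) \<Rightarrow> complex) \<Rightarrow>
     (nat \<Rightarrow> complex) \<Rightarrow> complex \<Rightarrow> bool" where
  "regular_with_value m p q \<mu> c \<longleftrightarrow>
     (\<exists>p' q'. polynomial_fun m p' \<and> polynomial_fun m q' \<and> (\<forall>x. p x * q' x = p' x * q x) \<and>
        q' \<mu> \<noteq> 0 \<and> c = p' \<mu> / q' \<mu>)"

definition rational_regular_on ::
    "nat \<Rightarrow> (nat \<Rightarrow> complex) set \<Rightarrow> ((nat \<Rightarrow> complex) \<Rightarrow> complex) \<Rightarrow> bool" where
  "rational_regular_on m D f \<longleftrightarrow>
     (\<exists>p q. polynomial_fun m p \<and> polynomial_fun m q \<and> (\<exists>x. q x \<noteq> 0) \<and>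
        (\<forall>\<mu>\<in>D. regular_with_value m p q \<mu> (f \<mu>)))"

text \<open>
  \<open>I\<close> is a normalization as in the theorem, extended from the generic points to all points where
  \<open>\<lambda> + \<rho>\<close> is dominant by the values of the rational function; note that \<open>\<lambda> + \<rho>\<close> is dominant
  whenever \<open>\<mu>\<close> is generic. The matrix entry of \<open>I \<mu>\<close> at \<open>x, y\<close> is
  \<open>I \<mu> (basis_vector y) x\<close>; the bases do not depend on \<open>\<mu>\<close>.
\<close>

definition normalized_family ::
    "nat \<Rightarrow> nat \<Rightarrow> (nat \<Rightarrow> nat) \<Rightarrow>
     ((nat \<Rightarrow> complex) \<Rightarrow> (nat set list \<Rightarrow> complex) \<Rightarrow> (nat set list \<Rightarrow> complex)) \<Rightarrow> bool" where
  "normalized_family n m \<nu> I \<longleftrightarrow>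
     (\<forall>\<mu>. generic m \<mu> \<longrightarrow> intertwiner n (Source n m \<nu> \<mu>) (Target n m \<nu> \<mu>) (I \<mu>)) \<and>
     (\<forall>y\<in>basis (source n m \<nu> (\<lambda>_. 0)). \<forall>x\<in>basis (target n m \<nu> (\<lambda>_. 0)).
        rational_regular_on m {\<mu>. shifted_dominant m \<nu> \<mu>} (\<lambda>\<mu>. I \<mu> (basis_vector y) x)) \<and>
     (\<forall>\<mu>. shifted_dominant m \<nu> \<mu> \<longrightarrow>
        linear_map (Source n m \<nu> \<mu>) (Target n m \<nu> \<mu>) (I \<mu>) \<and>
        nonzero_map (Source n m \<nu> \<mu>) (Target n m \<nu> \<mu>) (I \<mu>))"

end

theory Submission
  imports Defs "Jordan_Normal_Form.Determinant"
begin

text \<open>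
  Let \<open>S\<close> be the tensor product of the exterior powers with highest vector \<open>v\<close>, and \<open>T\<close> the one in the
  reverse order with highest vector \<open>v'\<close>.

  The heart of the proof is that \<open>S\<close> is generated by \<open>v\<close> whenever \<open>\<lambda> + \<rho>\<close> is dominant. Split off the first
  factor, with parameters \<open>k\<close> and \<open>t\<close>, and let \<open>w\<close> be the highest vector of the others. Evaluating suitable sums
  of series \<open>T_ij(x)\<close> at the points \<open>x = t, t + 1, ..., t + k - 1\<close> one obtains from \<open>v = e_{1..k} \<otimes> w\<close>
  all vectors \<open>e_S \<otimes> w\<close>; the factors which have to be inverted are \<open>t + k - j + 1 - s\<close> for
  the parameters \<open>l \<ge> j\<close> and \<open>s\<close> of the other factors, and they do not vanish by dominance.

  The matrix of \<open>T_ij(x)\<close> on \<open>T\<close> is the transpose of that of \<open>T_ji(x)\<close> on \<open>S\<close>, so every non-zero submodule of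
  \<open>T\<close> contains \<open>v'\<close>. By the commutation relations the coefficient of the highest vector in \<open>X v\<close>, for
  \<open>X\<close> in the Yangian, depends only on the highest weight, hence equals that of \<open>v'\<close> in \<open>X v'\<close>. Therefore
  \<open>X v = 0\<close> implies \<open>X v' = 0\<close>, and \<open>X v \<mapsto> X v'\<close> is an intertwining operator; it is the only one up to
  scalars, its image is irreducible, and by Cramer's rule its matrix is rational and regular.
\<close>

section \<open>The action on exterior powers\<close>

text \<open>At dominant but non-generic parameters \<open>S\<close> and \<open>T\<close> may be
  reducible, so Schur's lemma gives neither existence nor uniqueness of the operator. What survives
  there is cyclicity of the highest vector in \<open>S\<close> and, by transposition, the dual
  property of \<open>T\<close>. Sending \<open>v\<close> to \<open>v'\<close> fixes the multiplier
  at every dominant point at once, so no pole or zero has to be removed afterwards. The points of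
  evaluation arise as follows. Let z = e_A, where j is missing from A and q elements of A exceed j;
  sum T_cj(x) applied to the tensor product of E_jc z and w over c > j. In the coproduct the terms
  with p < j vanish, as w is highest; p = j gives a multiple of z; each p > j carries the scalar 1 -
  (q - 1)/(x - t), which vanishes at x = t + q - 1. This point may be a pole of T_jj(x) on w, so
  denominators are cleared before evaluation. The numerator, the product of x - s + 1 over l \<ge>
  j, becomes there the product of the factors t + q - s that dominance keeps non-zero. A given
  normalized family is only known to be linear at non-generic points; the intertwining property is
  carried over by density.\<close>

text \<open>
  Exterior multiplication \<open>cr i\<close> by \<open>e_i\<close> and contraction \<open>an j\<close> with the \<open>j\<close>-th coordinate function,
  acting on coefficient functions; thus \<open>E_ij\<close> is \<open>cr i \<circ> an j\<close>.
\<close>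

definition jw_sign :: "nat \<Rightarrow> nat set \<Rightarrow> complex" where
  "jw_sign i S = (-1) ^ card {s \<in> S. s < i}"

definition cr :: "nat \<Rightarrow> (nat set \<Rightarrow> complex) \<Rightarrow> nat set \<Rightarrow> complex" where
  "cr i f S = (if i \<in> S then jw_sign i S * f (S - {i}) else 0)"

definition an :: "nat \<Rightarrow> (nat set \<Rightarrow> complex) \<Rightarrow> nat set \<Rightarrow> complex" where
  "an j f S = (if j \<notin> S then jw_sign j S * f (insert j S) else 0)"

lemma jw_sign_insert:
  assumes "finite S" "j \<notin> S"
  shows "jw_sign i (insert j S) = (if j < i then - 1 else 1) * jw_sign i S"
proof (cases "j < i")
  case True
  then have "{s \<in> insert j S. s < i} = insert j {s \<in> S. s < i}"
    by auto
  then show ?thesis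
    using assms True by (simp add: jw_sign_def)
next
  case False
  then have "{s \<in> insert j S. s < i} = {s \<in> S. s < i}"
    by auto
  then show ?thesis
    using False by (simp add: jw_sign_def)
qed

lemma jw_sign_remove:
  assumes "finite S" "j \<in> S"
  shows "jw_sign i (S - {j}) = (if j < i then - 1 else 1) * jw_sign i S"
proof -
  have "jw_sign i S = (if j < i then - 1 else 1) * jw_sign i (S - {j})"
    using jw_sign_insert[of "S - {j}" j i] assms by (simp add: insert_absorb)
  then show ?thesis
    by auto
qed

lemma jw_sign_square [simp]: "jw_sign i S * jw_sign i S = 1"
  by (simp add: jw_sign_def flip: power_mult_distrib)

lemma jw_sign_square' [simp]: "jw_sign i S * (jw_sign i S * c) = c"
  by (simp flip: mult.assoc)

lemmas jw_simps = cr_def an_def jw_sign_insert jw_sign_remove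

text \<open>Canonical anticommutation relations: for \<open>i \<noteq> j\<close> exactly one of the
  two signs, that of the larger index, notices the insertion or removal of the other index.\<close>

lemma cr_an:
  assumes "finite S"
  shows "cr i (an j f) S = (if i = j then f S else 0) - an j (cr i f) S"
proof (cases "i = j")
  case True
  then show ?thesis
    using assms by (cases "i \<in> S") (simp_all add: jw_simps insert_absorb)
next
  case False
  then have "insert j (S - {i}) = insert j S - {i}"
    by auto
  then show ?thesis
    using assms False by (auto simp: jw_simps)
qed

lemma an_cr:
  assumes "finite S"
  shows "an j (cr i f) S = (if i = j then f S else 0) - cr i (an j f) S"
  using cr_an[OF assms, of i j f] by simp

lemma cr_cr:
  assumes "finite S"
  shows "cr i (cr k f) S = - cr k (cr i f) S"
proof (cases "i = k")
  case True
  then show ?thesis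
    by (simp add: cr_def)
next
  case False
  then have "S - {i} - {k} = S - {k} - {i}"
    by auto
  then show ?thesis
    using assms False by (auto simp: jw_simps)
qed

lemma an_an:
  assumes "finite S"
  shows "an i (an k f) S = - an k (an i f) S"
proof (cases "i = k")
  case True
  then show ?thesis
    by (simp add: an_def)
next
  case False
  then show ?thesis
    using assms by (auto simp: jw_simps insert_commute)
qed

lemma cr_cong: "(i \<in> S \<Longrightarrow> f (S - {i}) = g (S - {i})) \<Longrightarrow> cr i f S = cr i g S"
  by (simp add: cr_def)

lemma cr_diff: "cr i (\<lambda>S. f S - g S) S = cr i f S - cr i g S"
  by (simp add: cr_def algebra_simps)

lemma cr_if: "cr i (\<lambda>S. if b then f S else 0) S = (if b then cr i f S else 0)"
  by (simp add: cr_def)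

text \<open>Normal ordering of E_ij E_kl. By \<open>cr_cr_an_an\<close> the quartic remainder is
  symmetric under exchange of the two pairs, so it drops out of the commutator and the relations of
  gl(n) remain.\<close>

lemma cr_an_cr_an:
  assumes "finite S"
  shows "cr i (an j (cr k (an l f))) S
    = (if j = k then cr i (an l f) S else 0) - cr i (cr k (an j (an l f))) S"
proof -
  have "cr i (an j (cr k (an l f))) S
      = cr i (\<lambda>S. (if k = j then an l f S else 0) - cr k (an j (an l f)) S) S"
    using assms by (intro cr_cong an_cr) auto
  then show ?thesis
    by (simp add: cr_diff cr_if)
qed

lemma cr_cr_an_an:
  assumes "finite S"
  shows "cr i (cr k (an j (an l f))) S = cr k (cr i (an l (an j f))) S"
proof -
  have "cr i (cr k (an j (an l f))) S = cr i (cr k (\<lambda>S. - an l (an j f) S)) S"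
    using assms by (intro cr_cong an_an) auto
  also have "\<dots> = - cr i (cr k (an l (an j f))) S"
    using assms by (simp add: cr_def)
  also have "\<dots> = cr k (cr i (an l (an j f))) S"
    by (subst cr_cr[OF assms]) simp
  finally show ?thesis .
qed

lemma cr_an_commutator:
  assumes "finite S"
  shows "cr i (an j (cr k (an l f))) S - cr k (an l (cr i (an j f))) S
    = (if j = k then cr i (an l f) S else 0) - (if i = l then cr k (an j f) S else 0)"
  using cr_an_cr_an[OF assms, of i j k l f] cr_an_cr_an[OF assms, of k l i j f]
    cr_cr_an_an[OF assms, of i k j l f] by auto

section \<open>Matrices of the E_ij in the basis of an exterior power\<close>

definition ext_basis :: "nat \<Rightarrow> nat \<Rightarrow> nat set set" where
  "ext_basis n k = {S. S \<subseteq> {1..n} \<and> card S = k}"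

lemma finite_ext_basis [simp]: "finite (ext_basis n k)"
  by (rule finite_subset[of _ "Pow {1..n}"]) (auto simp: ext_basis_def)

lemma ext_basis_finite: "S \<in> ext_basis n k \<Longrightarrow> finite S"
  by (auto simp: ext_basis_def intro: finite_subset)

lemma basis_Phi: "basis (Phi n k t) = ext_basis n k"
  by (simp add: Phi_def ext_basis_def)

lemma ext_E_as_signs:
  "ext_E i j S' S = (if j \<in> S \<and> i \<notin> S - {j} \<and> S' = insert i (S - {j})
     then jw_sign j S * jw_sign i (S - {j}) else 0)"
  by (simp add: ext_E_def jw_sign_def)

text \<open>Creation and annihilation are adjoint for the form in which the e_S are orthonormal.
  This symmetry is the source of the duality between the two orders of the tensor factors.\<close>

lemma ext_E_sym:
  assumes "finite S" "finite S'"
  shows "ext_E i j S' S = ext_E j i S S'"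
proof -
  have *: "ext_E i j S' S = ext_E j i S S'"
    if "j \<in> S \<and> i \<notin> S - {j} \<and> S' = insert i (S - {j})" "finite S" for i j S S'
  proof -
    have "insert i (S - {j}) - {i} = S - {j}" "insert j (S - {j}) = S"
      using that by auto
    then have "ext_E i j S' S = jw_sign j S * jw_sign i (S - {j})"
        "ext_E j i S S' = jw_sign i (insert i (S - {j})) * jw_sign j (S - {j})"
      using that by (auto simp: ext_E_as_signs)
    then show ?thesis
      using that by (simp add: jw_sign_insert jw_sign_remove)
  qed
  show ?thesis
  proof (cases "j \<in> S \<and> i \<notin> S - {j} \<and> S' = insert i (S - {j})")
    case True
    then show ?thesis
      using * assms by blast
  next
    case False
    then show ?thesis
      using *[of i S' j S] assms by (auto simp: ext_E_as_signs)
  qed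
qed

lemma sum_ext_E:
  assumes "i \<in> {1..n}" "j \<in> {1..n}" "x \<in> ext_basis n k"
  shows "(\<Sum>y\<in>ext_basis n k. ext_E i j x y * f y) = cr i (an j f) x"
proof (cases "i \<in> x \<and> j \<notin> x - {i}")
  case True
  \<comment> \<open>The only index \<open>y\<close> for which E_ij e_y has a component along
    e_x.\<close>
  define y where "y = insert j (x - {i})"
  have fin: "finite x"
    using assms(3) by (rule ext_basis_finite)
  have "card y = k"
    using True assms(3) fin card_gt_0_iff[of x] by (auto simp: y_def ext_basis_def card_insert_if)
  then have y: "y \<in> ext_basis n k"
    using assms True by (auto simp: y_def ext_basis_def)
  have yj: "y - {j} = x - {i}"
    using True by (auto simp: y_def)
  have "ext_E i j x w = 0" if "w \<noteq> y" for w
  proof -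
    have "w = insert j (x - {i})" if "j \<in> w" "i \<notin> w - {j}" "x = insert i (w - {j})"
      using that by auto
    then show ?thesis
      using that by (auto simp: ext_E_as_signs y_def)
  qed
  then have "(\<Sum>y\<in>ext_basis n k. ext_E i j x y * f y) = (\<Sum>w\<in>{y}. ext_E i j x w * f w)"
    using y by (intro sum.mono_neutral_right) auto
  also have "\<dots> = jw_sign j y * jw_sign i (x - {i}) * f y"
    using True by (auto simp: ext_E_as_signs yj) (auto simp: y_def)
  also have "jw_sign j y = jw_sign j (x - {i})"
    using True fin by (simp add: y_def jw_sign_insert)
  also have "jw_sign i (x - {i}) = jw_sign i x"
    using True fin by (simp add: jw_sign_remove)
  finally show ?thesis
    using True by (simp add: cr_def an_def y_def)
next
  case False
  then have "ext_E i j x y = 0" for y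
    by (auto simp: ext_E_as_signs)
  then show ?thesis
    using False by (auto simp: cr_def an_def)
qed

lemma sum_ext_E_ext_E:
  assumes "{i, j, k, l} \<subseteq> {1..n}" "x \<in> ext_basis n d" "z \<in> ext_basis n d"
  shows "(\<Sum>y\<in>ext_basis n d. ext_E i j x y * ext_E k l y z)
    = cr i (an j (cr k (an l (basis_vector z)))) x"
proof -
  have "ext_E k l y z = cr k (an l (basis_vector z)) y" if "y \<in> ext_basis n d" for y
  proof -
    have "cr k (an l (basis_vector z)) y
        = (\<Sum>w\<in>ext_basis n d. ext_E k l y w * basis_vector z w)"
      using assms that by (simp add: sum_ext_E)
    also have "\<dots> = (\<Sum>w\<in>{z}. ext_E k l y w * basis_vector z w)"
      using assms by (intro sum.mono_neutral_right) (auto simp: basis_vector_def)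
    finally show ?thesis
      by (simp add: basis_vector_def)
  qed
  then have "(\<Sum>y\<in>ext_basis n d. ext_E i j x y * ext_E k l y z)
    = (\<Sum>y\<in>ext_basis n d. ext_E i j x y * cr k (an l (basis_vector z)) y)"
    by (intro sum.cong) auto
  then show ?thesis
    using assms by (simp add: sum_ext_E)
qed

lemma ext_E_eq_cr_an:
  assumes "i \<in> {1..n}" "j \<in> {1..n}" "x \<in> ext_basis n d" "z \<in> ext_basis n d"
  shows "ext_E i j x z = cr i (an j (basis_vector z)) x"
proof -
  have "cr i (an j (basis_vector z)) x
      = (\<Sum>w\<in>ext_basis n d. ext_E i j x w * basis_vector z w)"
    using assms by (simp add: sum_ext_E)
  also have "\<dots> = (\<Sum>w\<in>{z}. ext_E i j x w * basis_vector z w)"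
    using assms by (intro sum.mono_neutral_right) (auto simp: basis_vector_def)
  finally show ?thesis
    by (simp add: basis_vector_def)
qed

lemma ext_E_commutator:
  assumes "{i, j, k, l} \<subseteq> {1..n}" "x \<in> ext_basis n d" "z \<in> ext_basis n d"
  shows "(\<Sum>y\<in>ext_basis n d. ext_E i j x y * ext_E k l y z)
      - (\<Sum>y\<in>ext_basis n d. ext_E k l x y * ext_E i j y z)
    = (if j = k then ext_E i l x z else 0) - (if i = l then ext_E k j x z else 0)"
proof -
  have "finite x"
    using assms by (blast intro: ext_basis_finite)
  moreover have "{k, l, i, j} \<subseteq> {1..n}"
    using assms by auto
  ultimately show ?thesis
    using assms cr_an_commutator[of x i j k l "basis_vector z"]
    by (simp only: sum_ext_E_ext_E) (simp add: ext_E_eq_cr_an[of _ n _ _ d])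
qed

section \<open>The defining relations for matrix entries\<close>

definition yangian_entries :: "nat \<Rightarrow> 'b based_space \<Rightarrow> bool" where
  "yangian_entries n B \<longleftrightarrow> finite (basis B) \<and>
     (\<forall>i\<in>{1..n}. \<forall>j\<in>{1..n}. \<forall>x\<in>basis B. \<forall>z\<in>basis B.
        coef B i j 0 x z = (if i = j \<and> x = z then 1 else 0)) \<and>
     (\<forall>i\<in>{1..n}. \<forall>j\<in>{1..n}. \<forall>k\<in>{1..n}. \<forall>l\<in>{1..n}. \<forall>x\<in>basis B. \<forall>z\<in>basis B. \<forall>r s.
        (\<Sum>y\<in>basis B. coef B i j (Suc r) x y * coef B k l s y z
           - coef B k l s x y * coef B i j (Suc r) y z
           - (coef B i j r x y * coef B k l (Suc s) y z
              - coef B k l (Suc s) x y * coef B i j r y z))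
        = (\<Sum>y\<in>basis B. coef B k j r x y * coef B i l s y z - coef B k j s x y * coef B i l r y z))"

lemma sum_delta_left:
  fixes g :: "'b \<Rightarrow> complex"
  assumes "finite Z" "x \<in> Z"
  shows "(\<Sum>y\<in>Z. (if a \<and> x = y then 1 else 0) * g y) = (if a then g x else 0)"
  using assms by (simp add: if_distrib[of "\<lambda>u. u * _"] sum.delta' cong: if_cong)

lemma sum_delta_right:
  fixes g :: "'b \<Rightarrow> complex"
  assumes "finite Z" "z \<in> Z"
  shows "(\<Sum>y\<in>Z. g y * (if a \<and> y = z then 1 else 0)) = (if a then g z else 0)"
  using assms by (simp add: if_distrib[of "\<lambda>u. _ * u"] sum.delta cong: if_cong)

lemma yangian_entries_Phi: "yangian_entries n (Phi n d t)"
proof -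
  let ?Z = "ext_basis n d"
  have coef: "coef (Phi n d t) i j r x y
      = (if r = 0 then (if i = j \<and> x = y then 1 else 0) else t ^ (r - 1) * ext_E i j x y)"
    for i j r x y
    by (simp add: Phi_def)
  have coef0: "coef (Phi n d t) i j 0 x y = (if i = j \<and> x = y then 1 else 0)" for i j x y
    by (simp add: coef)
  have coef1: "coef (Phi n d t) i j (Suc r) x y = t ^ r * ext_E i j x y" for i j r x y
    by (simp add: coef)
  have *: "(\<Sum>y\<in>?Z. (t ^ a * ext_E i j x y) * (t ^ b * ext_E k l y z)) =
      t ^ a * t ^ b * (\<Sum>y\<in>?Z. ext_E i j x y * ext_E k l y z)" for i j k l x z a b
    by (simp add: sum_distrib_left mult_ac)
  have rel: "(\<Sum>y\<in>?Z. coef (Phi n d t) i j (Suc r) x y * coef (Phi n d t) k l s y z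
           - coef (Phi n d t) k l s x y * coef (Phi n d t) i j (Suc r) y z
           - (coef (Phi n d t) i j r x y * coef (Phi n d t) k l (Suc s) y z
              - coef (Phi n d t) k l (Suc s) x y * coef (Phi n d t) i j r y z))
        = (\<Sum>y\<in>?Z. coef (Phi n d t) k j r x y * coef (Phi n d t) i l s y z
            - coef (Phi n d t) k j s x y * coef (Phi n d t) i l r y z)"
    if ijkl: "i \<in> {1..n}" "j \<in> {1..n}" "k \<in> {1..n}" "l \<in> {1..n}" and xz: "x \<in> ?Z" "z \<in> ?Z"
    for i j k l r s x z
  proof -
    have comm: "(\<Sum>y\<in>?Z. ext_E i j x y * ext_E k l y z)
        = (\<Sum>y\<in>?Z. ext_E k l x y * ext_E i j y z)
          + (if j = k then ext_E i l x z else 0) - (if i = l then ext_E k j x z else 0)"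
      using ext_E_commutator[of i j k l n x d z] ijkl xz by (simp add: algebra_simps)
    show ?thesis
    proof -
      have delta: "(\<Sum>y\<in>?Z. (if a \<and> x = y then 1 else 0) * g y) = (if a then g x else 0)"
          "(\<Sum>y\<in>?Z. g y * (if a \<and> y = z then 1 else 0)) = (if a then g z else 0)"
        for a and g :: "nat set \<Rightarrow> complex"
        using xz by (simp_all add: sum_delta_left sum_delta_right)
      show ?thesis
      proof (cases r; cases s)
        assume "r = 0" "s = 0"
        then show ?thesis
          by (simp add: coef0 coef1 sum_subtractf delta)
      next
        fix s' assume "r = 0" "s = Suc s'"
        then show ?thesis
          by (simp only: coef0 coef1 sum_subtractf delta * comm)
             (auto simp: algebra_simps)
      next
        fix r' assume "r = Suc r'" "s = 0"
        then show ?thesis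
          by (simp only: coef0 coef1 sum_subtractf delta * comm)
             (auto simp: algebra_simps)
      next
        fix r' s' assume "r = Suc r'" "s = Suc s'"
        then show ?thesis
          by (simp only: coef1 * sum_subtractf) (simp add: algebra_simps)
      qed
    qed
  qed
  show ?thesis
    unfolding yangian_entries_def basis_Phi
    by (intro conjI ballI allI rel) (simp_all add: coef)
qed

section \<open>Tensor products\<close>

subsection \<open>Series of matrix entries\<close>

definition ser :: "'b based_space \<Rightarrow> nat \<Rightarrow> nat \<Rightarrow> 'b \<Rightarrow> 'b \<Rightarrow> complex fps" where
  "ser B i j x y = Abs_fps (\<lambda>r. coef B i j r x y)"

lemma ser_nth [simp]: "fps_nth (ser B i j x y) r = coef B i j r x y"
  by (simp add: ser_def)

lemma ser_tensor_Nil: "ser (tensor n []) i j xs ys = (if i = j then 1 else 0)"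
  by (rule fps_ext) (simp add: tensor_def)

lemma ser_tensor_Cons:
  "ser (tensor n (B # Bs)) i j xs ys
    = (\<Sum>k = 1..n. ser B i k (hd xs) (hd ys) * ser (tensor n Bs) k j (tl xs) (tl ys))"
  by (rule fps_ext) (simp add: tensor_def fps_sum_nth fps_mult_nth)

lemma basis_tensor_Nil: "basis (tensor n []) = {[]}"
  by (simp add: tensor_def)

lemma basis_tensor_Cons:
  "basis (tensor n (B # Bs)) = (\<lambda>(x, xs). x # xs) ` (basis B \<times> basis (tensor n Bs))"
  by (auto simp: tensor_def set_Cons_def)

lemma sum_basis_tensor_Cons:
  "(\<Sum>ys\<in>basis (tensor n (B # Bs)). f ys)
    = (\<Sum>y\<in>basis B. \<Sum>ys\<in>basis (tensor n Bs). f (y # ys))"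
proof -
  have "inj_on (\<lambda>(x, xs). x # xs) (basis B \<times> basis (tensor n Bs))"
    by (auto simp: inj_on_def)
  then show ?thesis
    by (simp add: basis_tensor_Cons sum.reindex sum.cartesian_product split_def)
qed

subsection \<open>The defining relations for a tensor product\<close>

text \<open>
  With \<open>P i j k l\<close> and \<open>Q i j k l\<close> the matrix entries of \<open>T_ij(x) T_kl(y)\<close> and of
  \<open>T_kl(y) T_ij(x)\<close>, the defining relation is linear in \<open>P\<close> and \<open>Q\<close>.
\<close>

lemma rtt_product:
  fixes P Q P' Q' :: "nat \<Rightarrow> nat \<Rightarrow> nat \<Rightarrow> nat \<Rightarrow> 'r :: comm_ring_1"
  assumes PQ: "\<And>i j k l. {i, j, k, l} \<subseteq> J \<Longrightarrow> d * (P i j k l - Q i j k l) = c * (P k j i l - Q i l k j)"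
    and PQ': "\<And>i j k l. {i, j, k, l} \<subseteq> J \<Longrightarrow> d * (P' i j k l - Q' i j k l) = c * (P' k j i l - Q' i l k j)"
    and ijkl: "{i, j, k, l} \<subseteq> J"
  shows "d * ((\<Sum>p\<in>J. \<Sum>q\<in>J. P i p k q * P' p j q l) - (\<Sum>p\<in>J. \<Sum>q\<in>J. Q i p k q * Q' p j q l))
    = c * ((\<Sum>p\<in>J. \<Sum>q\<in>J. P k p i q * P' p j q l) - (\<Sum>p\<in>J. \<Sum>q\<in>J. Q i p k q * Q' p l q j))"
proof -
  \<comment> \<open>Telescoping P P' - Q Q' = (P - Q) P' + Q (P' - Q') makes the relation applicable
    in each tensor factor separately.\<close>
  have "d * ((\<Sum>p\<in>J. \<Sum>q\<in>J. P i p k q * P' p j q l) - (\<Sum>p\<in>J. \<Sum>q\<in>J. Q i p k q * Q' p j q l))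
    = (\<Sum>p\<in>J. \<Sum>q\<in>J. d * (P i p k q - Q i p k q) * P' p j q l + Q i p k q * (d * (P' p j q l - Q' p j q l)))"
    by (simp add: sum_subtractf sum_distrib_left sum.distrib algebra_simps)
  also have "\<dots> = (\<Sum>p\<in>J. \<Sum>q\<in>J. c * (P k p i q - Q i q k p) * P' p j q l + Q i p k q * (c * (P' q j p l - Q' p l q j)))"
  proof (intro sum.cong refl)
    fix p q assume "p \<in> J" "q \<in> J"
    then have "d * (P i p k q - Q i p k q) = c * (P k p i q - Q i q k p)"
        "d * (P' p j q l - Q' p j q l) = c * (P' q j p l - Q' p l q j)"
      using ijkl by (auto intro!: PQ PQ')
    then show "d * (P i p k q - Q i p k q) * P' p j q l + Q i p k q * (d * (P' p j q l - Q' p j q l))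
      = c * (P k p i q - Q i q k p) * P' p j q l + Q i p k q * (c * (P' q j p l - Q' p l q j))"
      by simp
  qed
  also have "\<dots> = (\<Sum>p\<in>J. \<Sum>q\<in>J. c * P k p i q * P' p j q l) - (\<Sum>p\<in>J. \<Sum>q\<in>J. c * Q i q k p * P' p j q l)
     + ((\<Sum>p\<in>J. \<Sum>q\<in>J. c * Q i p k q * P' q j p l) - (\<Sum>p\<in>J. \<Sum>q\<in>J. c * Q i p k q * Q' p l q j))"
    by (simp add: sum_subtractf sum.distrib algebra_simps)
  \<comment> \<open>The mixed terms Q P' produced by the two halves agree after exchanging the names
    of \<open>p\<close> and \<open>q\<close>, and cancel.\<close>
  also have "(\<Sum>p\<in>J. \<Sum>q\<in>J. c * Q i q k p * P' p j q l) = (\<Sum>p\<in>J. \<Sum>q\<in>J. c * Q i p k q * P' q j p l)"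
    by (rule sum.swap)
  finally show ?thesis
    by (simp add: sum_distrib_left algebra_simps)
qed

text \<open>
  Series in \<open>x^(-1)\<close> and \<open>y^(-1)\<close>, the inner variable being \<open>x^(-1)\<close>. After division by \<open>x y\<close> the
  factor \<open>x - y\<close> of the defining relation becomes \<open>y^(-1) - x^(-1)\<close>.
\<close>

definition in_x :: "complex fps \<Rightarrow> complex fps fps" where
  "in_x f = fps_const f"

definition in_y :: "complex fps \<Rightarrow> complex fps fps" where
  "in_y f = Abs_fps (\<lambda>s. fps_const (fps_nth f s))"

lemma in_x_mult: "in_x (f * g) = in_x f * in_x g"
  by (simp add: in_x_def)

lemma in_x_sum: "in_x (sum f A) = (\<Sum>a\<in>A. in_x (f a))"
  by (rule fps_ext) (simp add: in_x_def fps_sum_nth)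

lemma in_y_sum: "in_y (sum f A) = (\<Sum>a\<in>A. in_y (f a))"
  by (intro fps_ext) (simp add: in_y_def fps_sum_nth)

lemma in_y_mult: "in_y (f * g) = in_y f * in_y g"
  by (intro fps_ext) (simp add: in_y_def fps_mult_nth fps_sum_nth)

lemma in_x_in_y_nth: "fps_nth (fps_nth (in_x f * in_y g) s) r = fps_nth f r * fps_nth g s"
  by (simp add: in_x_def in_y_def)

definition entries_xy :: "'b based_space \<Rightarrow> 'b \<Rightarrow> 'b \<Rightarrow> nat \<Rightarrow> nat \<Rightarrow> nat \<Rightarrow> nat \<Rightarrow> complex fps fps" where
  "entries_xy B x z i j k l = (\<Sum>y\<in>basis B. in_x (ser B i j x y) * in_y (ser B k l y z))"

definition entries_yx :: "'b based_space \<Rightarrow> 'b \<Rightarrow> 'b \<Rightarrow> nat \<Rightarrow> nat \<Rightarrow> nat \<Rightarrow> nat \<Rightarrow> complex fps fps" where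
  "entries_yx B x z i j k l = (\<Sum>y\<in>basis B. in_y (ser B k l x y) * in_x (ser B i j y z))"

lemma entries_xy_nth:
  "fps_nth (fps_nth (entries_xy B x z i j k l) s) r = (\<Sum>y\<in>basis B. coef B i j r x y * coef B k l s y z)"
  by (simp add: entries_xy_def fps_sum_nth in_x_in_y_nth)

lemma entries_yx_nth:
  "fps_nth (fps_nth (entries_yx B x z i j k l) s) r = (\<Sum>y\<in>basis B. coef B k l s x y * coef B i j r y z)"
  by (simp add: entries_yx_def fps_sum_nth in_x_in_y_nth mult.commute[of "in_y _"] mult.commute[of "coef _ _ _ r _ _"])

abbreviation (input) inv_diff :: "complex fps fps" where
  "inv_diff \<equiv> fps_X - fps_const fps_X"

abbreviation (input) inv_prod :: "complex fps fps" where
  "inv_prod \<equiv> fps_const fps_X * fps_X"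

lemma inv_diff_nth:
  "fps_nth (fps_nth (inv_diff * G) s) r
    = (if s = 0 then 0 else fps_nth (fps_nth G (s - 1)) r)
      - (if r = 0 then 0 else fps_nth (fps_nth G s) (r - 1))"
  by (simp add: left_diff_distrib)

lemma inv_prod_nth:
  "fps_nth (fps_nth (inv_prod * G) s) r
    = (if s = 0 \<or> r = 0 then 0 else fps_nth (fps_nth G (s - 1)) (r - 1))"
  by (simp add: mult.assoc)

text \<open>When \<open>r = 0\<close> or \<open>s = 0\<close> the right-hand side contributes
  nothing, so the constant terms of \<open>G\<close> vanish. For commutators this is automatic
  because T^(0) is scalar; hence the coefficientwise relations are equivalent to one identity of
  series, the form that passes to tensor products.\<close>

lemma rtt_iff:
  "inv_diff * G = inv_prod * H \<longleftrightarrow>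
     (\<forall>r. fps_nth (fps_nth G 0) r = 0) \<and> (\<forall>s. fps_nth (fps_nth G s) 0 = 0) \<and>
     (\<forall>r s. fps_nth (fps_nth G s) (Suc r) - fps_nth (fps_nth G (Suc s)) r = fps_nth (fps_nth H s) r)"
  (is "?L \<longleftrightarrow> ?R")
proof
  assume ?L
  then have eq: "fps_nth (fps_nth (inv_diff * G) s) r = fps_nth (fps_nth (inv_prod * H) s) r" for r s
    by simp
  show ?R
  proof (intro conjI allI)
    show "fps_nth (fps_nth G 0) r = 0" for r
      using eq[of 0 "Suc r"] unfolding inv_diff_nth inv_prod_nth by simp
    show "fps_nth (fps_nth G s) 0 = 0" for s
      using eq[of "Suc s" 0] unfolding inv_diff_nth inv_prod_nth by simp
    show "fps_nth (fps_nth G s) (Suc r) - fps_nth (fps_nth G (Suc s)) r = fps_nth (fps_nth H s) r" for r s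
      using eq[of "Suc s" "Suc r"] unfolding inv_diff_nth inv_prod_nth by simp
  qed
next
  assume R: ?R
  show ?L
  proof (intro fps_ext)
    fix s r
    show "fps_nth (fps_nth (inv_diff * G) s) r = fps_nth (fps_nth (inv_prod * H) s) r"
      unfolding inv_diff_nth inv_prod_nth using R by (cases s; cases r) auto
  qed
qed

lemma yangian_entries_iff_rtt:
  "yangian_entries n B \<longleftrightarrow> finite (basis B) \<and>
     (\<forall>i\<in>{1..n}. \<forall>j\<in>{1..n}. \<forall>x\<in>basis B. \<forall>z\<in>basis B.
        coef B i j 0 x z = (if i = j \<and> x = z then 1 else 0)) \<and>
     (\<forall>i\<in>{1..n}. \<forall>j\<in>{1..n}. \<forall>k\<in>{1..n}. \<forall>l\<in>{1..n}. \<forall>x\<in>basis B. \<forall>z\<in>basis B.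
        inv_diff * (entries_xy B x z i j k l - entries_yx B x z i j k l)
        = inv_prod * (entries_xy B x z k j i l - entries_yx B x z i l k j))"
proof -
  have "(\<forall>r s. (\<Sum>y\<in>basis B. coef B i j (Suc r) x y * coef B k l s y z
           - coef B k l s x y * coef B i j (Suc r) y z
           - (coef B i j r x y * coef B k l (Suc s) y z
              - coef B k l (Suc s) x y * coef B i j r y z))
        = (\<Sum>y\<in>basis B. coef B k j r x y * coef B i l s y z - coef B k j s x y * coef B i l r y z))
     \<longleftrightarrow> inv_diff * (entries_xy B x z i j k l - entries_yx B x z i j k l)
        = inv_prod * (entries_xy B x z k j i l - entries_yx B x z i l k j)"
    if fin: "finite (basis B)" and xz: "x \<in> basis B" "z \<in> basis B"
      and ijkl: "i \<in> {1..n}" "j \<in> {1..n}" "k \<in> {1..n}" "l \<in> {1..n}"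
      and coef0: "\<And>i j x z. i \<in> {1..n} \<Longrightarrow> j \<in> {1..n} \<Longrightarrow> x \<in> basis B \<Longrightarrow> z \<in> basis B \<Longrightarrow>
        coef B i j 0 x z = (if i = j \<and> x = z then 1 else 0)"
    for i j k l x z
  proof -
    have "(\<Sum>y\<in>basis B. coef B i j 0 x y * g y) = (if i = j then g x else 0)"
        "(\<Sum>y\<in>basis B. g y * coef B k l 0 y z) = (if k = l then g z else 0)"
        "(\<Sum>y\<in>basis B. coef B k l 0 x y * g y) = (if k = l then g x else 0)"
        "(\<Sum>y\<in>basis B. g y * coef B i j 0 y z) = (if i = j then g z else 0)" for g
      using fin xz ijkl by (simp_all add: coef0 sum_delta_left sum_delta_right cong: sum.cong)
    then have "fps_nth (fps_nth (entries_xy B x z i j k l - entries_yx B x z i j k l) 0) r = 0"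
        "fps_nth (fps_nth (entries_xy B x z i j k l - entries_yx B x z i j k l) s) 0 = 0" for r s
      by (simp_all add: entries_xy_nth entries_yx_nth)
    then show ?thesis
      unfolding rtt_iff
      by (simp only: fps_sub_nth entries_xy_nth entries_yx_nth sum_subtractf simp_thms)
  qed
  then show ?thesis
    unfolding yangian_entries_def by (intro conj_cong refl ball_cong) blast+
qed

lemma sum_product4:
  fixes a b c d :: "_ \<Rightarrow> _ \<Rightarrow> 'r :: comm_ring_1"
  shows "(\<Sum>y\<in>Z. \<Sum>v\<in>W. (\<Sum>p\<in>J. a p y * b p v) * (\<Sum>q\<in>J. c q y * d q v))
    = (\<Sum>p\<in>J. \<Sum>q\<in>J. (\<Sum>y\<in>Z. a p y * c q y) * (\<Sum>v\<in>W. b p v * d q v))"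
proof -
  have "(\<Sum>y\<in>Z. \<Sum>v\<in>W. (\<Sum>p\<in>J. a p y * b p v) * (\<Sum>q\<in>J. c q y * d q v))
    = (\<Sum>y\<in>Z. \<Sum>v\<in>W. \<Sum>p\<in>J. \<Sum>q\<in>J. (a p y * c q y) * (b p v * d q v))"
    by (simp add: sum_product mult_ac)
  also have "\<dots> = (\<Sum>y\<in>Z. \<Sum>p\<in>J. \<Sum>v\<in>W. \<Sum>q\<in>J. (a p y * c q y) * (b p v * d q v))"
    by (rule sum.cong[OF refl sum.swap])
  also have "\<dots> = (\<Sum>p\<in>J. \<Sum>y\<in>Z. \<Sum>v\<in>W. \<Sum>q\<in>J. (a p y * c q y) * (b p v * d q v))"
    by (rule sum.swap)
  also have "\<dots> = (\<Sum>p\<in>J. \<Sum>y\<in>Z. \<Sum>q\<in>J. \<Sum>v\<in>W. (a p y * c q y) * (b p v * d q v))"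
    by (rule sum.cong[OF refl], rule sum.cong[OF refl], rule sum.swap)
  also have "\<dots> = (\<Sum>p\<in>J. \<Sum>q\<in>J. \<Sum>y\<in>Z. \<Sum>v\<in>W. (a p y * c q y) * (b p v * d q v))"
    by (rule sum.cong[OF refl], rule sum.swap)
  also have "\<dots> = (\<Sum>p\<in>J. \<Sum>q\<in>J. (\<Sum>y\<in>Z. a p y * c q y) * (\<Sum>v\<in>W. b p v * d q v))"
    by (simp add: sum_product)
  finally show ?thesis .
qed

lemma entries_xy_tensor:
  "entries_xy (tensor n (B # Bs)) (x # xs) (z # zs) i j k l
    = (\<Sum>p = 1..n. \<Sum>q = 1..n. entries_xy B x z i p k q * entries_xy (tensor n Bs) xs zs p j q l)"
  by (simp add: entries_xy_def sum_basis_tensor_Cons ser_tensor_Cons in_x_sum in_y_sum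
      in_x_mult in_y_mult sum_product4)

lemma entries_yx_tensor:
  "entries_yx (tensor n (B # Bs)) (x # xs) (z # zs) i j k l
    = (\<Sum>p = 1..n. \<Sum>q = 1..n. entries_yx B x z i p k q * entries_yx (tensor n Bs) xs zs p j q l)"
  unfolding entries_yx_def sum_basis_tensor_Cons ser_tensor_Cons in_x_sum in_y_sum
      in_x_mult in_y_mult list.sel sum_product4
  by (rule sum.swap)

lemma yangian_entries_tensor:
  assumes "\<forall>B\<in>set Bs. yangian_entries n B"
  shows "yangian_entries n (tensor n Bs)"
  using assms
proof (induction Bs)
  case Nil
  show ?case
    by (auto simp: yangian_entries_def tensor_def)
next
  case (Cons B Bs)
  let ?J = "{1..n}"
  have B: "yangian_entries n B" and Bs: "yangian_entries n (tensor n Bs)"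
    using Cons by auto
  have fin: "finite (basis (tensor n (B # Bs)))"
    using B Bs by (simp add: basis_tensor_Cons yangian_entries_def)
  have coef0: "coef (tensor n (B # Bs)) i j 0 (x # xs) (z # zs) = (if i = j \<and> x # xs = z # zs then 1 else 0)"
    if "i \<in> ?J" "j \<in> ?J" "x \<in> basis B" "z \<in> basis B" "xs \<in> basis (tensor n Bs)" "zs \<in> basis (tensor n Bs)"
    for i j x z xs zs
  proof -
    have "coef (tensor n (B # Bs)) i j 0 (x # xs) (z # zs)
        = (\<Sum>k = 1..n. coef B i k 0 x z * coef (tensor n Bs) k j 0 xs zs)"
      by (simp add: tensor_def)
    also have "\<dots> = (\<Sum>k = 1..n. if k = i then (if x = z \<and> i = j \<and> xs = zs then 1 else 0) else 0)"
      using B Bs that by (intro sum.cong) (auto simp: yangian_entries_def)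
    finally show ?thesis
      using that by (auto simp: sum.delta)
  qed
  have rtt: "inv_diff * (entries_xy (tensor n (B # Bs)) (x # xs) (z # zs) i j k l
        - entries_yx (tensor n (B # Bs)) (x # xs) (z # zs) i j k l)
      = inv_prod * (entries_xy (tensor n (B # Bs)) (x # xs) (z # zs) k j i l
        - entries_yx (tensor n (B # Bs)) (x # xs) (z # zs) i l k j)"
    if "i \<in> ?J" "j \<in> ?J" "k \<in> ?J" "l \<in> ?J"
      and "x \<in> basis B" "z \<in> basis B" "xs \<in> basis (tensor n Bs)" "zs \<in> basis (tensor n Bs)"
    for i j k l x z xs zs
    unfolding entries_xy_tensor entries_yx_tensor
    using B Bs that by (intro rtt_product[where J = ?J]) (auto simp: yangian_entries_iff_rtt)
  show ?case
    unfolding yangian_entries_iff_rtt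
    using fin coef0 rtt by (auto simp: basis_tensor_Cons)
qed

section \<open>Tensor products of exterior powers and their transposes\<close>

definition ext_tensor :: "nat \<Rightarrow> (nat \<times> complex) list \<Rightarrow> nat set list based_space" where
  "ext_tensor n L = tensor n (map (\<lambda>(k, t). Phi n k t) L)"

lemma yangian_entries_ext_tensor: "yangian_entries n (ext_tensor n L)"
  unfolding ext_tensor_def
  by (rule yangian_entries_tensor) (auto simp: yangian_entries_Phi)

lemma finite_basis_ext_tensor [simp]: "finite (basis (ext_tensor n L))"
  using yangian_entries_ext_tensor[of n L] by (simp add: yangian_entries_def)

lemma ext_tensor_Nil: "ext_tensor n [] = tensor n []"
  by (simp add: ext_tensor_def)

lemma basis_ext_tensor_Nil: "basis (ext_tensor n []) = {[]}"
  by (simp add: ext_tensor_def basis_tensor_Nil)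

lemma basis_ext_tensor_Cons:
  "basis (ext_tensor n ((k, t) # L)) = (\<lambda>(x, xs). x # xs) ` (ext_basis n k \<times> basis (ext_tensor n L))"
  by (simp add: ext_tensor_def basis_tensor_Cons basis_Phi)

lemma Cons_in_basis_ext_tensor [simp]:
  "x # xs \<in> basis (ext_tensor n ((k, t) # L)) \<longleftrightarrow> x \<in> ext_basis n k \<and> xs \<in> basis (ext_tensor n L)"
  by (auto simp: basis_ext_tensor_Cons)

lemma in_basis_ext_tensor_iff:
  "xs \<in> basis (ext_tensor n L) \<longleftrightarrow> list_all2 (\<lambda>x p. x \<in> ext_basis n (fst p)) xs L"
proof (induction L arbitrary: xs)
  case Nil
  then show ?case
    by (simp add: basis_ext_tensor_Nil)
next
  case (Cons p L)
  then show ?case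
    by (cases p; cases xs) (auto simp: basis_ext_tensor_Cons)
qed

lemma rev_in_basis_ext_tensor [simp]:
  "rev xs \<in> basis (ext_tensor n (rev L)) \<longleftrightarrow> xs \<in> basis (ext_tensor n L)"
  by (simp add: in_basis_ext_tensor_iff)

lemma sum_basis_ext_tensor_Cons:
  "(\<Sum>ys\<in>basis (ext_tensor n ((k, t) # L)). f ys)
    = (\<Sum>y\<in>ext_basis n k. \<Sum>ys\<in>basis (ext_tensor n L). f (y # ys))"
  by (simp add: ext_tensor_def sum_basis_tensor_Cons basis_Phi)

lemma sum_basis_ext_tensor_rev:
  "(\<Sum>ys\<in>basis (ext_tensor n (rev L)). f ys) = (\<Sum>ys\<in>basis (ext_tensor n L). f (rev ys))"
  by (rule sum.reindex_bij_witness[of _ rev rev]) (use rev_in_basis_ext_tensor[of _ n "rev L"] in auto)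

lemma ser_ext_tensor_Cons:
  "ser (ext_tensor n ((k, t) # L)) i j (x # xs) (y # ys)
    = (\<Sum>p = 1..n. ser (Phi n k t) i p x y * ser (ext_tensor n L) p j xs ys)"
  by (simp add: ext_tensor_def ser_tensor_Cons)

lemma ser_ext_tensor_Nil: "ser (ext_tensor n []) i j xs ys = (if i = j then 1 else 0)"
  by (simp add: ext_tensor_Nil ser_tensor_Nil)

lemma sum_if_eq:
  fixes g :: "nat \<Rightarrow> 'r :: semiring_1"
  assumes "i \<in> {1..n}"
  shows "(\<Sum>k = 1..n. (if i = k then 1 else 0) * g k) = g i"
    "(\<Sum>k = 1..n. g k * (if k = i then 1 else 0)) = g i"
  using assms
  by (simp_all add: if_distrib[of "\<lambda>u. u * _"] if_distrib[of "\<lambda>u. _ * u"] sum.delta sum.delta'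
      cong: if_cong)

text \<open>Coassociativity. It allows the last factor to be split off, as needed for reversed
  lists, whereas the definition only splits off the first.\<close>

lemma ser_ext_tensor_append:
  assumes "length xs = length L" "length ys = length L" "i \<in> {1..n}"
  shows "ser (ext_tensor n (L @ L')) i j (xs @ xs') (ys @ ys')
    = (\<Sum>p = 1..n. ser (ext_tensor n L) i p xs ys * ser (ext_tensor n L') p j xs' ys')"
  using assms
proof (induction L arbitrary: xs ys i)
  case Nil
  then show ?case
    by (simp add: ser_ext_tensor_Nil sum_if_eq del: One_nat_def)
next
  case (Cons q L)
  obtain k t where q: "q = (k, t)"
    by force
  obtain x xs1 y ys1 where xs: "xs = x # xs1" and ys: "ys = y # ys1"
    using Cons.prems by (metis length_Suc_conv)
  have "ser (ext_tensor n ((q # L) @ L')) i j (xs @ xs') (ys @ ys')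
    = (\<Sum>p = 1..n. \<Sum>p' = 1..n. ser (Phi n k t) i p x y * ser (ext_tensor n L) p p' xs1 ys1
         * ser (ext_tensor n L') p' j xs' ys')"
    using Cons.prems
    by (simp add: q xs ys ser_ext_tensor_Cons Cons.IH sum_distrib_left mult.assoc)
  also have "\<dots> = (\<Sum>p' = 1..n. \<Sum>p = 1..n. ser (Phi n k t) i p x y * ser (ext_tensor n L) p p' xs1 ys1
         * ser (ext_tensor n L') p' j xs' ys')"
    by (rule sum.swap)
  finally show ?case
    by (simp add: q xs ys ser_ext_tensor_Cons sum_distrib_right)
qed

lemma ser_Phi_sym:
  assumes "x \<in> ext_basis n k" "y \<in> ext_basis n k"
  shows "ser (Phi n k t) i j x y = ser (Phi n k t) j i y x"
  using assms by (intro fps_ext) (auto simp: Phi_def intro: ext_E_sym ext_basis_finite)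

lemma ser_ext_tensor_single:
  assumes "j \<in> {1..n}"
  shows "ser (ext_tensor n [(k, t)]) i j [x] [y] = ser (Phi n k t) i j x y"
  using assms by (simp add: ser_ext_tensor_Cons ser_ext_tensor_Nil sum_if_eq del: One_nat_def)

text \<open>The anti-automorphism exchanging T_ij and T_ji reverses the coproduct, and on a single
  exterior power it is transposition. Thus the tensor product in the reverse order is the dual of
  the original one, twisted by this anti-automorphism.\<close>

lemma ser_ext_tensor_rev:
  assumes "xs \<in> basis (ext_tensor n L)" "ys \<in> basis (ext_tensor n L)" "i \<in> {1..n}" "j \<in> {1..n}"
  shows "ser (ext_tensor n (rev L)) i j (rev xs) (rev ys) = ser (ext_tensor n L) j i ys xs"
  using assms
proof (induction L arbitrary: xs ys i j)
  case Nil
  then show ?case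
    by (simp add: ser_ext_tensor_Nil)
next
  case (Cons q L)
  obtain k t where q: "q = (k, t)"
    by force
  obtain x xs1 y ys1 where xs: "xs = x # xs1" and ys: "ys = y # ys1"
    using Cons.prems by (auto simp: q basis_ext_tensor_Cons)
  have mem: "x \<in> ext_basis n k" "y \<in> ext_basis n k"
      "xs1 \<in> basis (ext_tensor n L)" "ys1 \<in> basis (ext_tensor n L)"
    using Cons.prems by (auto simp: q xs ys)
  then have "length xs1 = length L" "length ys1 = length L"
    by (auto simp: in_basis_ext_tensor_iff dest: list_all2_lengthD)
  then have "ser (ext_tensor n (rev (q # L))) i j (rev xs) (rev ys)
     = (\<Sum>p = 1..n. ser (ext_tensor n (rev L)) i p (rev xs1) (rev ys1) * ser (Phi n k t) p j x y)"
    using Cons.prems by (simp add: q xs ys ser_ext_tensor_append ser_ext_tensor_single)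
  also have "\<dots> = (\<Sum>p = 1..n. ser (Phi n k t) j p y x * ser (ext_tensor n L) p i ys1 xs1)"
    using Cons.prems mem
    by (intro sum.cong) (auto simp: Cons.IH ser_Phi_sym[of x n k y] mult.commute)
  finally show ?case
    by (simp add: q xs ys ser_ext_tensor_Cons)
qed

lemma coef_ext_tensor_rev:
  assumes "xs \<in> basis (ext_tensor n L)" "ys \<in> basis (ext_tensor n L)" "i \<in> {1..n}" "j \<in> {1..n}"
  shows "coef (ext_tensor n (rev L)) i j r (rev xs) (rev ys) = coef (ext_tensor n L) j i r ys xs"
  using ser_ext_tensor_rev[OF assms] by (metis ser_nth)

section \<open>Stable subspaces\<close>

definition act :: "'b based_space \<Rightarrow> nat \<Rightarrow> nat \<Rightarrow> nat \<Rightarrow> ('b \<Rightarrow> complex) \<Rightarrow> 'b \<Rightarrow> complex" where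
  "act B i j r f x = (if x \<in> basis B then (\<Sum>y\<in>basis B. coef B i j r x y * f y) else 0)"

definition supported :: "'b based_space \<Rightarrow> ('b \<Rightarrow> complex) set" where
  "supported B = {f. \<forall>x. x \<notin> basis B \<longrightarrow> f x = 0}"

text \<open>Containment in \<open>supported B\<close> is left out: annihilators of a pairing and
  sets of word combinations can then be used directly, and \<open>act\<close> lands in
  \<open>supported B\<close> in any case.\<close>

definition stable :: "nat \<Rightarrow> 'b based_space \<Rightarrow> ('b \<Rightarrow> complex) set \<Rightarrow> bool" where
  "stable n B N \<longleftrightarrow> (\<lambda>_. 0) \<in> N \<and> (\<forall>f\<in>N. \<forall>g\<in>N. (\<lambda>x. f x + g x) \<in> N) \<and>
     (\<forall>c. \<forall>f\<in>N. (\<lambda>x. c * f x) \<in> N) \<and>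
     (\<forall>i\<in>{1..n}. \<forall>j\<in>{1..n}. \<forall>r. \<forall>f\<in>N. act B i j r f \<in> N)"

definition cyclic_vector :: "nat \<Rightarrow> 'b based_space \<Rightarrow> ('b \<Rightarrow> complex) \<Rightarrow> bool" where
  "cyclic_vector n B v \<longleftrightarrow> (\<forall>N. stable n B N \<longrightarrow> v \<in> N \<longrightarrow> supported B \<subseteq> N)"

lemma stable_zero: "stable n B N \<Longrightarrow> (\<lambda>_. 0) \<in> N"
  and stable_add: "stable n B N \<Longrightarrow> f \<in> N \<Longrightarrow> g \<in> N \<Longrightarrow> (\<lambda>x. f x + g x) \<in> N"
  and stable_smult: "stable n B N \<Longrightarrow> f \<in> N \<Longrightarrow> (\<lambda>x. c * f x) \<in> N"
  and stable_act: "stable n B N \<Longrightarrow> f \<in> N \<Longrightarrow> i \<in> {1..n} \<Longrightarrow> j \<in> {1..n} \<Longrightarrow> act B i j r f \<in> N"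
  by (auto simp: stable_def)

lemma stable_diff:
  assumes "stable n B N" "f \<in> N" "g \<in> N"
  shows "(\<lambda>x. f x - g x) \<in> N"
  using stable_add[OF assms(1,2) stable_smult[OF assms(1,3), of "-1"]] by simp

lemma stable_sum:
  assumes "stable n B N" "\<And>a. a \<in> A \<Longrightarrow> f a \<in> N"
  shows "(\<lambda>x. \<Sum>a\<in>A. f a x) \<in> N"
  using assms(2)
proof (induction A rule: infinite_finite_induct)
  case (insert a A)
  then show ?case
    using stable_add[OF assms(1), of "f a" "\<lambda>x. \<Sum>a\<in>A. f a x"] by simp
qed (simp_all add: stable_zero[OF assms(1)])

lemma supported_expansion:
  assumes "finite (basis B)" "f \<in> supported B"
  shows "f = (\<lambda>x. \<Sum>y\<in>basis B. f y * basis_vector y x)"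
proof
  fix x
  have "(\<Sum>y\<in>basis B. f y * basis_vector y x) = (\<Sum>y\<in>basis B. if x = y then f y else 0)"
    by (intro sum.cong) (auto simp: basis_vector_def)
  then show "f x = (\<Sum>y\<in>basis B. f y * basis_vector y x)"
    using assms by (auto simp: supported_def)
qed

lemma stable_basis_vectors:
  assumes "stable n B N" "finite (basis B)" "\<And>y. y \<in> basis B \<Longrightarrow> basis_vector y \<in> N"
  shows "supported B \<subseteq> N"
proof
  fix f assume f: "f \<in> supported B"
  then have "f = (\<lambda>x. \<Sum>y\<in>basis B. f y * basis_vector y x)"
    using assms(2) by (rule_tac supported_expansion)
  moreover have "\<dots> \<in> N"
    using assms by (intro stable_sum stable_smult[of n B N "basis_vector _"])
  ultimately show "f \<in> N"
    by simp
qed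

lemma act_supported: "act B i j r f \<in> supported B"
  by (simp add: act_def supported_def)

lemma act_add: "act B i j r (\<lambda>x. f x + g x) = (\<lambda>x. act B i j r f x + act B i j r g x)"
  by (auto simp: act_def fun_eq_iff algebra_simps sum.distrib)

lemma act_smult: "act B i j r (\<lambda>x. c * f x) = (\<lambda>x. c * act B i j r f x)"
  by (auto simp: act_def fun_eq_iff sum_distrib_left algebra_simps)

lemma act_zero: "act B i j r (\<lambda>_. 0) = (\<lambda>_. 0)"
  by (auto simp: act_def)

lemma act_basis_vector:
  assumes "finite (basis B)" "y \<in> basis B" "x \<in> basis B"
  shows "act B i j r (basis_vector y) x = coef B i j r x y"
  using assms sum_delta_right[of "basis B" y "coef B i j r x" True]
  by (simp add: act_def basis_vector_def)

subsection \<open>Evaluation of polynomials in the inverse variable\<close>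

definition fps_deg_le :: "complex fps \<Rightarrow> nat \<Rightarrow> bool" where
  "fps_deg_le f d \<longleftrightarrow> (\<forall>r>d. fps_nth f r = 0)"

text \<open>The value at \<open>x = y\<close> of \<open>x^d f(1/x)\<close>.\<close>

definition reversed_eval :: "nat \<Rightarrow> complex \<Rightarrow> complex fps \<Rightarrow> complex" where
  "reversed_eval d y f = (\<Sum>r\<le>d. fps_nth f r * y ^ (d - r))"

lemma fps_deg_le_mult:
  assumes "fps_deg_le f a" "fps_deg_le g b"
  shows "fps_deg_le (f * g) (a + b)"
  unfolding fps_deg_le_def fps_mult_nth
proof (intro allI impI sum.neutral ballI)
  fix r i assume "a + b < r" "i \<in> {0..r}"
  then have "a < i \<or> b < r - i"
    by auto
  then show "fps_nth f i * fps_nth g (r - i) = 0"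
    using assms by (auto simp: fps_deg_le_def)
qed

lemma fps_deg_le_sum: "(\<And>a. a \<in> A \<Longrightarrow> fps_deg_le (f a) d) \<Longrightarrow> fps_deg_le (sum f A) d"
  by (simp add: fps_deg_le_def fps_sum_nth)

lemma reversed_eval_add: "reversed_eval d y (f + g) = reversed_eval d y f + reversed_eval d y g"
  by (simp add: reversed_eval_def algebra_simps sum.distrib)

lemma reversed_eval_const_mult: "reversed_eval d y (fps_const c * f) = c * reversed_eval d y f"
  by (simp add: reversed_eval_def sum_distrib_left mult.assoc)

lemma reversed_eval_X_mult: "reversed_eval (Suc d) y (fps_X * f) = reversed_eval d y f"
  unfolding reversed_eval_def by (subst sum.atMost_Suc_shift) simp

lemma reversed_eval_Suc:
  assumes "fps_deg_le f d"
  shows "reversed_eval (Suc d) y f = y * reversed_eval d y f"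
proof -
  have "(\<Sum>r\<le>d. fps_nth f r * y ^ (Suc d - r)) = (\<Sum>r\<le>d. y * (fps_nth f r * y ^ (d - r)))"
    by (intro sum.cong) (auto simp: Suc_diff_le)
  then show ?thesis
    using assms by (simp add: reversed_eval_def fps_deg_le_def sum_distrib_left)
qed

lemma reversed_eval_linear_mult:
  assumes "fps_deg_le f d"
  shows "reversed_eval (Suc d) y ((1 + fps_const c * fps_X) * f) = (y + c) * reversed_eval d y f"
  by (simp add: distrib_right reversed_eval_add reversed_eval_Suc[OF assms] mult.assoc
      reversed_eval_const_mult reversed_eval_X_mult)

text \<open>Only finitely many coefficients enter, so a series of vectors of \<open>N\<close> can be
  multiplied by a scalar series and evaluated at a point without leaving \<open>N\<close>.\<close>

lemma stable_reversed_eval: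
  assumes "stable n B N" "\<And>r. u r \<in> N"
  shows "(\<lambda>x. reversed_eval d y (D * Abs_fps (\<lambda>r. u r x))) \<in> N"
proof -
  have "(\<lambda>x. \<Sum>r\<le>d. \<Sum>s = 0..r. (fps_nth D s * y ^ (d - r)) * u (r - s) x) \<in> N"
    by (intro stable_sum[OF assms(1)] stable_smult[OF assms(1)] assms(2))
  then show ?thesis
    by (simp add: reversed_eval_def fps_mult_nth sum_distrib_left mult_ac)
qed

subsection \<open>Highest vectors\<close>

text \<open>In the variable 1/x, the series \<open>fps_X * geo t\<close> is 1/(x - t), and
  \<open>lin c\<close> below is (x + c)/x.\<close>

definition geo :: "complex \<Rightarrow> complex fps" where
  "geo t = Abs_fps (\<lambda>r. t ^ r)"

abbreviation lin :: "complex \<Rightarrow> complex fps" where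
  "lin c \<equiv> 1 + fps_const c * fps_X"

lemma lin_geo: "lin (- t) * geo t = 1"
proof (rule fps_ext)
  fix r
  show "fps_nth (lin (- t) * geo t) r = fps_nth 1 r"
    by (cases r) (simp_all add: distrib_right mult.assoc geo_def fps_X_mult_nth)
qed

lemma ser_Phi:
  "ser (Phi n k t) i j x y = (if i = j \<and> x = y then 1 else 0) + fps_const (ext_E i j x y) * (fps_X * geo t)"
proof (rule fps_ext)
  fix r
  show "fps_nth (ser (Phi n k t) i j x y) r
    = fps_nth ((if i = j \<and> x = y then 1 else 0) + fps_const (ext_E i j x y) * (fps_X * geo t)) r"
    by (cases r) (simp_all add: Phi_def geo_def)
qed

lemma lin_ser_Phi:
  "lin (- t) * ser (Phi n k t) i j x y
    = (if i = j \<and> x = y then lin (- t) else 0) + fps_const (ext_E i j x y) * fps_X"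
proof -
  have "lin (- t) * (fps_const c * (fps_X * geo t)) = fps_const c * fps_X * (lin (- t) * geo t)" for c
    by (simp only: mult_ac)
  then show ?thesis
    by (simp only: ser_Phi distrib_left lin_geo) auto
qed

lemma ext_E_top:
  "i \<ge> 1 \<Longrightarrow> i < j \<Longrightarrow> ext_E i j x {1..k} = 0"
  "j > k \<Longrightarrow> ext_E i j x {1..k} = 0"
  "i \<in> {1..k} \<Longrightarrow> ext_E i i x {1..k} = (if x = {1..k} then 1 else 0)"
proof -
  assume i: "i \<in> {1..k}"
  have "{s \<in> {1..k} - {i}. s < i} = {s \<in> {1..k}. s < i}" "insert i ({1..k} - {i}) = {1..k}"
    using i by auto
  then show "ext_E i i x {1..k} = (if x = {1..k} then 1 else 0)"
    using i by (auto simp: ext_E_def simp flip: power_mult_distrib)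
qed (auto simp: ext_E_def)

fun top_index :: "(nat \<times> complex) list \<Rightarrow> nat set list" where
  "top_index [] = []"
| "top_index ((k, t) # L) = {1..k} # top_index L"

lemma top_index_eq_map: "top_index L = map (\<lambda>(k, t). {1..k}) L"
  by (induction L rule: top_index.induct) auto

definition sized :: "nat \<Rightarrow> (nat \<times> complex) list \<Rightarrow> bool" where
  "sized n L \<longleftrightarrow> (\<forall>(k, t)\<in>set L. k \<le> n)"

lemma sized_simps [simp]: "sized n []" "sized n ((k, t) # L) \<longleftrightarrow> k \<le> n \<and> sized n L"
  by (auto simp: sized_def)

lemma interval_in_ext_basis: "k \<le> n \<Longrightarrow> {1..k} \<in> ext_basis n k"
  by (auto simp: ext_basis_def)

lemma top_index_in_basis: "sized n L \<Longrightarrow> top_index L \<in> basis (ext_tensor n L)"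
proof (induction L rule: top_index.induct)
  case 1
  then show ?case
    by (simp add: basis_ext_tensor_Nil)
next
  case (2 k t L)
  then show ?case
    using interval_in_ext_basis[of k n] by simp
qed

fun top_series :: "(nat \<times> complex) list \<Rightarrow> nat \<Rightarrow> complex fps" where
  "top_series [] i = 1"
| "top_series ((k, t) # L) i = (if i \<le> k then 1 + fps_X * geo t else 1) * top_series L i"

text \<open>In each coproduct term with inner index p, either i < p and the first factor is killed,
  or p \<le> i < j and the induction hypothesis kills the rest.\<close>

lemma ser_top_raise:
  assumes "i \<in> {1..n}" "i < j"
  shows "ser (ext_tensor n L) i j xs (top_index L) = 0"
  using assms
proof (induction L arbitrary: xs i rule: top_index.induct)
  case 1
  then show ?case
    by (simp add: ser_ext_tensor_Nil)
next
  case (2 k t L)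
  have "ser (ext_tensor n ((k, t) # L)) i j xs (top_index ((k, t) # L))
      = (\<Sum>p = 1..n. ser (Phi n k t) i p (hd xs) {1..k} * ser (ext_tensor n L) p j (tl xs) (top_index L))"
    by (simp add: ext_tensor_def ser_tensor_Cons)
  also have "\<dots> = 0"
  proof (intro sum.neutral ballI)
    fix p assume p: "p \<in> {1..n}"
    show "ser (Phi n k t) i p (hd xs) {1..k} * ser (ext_tensor n L) p j (tl xs) (top_index L) = 0"
    proof (cases "i < p")
      case True
      then show ?thesis
        using 2 by (simp add: ser_Phi ext_E_top del: One_nat_def)
    next
      case False
      then show ?thesis
        using 2 p by auto
    qed
  qed
  finally show ?case .
qed

lemma ser_Phi_top_diag:
  assumes "i \<ge> 1"
  shows "ser (Phi n k t) i i x {1..k} = (if x = {1..k} then if i \<le> k then 1 + fps_X * geo t else 1 else 0)"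
  using assms by (simp add: ser_Phi ext_E_top del: One_nat_def)

lemma ser_top_diag:
  assumes "i \<in> {1..n}" "xs \<in> basis (ext_tensor n L)"
  shows "ser (ext_tensor n L) i i xs (top_index L) = (if xs = top_index L then top_series L i else 0)"
  using assms
proof (induction L arbitrary: xs rule: top_index.induct)
  case 1
  then show ?case
    by (simp add: ser_ext_tensor_Nil basis_ext_tensor_Nil)
next
  case (2 k t L)
  then obtain x ys where xs: "xs = x # ys" and x: "x \<in> ext_basis n k" and ys: "ys \<in> basis (ext_tensor n L)"
    by (auto simp: basis_ext_tensor_Cons)
  have "ser (ext_tensor n ((k, t) # L)) i i xs (top_index ((k, t) # L))
      = (\<Sum>p = 1..n. ser (Phi n k t) i p x {1..k} * ser (ext_tensor n L) p i ys (top_index L))"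
    by (simp add: xs ser_ext_tensor_Cons)
  also have "\<dots> = (\<Sum>p\<in>{i}. ser (Phi n k t) i p x {1..k} * ser (ext_tensor n L) p i ys (top_index L))"
  proof (intro sum.mono_neutral_right ballI)
    fix p assume p: "p \<in> {1..n} - {i}"
    show "ser (Phi n k t) i p x {1..k} * ser (ext_tensor n L) p i ys (top_index L) = 0"
    proof (cases "i < p")
      case True
      then show ?thesis
        using 2 by (simp add: ser_Phi ext_E_top del: One_nat_def)
    next
      case False
      then show ?thesis
        using p by (simp add: ser_top_raise del: One_nat_def)
    qed
  qed (use 2 in auto)
  also have "\<dots> = (if xs = top_index ((k, t) # L) then top_series ((k, t) # L) i else 0)"
    using 2 ys by (simp add: xs ser_Phi_top_diag del: One_nat_def)
  finally show ?case .
qed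

text \<open>Over the \<open>top_deg\<close> factors with k \<ge> j, \<open>top_den\<close> is the
  product of (x - t)/x and \<open>top_num\<close> that of (x - t + 1)/x. They are denominator and
  numerator of the eigenvalue \<open>top_series\<close> of T_jj(x).\<close>

fun top_den :: "(nat \<times> complex) list \<Rightarrow> nat \<Rightarrow> complex fps" where
  "top_den [] j = 1"
| "top_den ((k, t) # L) j = (if j \<le> k then lin (- t) else 1) * top_den L j"

fun top_deg :: "(nat \<times> complex) list \<Rightarrow> nat \<Rightarrow> nat" where
  "top_deg [] j = 0"
| "top_deg ((k, t) # L) j = (if j \<le> k then 1 else 0) + top_deg L j"

fun top_num :: "(nat \<times> complex) list \<Rightarrow> nat \<Rightarrow> complex fps" where
  "top_num [] j = 1"
| "top_num ((k, t) # L) j = (if j \<le> k then lin (1 - t) else 1) * top_num L j"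

lemma fps_deg_le_lin: "fps_deg_le (lin c) 1"
  by (auto simp: fps_deg_le_def)

lemma top_den_series: "top_den L j * top_series L j = top_num L j"
proof (induction L j rule: top_series.induct)
  case (2 k t L i)
  have "lin (- t) * (1 + fps_X * geo t) = lin (- t) + fps_X * (lin (- t) * geo t)"
    by (simp only: distrib_left mult_1_right mult.left_commute[of "lin (- t)" fps_X])
  also have "\<dots> = lin (1 - t)"
    unfolding lin_geo by (simp add: algebra_simps fps_const_sub[symmetric] fps_const_neg[symmetric] del: fps_const_sub fps_const_neg)
  finally have "lin (- t) * (1 + fps_X * geo t) = lin (1 - t)" .
  then have "lin (- t) * top_den L i * ((1 + fps_X * geo t) * top_series L i) = lin (1 - t) * top_num L i"
    using 2 by (metis (no_types) mult.assoc mult.left_commute)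
  then show ?case
    using 2 by simp
qed simp

lemma fps_deg_le_top_num: "fps_deg_le (top_num L j) (top_deg L j)"
proof (induction L j rule: top_num.induct)
  case (2 k t L j)
  then show ?case
    using fps_deg_le_mult[OF fps_deg_le_lin 2] by auto
qed (simp add: fps_deg_le_def)

lemma reversed_eval_top_num_nonzero:
  assumes "\<forall>(k, t)\<in>set L. j \<le> k \<longrightarrow> y + 1 - t \<noteq> 0"
  shows "reversed_eval (top_deg L j) y (top_num L j) \<noteq> 0"
  using assms
proof (induction L j rule: top_num.induct)
  case (2 k t L j)
  then have IH: "reversed_eval (top_deg L j) y (top_num L j) \<noteq> 0"
    by simp
  show ?case
  proof (cases "j \<le> k")
    case True
    then have "y + (1 - t) \<noteq> 0"
      using 2 by (simp add: algebra_simps)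
    then show ?thesis
      using True IH reversed_eval_linear_mult[OF fps_deg_le_top_num[of L j], of y "1 - t"] by simp
  next
    case False
    then show ?thesis
      using IH by simp
  qed
qed (simp add: reversed_eval_def)

text \<open>The poles of T_jj(x) on the highest vector are the only ones in the whole column j:
  coproduct terms with p < j vanish, and for p \<ge> j > k the operator E_ip kills the highest
  vector of that factor, so it contributes no pole.\<close>

lemma fps_deg_le_top_den_ser:
  assumes "i \<in> {1..n}" "j \<in> {1..n}" "xs \<in> basis (ext_tensor n L)"
  shows "fps_deg_le (top_den L j * ser (ext_tensor n L) i j xs (top_index L)) (top_deg L j)"
  using assms
proof (induction L arbitrary: xs i rule: top_index.induct)
  case 1
  then show ?case
    by (simp add: ser_ext_tensor_Nil fps_deg_le_def)
next
  case (2 k t L)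
  then obtain x ys where xs: "xs = x # ys" and x: "x \<in> ext_basis n k" and ys: "ys \<in> basis (ext_tensor n L)"
    by (auto simp: basis_ext_tensor_Cons)
  let ?d = "if j \<le> k then lin (- t) else 1"
  have "top_den ((k, t) # L) j * ser (ext_tensor n ((k, t) # L)) i j xs (top_index ((k, t) # L))
    = (\<Sum>p = 1..n. (?d * ser (Phi n k t) i p x {1..k}) * (top_den L j * ser (ext_tensor n L) p j ys (top_index L)))"
    by (simp add: xs ser_ext_tensor_Cons sum_distrib_left mult_ac)
  moreover have "fps_deg_le ((?d * ser (Phi n k t) i p x {1..k}) * (top_den L j * ser (ext_tensor n L) p j ys (top_index L)))
      ((if j \<le> k then 1 else 0) + top_deg L j)" if p: "p \<in> {1..n}" for p
  proof (cases "p < j")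
    case True
    then show ?thesis
      using p by (simp add: ser_top_raise fps_deg_le_def del: One_nat_def)
  next
    case False
    have "fps_deg_le (?d * ser (Phi n k t) i p x {1..k}) (if j \<le> k then 1 else 0)"
    proof (cases "j \<le> k")
      case True
      then show ?thesis
        by (simp add: lin_ser_Phi del: One_nat_def) (auto simp: fps_deg_le_def)
    next
      case False
      then show ?thesis
        using \<open>\<not> p < j\<close> by (simp add: ser_Phi ext_E_top fps_deg_le_def del: One_nat_def)
    qed
    then show ?thesis
      using 2 p ys by (intro fps_deg_le_mult) auto
  qed
  ultimately show ?case
    by (simp only: top_deg.simps) (intro fps_deg_le_sum)
qed

section \<open>Cyclicity of the highest vector\<close>

fun ten :: "('b \<Rightarrow> complex) \<Rightarrow> ('b list \<Rightarrow> complex) \<Rightarrow> 'b list \<Rightarrow> complex" where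
  "ten v w [] = 0"
| "ten v w (x # xs) = v x * w xs"

lemma ten_add_right: "ten v (\<lambda>x. f x + g x) = (\<lambda>x. ten v f x + ten v g x)"
proof
  fix x show "ten v (\<lambda>x. f x + g x) x = ten v f x + ten v g x"
    by (cases x) (simp_all add: algebra_simps)
qed

lemma ten_smult_right: "ten v (\<lambda>x. c * f x) = (\<lambda>x. c * ten v f x)"
proof
  fix x show "ten v (\<lambda>x. c * f x) x = c * ten v f x"
    by (cases x) simp_all
qed

lemma ten_zero_right: "ten v (\<lambda>_. 0) = (\<lambda>_. 0)"
proof
  fix x show "ten v (\<lambda>_. 0) x = 0"
    by (cases x) simp_all
qed

lemma ten_smult_left: "ten (\<lambda>x. c * f x) w = (\<lambda>x. c * ten f w x)"
proof
  fix x show "ten (\<lambda>x. c * f x) w x = c * ten f w x"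
    by (cases x) simp_all
qed

lemma ten_basis_vector: "ten (basis_vector y) (basis_vector ys) = basis_vector (y # ys)"
proof
  fix x show "ten (basis_vector y) (basis_vector ys) x = basis_vector (y # ys) x"
    by (cases x) (simp_all add: basis_vector_def)
qed

lemma coef_ext_tensor_Cons:
  "coef (ext_tensor n ((k, t) # L)) i j r (x # xs) (y # ys)
    = (\<Sum>p = 1..n. \<Sum>s = 0..r. coef (Phi n k t) i p s x y * coef (ext_tensor n L) p j (r - s) xs ys)"
  by (simp add: ext_tensor_def tensor_def)

lemma act_ten:
  "act (ext_tensor n ((k, t) # L)) i j r (ten v w)
    = (\<lambda>x. \<Sum>p = 1..n. \<Sum>s = 0..r. ten (act (Phi n k t) i p s v) (act (ext_tensor n L) p j (r - s) w) x)"
proof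
  fix xs
  show "act (ext_tensor n ((k, t) # L)) i j r (ten v w) xs
    = (\<Sum>p = 1..n. \<Sum>s = 0..r. ten (act (Phi n k t) i p s v) (act (ext_tensor n L) p j (r - s) w) xs)"
  proof (cases "xs \<in> basis (ext_tensor n ((k, t) # L))")
    case True
    then obtain x ys where xs: "xs = x # ys" and x: "x \<in> ext_basis n k" and ys: "ys \<in> basis (ext_tensor n L)"
      by (auto simp: basis_ext_tensor_Cons)
    let ?Z = "ext_basis n k" and ?W = "basis (ext_tensor n L)"
    let ?a = "\<lambda>p s y. coef (Phi n k t) i p s x y * v y"
    let ?b = "\<lambda>p s zs. coef (ext_tensor n L) p j (r - s) ys zs * w zs"
    have "act (ext_tensor n ((k, t) # L)) i j r (ten v w) xs
        = (\<Sum>y\<in>?Z. \<Sum>zs\<in>?W. \<Sum>p = 1..n. \<Sum>s = 0..r. ?a p s y * ?b p s zs)"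
      using True unfolding xs act_def sum_basis_ext_tensor_Cons coef_ext_tensor_Cons
      by (simp add: sum_distrib_left sum_distrib_right mult_ac)
    also have "\<dots> = (\<Sum>y\<in>?Z. \<Sum>p = 1..n. \<Sum>zs\<in>?W. \<Sum>s = 0..r. ?a p s y * ?b p s zs)"
      by (rule sum.cong[OF refl sum.swap])
    also have "\<dots> = (\<Sum>p = 1..n. \<Sum>y\<in>?Z. \<Sum>zs\<in>?W. \<Sum>s = 0..r. ?a p s y * ?b p s zs)"
      by (rule sum.swap)
    also have "\<dots> = (\<Sum>p = 1..n. \<Sum>y\<in>?Z. \<Sum>s = 0..r. \<Sum>zs\<in>?W. ?a p s y * ?b p s zs)"
      by (rule sum.cong[OF refl], rule sum.cong[OF refl], rule sum.swap)
    also have "\<dots> = (\<Sum>p = 1..n. \<Sum>s = 0..r. \<Sum>y\<in>?Z. \<Sum>zs\<in>?W. ?a p s y * ?b p s zs)"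
      by (rule sum.cong[OF refl], rule sum.swap)
    also have "\<dots> = (\<Sum>p = 1..n. \<Sum>s = 0..r. (\<Sum>y\<in>?Z. ?a p s y) * (\<Sum>zs\<in>?W. ?b p s zs))"
      by (simp only: sum_product)
    also have "\<dots> = (\<Sum>p = 1..n. \<Sum>s = 0..r. ten (act (Phi n k t) i p s v) (act (ext_tensor n L) p j (r - s) w) xs)"
      using x ys by (simp add: xs act_def basis_Phi)
    finally show ?thesis .
  next
    case False
    have "ten (act (Phi n k t) i p s v) (act (ext_tensor n L) p j (r - s) w) xs = 0" for p s
      using False by (cases xs) (auto simp: act_def basis_Phi)
    then show ?thesis
      using False by (simp add: act_def)
  qed
qed

lemma act_Phi_0:
  assumes "i \<in> {1..n}" "p \<in> {1..n}" "v \<in> supported (Phi n k t)"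
  shows "act (Phi n k t) i p 0 v = (if i = p then v else (\<lambda>_. 0))"
proof
  fix x
  show "act (Phi n k t) i p 0 v x = (if i = p then v else (\<lambda>_. 0)) x"
  proof (cases "x \<in> ext_basis n k")
    case True
    have "coef (Phi n k t) i p 0 x y = (if i = p \<and> x = y then 1 else 0)" for y
      by (simp add: Phi_def)
    then show ?thesis
      using True sum_delta_left[of "ext_basis n k" x "i = p" v] by (simp add: act_def basis_Phi)
  next
    case False
    then show ?thesis
      using assms by (simp add: act_def basis_Phi supported_def)
  qed
qed

text \<open>The vectors \<open>w\<close> whose tensor products with all of the first factor lie in
  \<open>N\<close> form a stable subspace. In T_ij^(r) applied to a tensor product of
  \<open>v\<close> and \<open>w\<close>, one term is that of \<open>v\<close> and T_ij^(r) w; all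
  others carry smaller r on \<open>w\<close> and some other vector of the first factor, so induction
  on r, for all \<open>v\<close> simultaneously, isolates it.\<close>

lemma cyclic_vector_tensor:
  assumes N: "stable n (ext_tensor n ((k, t) # L)) N"
    and w0: "cyclic_vector n (ext_tensor n L) w0"
    and first: "\<And>v. v \<in> supported (Phi n k t) \<Longrightarrow> ten v w0 \<in> N"
  shows "supported (ext_tensor n ((k, t) # L)) \<subseteq> N"
proof -
  let ?V = "Phi n k t" and ?W = "ext_tensor n L"
  define M where "M = {w. \<forall>v\<in>supported ?V. ten v w \<in> N}"
  have "stable n ?W M"
    unfolding stable_def
  proof (intro conjI ballI allI)
    fix i j r w assume i: "i \<in> {1..n}" and j: "j \<in> {1..n}" and w: "w \<in> M"
    have "ten v (act ?W i j r w) \<in> N" if "v \<in> supported ?V" for v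
      using that i
    proof (induction r arbitrary: v i rule: less_induct)
      case (less r)
      let ?rest = "\<lambda>x. \<Sum>p = 1..n. \<Sum>s = Suc 0..r. ten (act ?V i p s v) (act ?W p j (r - s) w) x"
      have "act (ext_tensor n ((k, t) # L)) i j r (ten v w)
          = (\<lambda>x. (\<Sum>p = 1..n. ten (act ?V i p 0 v) (act ?W p j r w) x) + ?rest x)"
        by (simp add: act_ten sum.atLeast_Suc_atMost sum.distrib)
      moreover have "(\<Sum>p = 1..n. ten (act ?V i p 0 v) (act ?W p j r w) x) = ten v (act ?W i j r w) x" for x
      proof -
        have "(\<Sum>p = 1..n. ten (act ?V i p 0 v) (act ?W p j r w) x)
            = (\<Sum>p = 1..n. if i = p then ten v (act ?W p j r w) x else 0)"
          using less by (intro sum.cong) (auto simp: act_Phi_0, cases x, auto)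
        then show ?thesis
          using less by simp
      qed
      ultimately have "ten v (act ?W i j r w)
          = (\<lambda>x. act (ext_tensor n ((k, t) # L)) i j r (ten v w) x - ?rest x)"
        by simp
      moreover have "?rest \<in> N"
        using less j by (intro stable_sum[OF N] less.IH act_supported) auto
      moreover have "act (ext_tensor n ((k, t) # L)) i j r (ten v w) \<in> N"
        using less j w by (intro stable_act[OF N]) (auto simp: M_def)
      ultimately show ?case
        using stable_diff[OF N] by simp
    qed
    then show "act ?W i j r w \<in> M"
      by (simp add: M_def)
  qed (auto simp: M_def ten_zero_right ten_add_right ten_smult_right
      stable_zero[OF N] stable_add[OF N] stable_smult[OF N])
  moreover have "w0 \<in> M"
    using first by (simp add: M_def)
  ultimately have "supported ?W \<subseteq> M"
    using w0 by (auto simp: cyclic_vector_def)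
  show ?thesis
  proof (rule stable_basis_vectors[OF N])
    fix y assume "y \<in> basis (ext_tensor n ((k, t) # L))"
    then obtain x ys where y: "y = x # ys" and x: "x \<in> ext_basis n k" and ys: "ys \<in> basis ?W"
      by (auto simp: basis_ext_tensor_Cons)
    then have "basis_vector x \<in> supported ?V" "basis_vector ys \<in> supported ?W"
      by (auto simp: supported_def basis_vector_def basis_Phi)
    then have "ten (basis_vector x) (basis_vector ys) \<in> N"
      using \<open>supported ?W \<subseteq> M\<close> by (auto simp: M_def)
    then show "basis_vector y \<in> N"
      by (simp add: y ten_basis_vector)
  qed simp
qed

section \<open>Reaching every basis vector of the first tensor factor\<close>

lemma sum_cr_an:
  assumes "x \<subseteq> {1..n}"
  shows "(\<Sum>c = Suc j..n. cr c (an c f) x) = of_nat (card {s \<in> x. j < s}) * f x"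
proof -
  have "cr c (an c f) x = (if c \<in> x then f x else 0)" for c
    using assms finite_subset[OF assms] by (auto simp: cr_def an_def insert_absorb jw_sign_remove)
  then have "(\<Sum>c = Suc j..n. cr c (an c f) x) = (\<Sum>c\<in>{Suc j..n} \<inter> x. f x)"
    by (simp only: sum.inter_restrict finite_atLeastAtMost)
  also have "{Suc j..n} \<inter> x = {s \<in> x. j < s}"
    using assms by auto
  finally show ?thesis
    by simp
qed

text \<open>Since j is missing from S, E_cj E_jc acts on e_S as E_cc, and the sum of these is the
  number operator for the indices above j.\<close>

lemma sum_cr_an_cr_an_same:
  assumes "x \<subseteq> {1..n}" "j \<notin> S"
  shows "(\<Sum>c = Suc j..n. cr c (an j (cr j (an c (basis_vector S)))) x)
    = of_nat (card {s \<in> S. j < s}) * basis_vector S x"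
proof -
  have fin: "finite x"
    using assms by (auto intro: finite_subset)
  have "cr c (an j (cr j (an c (basis_vector S)))) x = cr c (an c (basis_vector S)) x" for c
  proof -
    have "cr c (cr j (an j (an c (basis_vector S)))) x = 0"
      using assms fin unfolding cr_def an_def basis_vector_def by auto
    then show ?thesis
      using cr_an_cr_an[OF fin, of c j j c "basis_vector S"] by simp
  qed
  then show ?thesis
    using sum_cr_an[OF assms(1), where j = j and f = "basis_vector S"] by (auto simp: basis_vector_def)
qed

text \<open>Normal ordering yields minus E_jp with the number operator inserted after
  \<open>an p\<close>. That operator has already removed one index above j, so the count is q - 1
  instead of q.\<close>

lemma sum_cr_an_cr_an_other:
  assumes "x \<subseteq> {1..n}" "j \<notin> S" "p > j" "j \<ge> 1" "finite S"
  shows "(\<Sum>c = Suc j..n. cr c (an p (cr j (an c (basis_vector S)))) x)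
    = - (of_nat (card {s \<in> S. j < s}) - 1) * cr j (an p (basis_vector S)) x"
proof -
  have fin: "finite x"
    using assms by (auto intro: finite_subset)
  let ?z = "basis_vector S"
  have "cr c (an p (cr j (an c ?z))) x = - cr j (cr c (an c (an p ?z))) x" for c
    using cr_an_cr_an[OF fin, of c p j c ?z] cr_cr_an_an[OF fin, of c j p c ?z] assms(3) by simp
  then have "(\<Sum>c = Suc j..n. cr c (an p (cr j (an c ?z))) x)
      = - (\<Sum>c = Suc j..n. cr j (cr c (an c (an p ?z))) x)"
    by (simp add: sum_negf)
  also have "(\<Sum>c = Suc j..n. cr j (cr c (an c (an p ?z))) x)
      = cr j (\<lambda>x. \<Sum>c = Suc j..n. cr c (an c (an p ?z)) x) x"
    by (simp add: cr_def sum_distrib_left)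
  also have "\<dots> = cr j (\<lambda>x. of_nat (card {s \<in> x. j < s}) * an p ?z x) x"
    using assms(1) by (intro cr_cong sum_cr_an) auto
  also have "\<dots> = cr j (\<lambda>x. (of_nat (card {s \<in> S. j < s}) - 1) * an p ?z x) x"
  proof (intro cr_cong)
    let ?y = "x - {j}"
    have "of_nat (card {s \<in> ?y. j < s}) = of_nat (card {s \<in> S. j < s}) - (1 :: complex)"
      if "p \<notin> ?y" "insert p ?y = S"
    proof -
      have "{s \<in> S. j < s} = insert p {s \<in> ?y. j < s}"
        using that assms(3) by auto
      moreover have "finite ?y"
        using fin by simp
      ultimately show ?thesis
        using that by simp
    qed
    then show "of_nat (card {s \<in> ?y. j < s}) * an p ?z ?y
        = (of_nat (card {s \<in> S. j < s}) - 1) * an p ?z ?y"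
      by (auto simp: an_def basis_vector_def)
  qed
  also have "\<dots> = (of_nat (card {s \<in> S. j < s}) - 1) * cr j (an p ?z) x"
    by (simp add: cr_def)
  finally show ?thesis
    by (simp only: mult_minus_left)
qed

lemma cr_an_basis_vector:
  assumes "j \<notin> S" "c \<noteq> j"
  shows "cr j (an c (basis_vector S))
    = (\<lambda>x. (if c \<in> S then cr j (an c (basis_vector S)) (insert j (S - {c})) else 0)
         * basis_vector (insert j (S - {c})) x)"
proof
  fix x
  show "cr j (an c (basis_vector S)) x
    = (if c \<in> S then cr j (an c (basis_vector S)) (insert j (S - {c})) else 0)
         * basis_vector (insert j (S - {c})) x"
  proof (cases "x = insert j (S - {c})")
    case True
    then show ?thesis
      using assms by (auto simp: basis_vector_def cr_def an_def)
  next
    case False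
    have "x = insert j (S - {c})" if "j \<in> x" "c \<notin> x - {j}" "insert c (x - {j}) = S"
      using that assms by auto
    then have "cr j (an c (basis_vector S)) x = 0"
      using False by (auto simp: basis_vector_def cr_def an_def)
    then show ?thesis
      using False by (simp add: basis_vector_def)
  qed
qed

text \<open>
  For \<open>z = e_S\<close> with \<open>j\<close> not in \<open>S\<close>, with \<open>q\<close> the number of elements of \<open>S\<close> above \<open>j\<close>, and with
  \<open>w\<close> the highest vector of the remaining factors: up to the factor \<open>x / (x - t)\<close>, the sum of
  \<open>T_cj(x) (E_jc z \<otimes> w)\<close> over \<open>c > j\<close> is \<open>q z \<otimes> T_jj(x) w / x\<close> plus terms which
  vanish at \<open>x = t + q - 1\<close>.
\<close>

lemma raised_sum:
  fixes S j n k t L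
  defines "z \<equiv> basis_vector S" and "W \<equiv> ext_tensor n L" and "q \<equiv> of_nat (card {s \<in> S. j < s}) :: complex"
  assumes S: "S \<in> ext_basis n k" "j \<notin> S" and j: "j \<in> {1..n}"
    and x: "x \<in> ext_basis n k" and ys: "ys \<in> basis W" and L: "sized n L"
  shows "lin (- t) * Abs_fps (\<lambda>r. \<Sum>c = Suc j..n.
        act (ext_tensor n ((k, t) # L)) c j r (ten (cr j (an c z)) (basis_vector (top_index L))) (x # ys))
    = fps_const (q * z x * basis_vector (top_index L) ys) * (fps_X * top_series L j)
      + lin (- (t + q - 1)) * (\<Sum>p = Suc j..n. fps_const (cr j (an p z) x) * ser W p j ys (top_index L))"
proof -
  have x': "x \<subseteq> {1..n}" "finite x"
    using x by (auto simp: ext_basis_def intro: finite_subset)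
  have finS: "finite S"
    using S by (auto intro: ext_basis_finite)
  have topW: "top_index L \<in> basis W"
    using L by (simp add: W_def top_index_in_basis)
  let ?E = "\<lambda>c. cr j (an c z)" and ?w = "basis_vector (top_index L) :: nat set list \<Rightarrow> complex"
  let ?G = "\<lambda>c p. (if c = p then fps_const (?E c x) * lin (- t) else 0) + fps_const (cr c (an p (?E c)) x) * fps_X"
  let ?H = "\<lambda>p. (if p \<in> {Suc j..n} then fps_const (?E p x) * lin (- t) else 0)
      + fps_const (\<Sum>c = Suc j..n. cr c (an p (?E c)) x) * fps_X"
  let ?F = "\<lambda>p. ser W p j ys (top_index L)"
  have Phi_act: "lin (- t) * Abs_fps (\<lambda>r. act (Phi n k t) c p r v x)
      = (if c = p then fps_const (v x) * lin (- t) else 0) + fps_const (cr c (an p v) x) * fps_X"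
    if "c \<in> {1..n}" "p \<in> {1..n}" for c p v
  proof -
    have "Abs_fps (\<lambda>r. act (Phi n k t) c p r v x) = (\<Sum>y\<in>ext_basis n k. fps_const (v y) * ser (Phi n k t) c p x y)"
      using x by (intro fps_ext) (simp add: act_def basis_Phi fps_sum_nth mult.commute)
    then have "lin (- t) * Abs_fps (\<lambda>r. act (Phi n k t) c p r v x)
       = (\<Sum>y\<in>ext_basis n k. fps_const (v y) * (lin (- t) * ser (Phi n k t) c p x y))"
      by (simp only: sum_distrib_left mult_ac)
    also have "\<dots> = (\<Sum>y\<in>ext_basis n k. (if x = y then if c = p then fps_const (v y) * lin (- t) else 0 else 0)
        + fps_const (ext_E c p x y * v y) * fps_X)"
      unfolding lin_ser_Phi by (intro sum.cong refl) (auto simp: algebra_simps fps_const_mult[symmetric] simp del: fps_const_mult)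
    also have "\<dots> = (if c = p then fps_const (v x) * lin (- t) else 0)
        + (\<Sum>y\<in>ext_basis n k. fps_const (ext_E c p x y * v y)) * fps_X"
      using x by (simp only: sum.distrib sum.delta' finite_ext_basis if_True sum_distrib_right)
    also have "(\<Sum>y\<in>ext_basis n k. fps_const (ext_E c p x y * v y)) = fps_const (cr c (an p v) x)"
      using that x by (intro fps_ext) (simp add: fps_sum_nth flip: sum_ext_E[of c n p x k v])
    finally show ?thesis .
  qed
  have act_w: "act W p j s ?w ys = fps_nth (?F p) s" for p s
    using topW ys by (simp add: act_basis_vector W_def)
  have "Abs_fps (\<lambda>r. act (ext_tensor n ((k, t) # L)) c j r (ten v ?w) (x # ys))
      = (\<Sum>p = 1..n. Abs_fps (\<lambda>r. act (Phi n k t) c p r v x) * ?F p)" for c v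
    by (rule fps_ext) (simp add: act_ten fps_sum_nth fps_mult_nth act_w flip: W_def)
  then have "lin (- t) * Abs_fps (\<lambda>r. \<Sum>c = Suc j..n. act (ext_tensor n ((k, t) # L)) c j r (ten (?E c) ?w) (x # ys))
      = lin (- t) * (\<Sum>c = Suc j..n. \<Sum>p = 1..n. Abs_fps (\<lambda>r. act (Phi n k t) c p r (?E c) x) * ?F p)"
    by (intro arg_cong[of _ _ "\<lambda>u. lin (- t) * u"] fps_ext) (simp add: fps_sum_nth fps_eq_iff)
  also have "\<dots> = (\<Sum>c = Suc j..n. \<Sum>p = 1..n. (lin (- t) * Abs_fps (\<lambda>r. act (Phi n k t) c p r (?E c) x)) * ?F p)"
    by (simp only: sum_distrib_left mult.assoc)
  also have "\<dots> = (\<Sum>c = Suc j..n. \<Sum>p = 1..n. ?G c p * ?F p)"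
    using j by (intro sum.cong refl) (auto simp: Phi_act)
  also have "\<dots> = (\<Sum>p = 1..n. \<Sum>c = Suc j..n. ?G c p * ?F p)"
    by (rule sum.swap)
  also have "\<dots> = (\<Sum>p = 1..n. ?H p * ?F p)"
  proof (intro sum.cong refl)
    fix p
    have "(\<Sum>c = Suc j..n. ?G c p)
       = (if p \<in> {Suc j..n} then fps_const (?E p x) * lin (- t) else 0)
      + (\<Sum>c = Suc j..n. fps_const (cr c (an p (?E c)) x)) * fps_X"
      by (simp only: sum.distrib sum.delta finite_atLeastAtMost sum_distrib_right)
    moreover have "(\<Sum>c = Suc j..n. fps_const (cr c (an p (?E c)) x)) = fps_const (\<Sum>c = Suc j..n. cr c (an p (?E c)) x)"
      by (rule fps_ext) (simp add: fps_sum_nth)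
    ultimately show "(\<Sum>c = Suc j..n. ?G c p * ?F p) = ?H p * ?F p"
      by (simp only: sum_distrib_right[symmetric])
  qed
  \<comment> \<open>For p < j the operator T_pj(x) raises, so it kills the highest vector of the
    remaining factors.\<close>
  also have "\<dots> = (\<Sum>p\<in>{j..n}. ?H p * ?F p)"
    using j by (intro sum.mono_neutral_right) (auto simp: W_def ser_top_raise)
  also have "\<dots> = fps_const (\<Sum>c = Suc j..n. cr c (an j (?E c)) x) * fps_X * ?F j
     + (\<Sum>p = Suc j..n. (fps_const (?E p x) * lin (- t)
      + fps_const (\<Sum>c = Suc j..n. cr c (an p (?E c)) x) * fps_X) * ?F p)"
    using j by (simp add: sum.atLeast_Suc_atMost[of j n])
  also have "(\<Sum>c = Suc j..n. cr c (an j (?E c)) x) = q * z x"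
    unfolding z_def q_def using x' S by (rule_tac sum_cr_an_cr_an_same) auto
  also have "?F j = (if ys = top_index L then top_series L j else 0)"
    using j ys by (simp add: W_def ser_top_diag)
  also have "(\<Sum>p = Suc j..n. (fps_const (?E p x) * lin (- t)
      + fps_const (\<Sum>c = Suc j..n. cr c (an p (?E c)) x) * fps_X) * ?F p)
    = lin (- (t + q - 1)) * (\<Sum>p = Suc j..n. fps_const (?E p x) * ?F p)"
    unfolding sum_distrib_left
  proof (intro sum.cong refl)
    fix p assume p: "p \<in> {Suc j..n}"
    have "(\<Sum>c = Suc j..n. cr c (an p (?E c)) x) = - (q - 1) * ?E p x"
      unfolding z_def q_def using x' S p j finS by (intro sum_cr_an_cr_an_other) auto
    \<comment> \<open>Multiplied by x this is (x - t) - (q - 1) = x - (t + q - 1), the factor that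
      vanishes at the chosen point.\<close>
    moreover have "fps_const e * lin (- t) + fps_const (- (q - 1) * e) * fps_X = lin (- (t + q - 1)) * fps_const e" for e
      by (rule fps_ext) (auto simp: algebra_simps fps_X_def)
    ultimately show "(fps_const (?E p x) * lin (- t) + fps_const (\<Sum>c = Suc j..n. cr c (an p (?E c)) x) * fps_X) * ?F p
      = lin (- (t + q - 1)) * (fps_const (?E p x) * ?F p)"
      by (simp only: mult.assoc)
  qed
  also have "fps_const (q * z x) * fps_X * (if ys = top_index L then top_series L j else 0)
     = fps_const (q * z x * ?w ys) * (fps_X * top_series L j)"
    by (simp add: basis_vector_def mult.assoc)
  finally show ?thesis .
qed

text \<open>Evaluating \<open>raised_sum\<close> at x = t + q - 1 leaves only a multiple of the
  wanted vector. The multiple is q times the numerator of T_jj on the remaining factors, and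
  \<open>nz\<close> makes it invertible.\<close>

lemma first_factor_step:
  assumes N: "stable n (ext_tensor n ((k, t) # L)) N" and L: "sized n L"
    and S: "S \<in> ext_basis n k" "j \<notin> S" and j: "j \<in> {1..n}" and q: "{s \<in> S. j < s} \<noteq> {}"
    and IH: "\<And>c. c \<in> S \<Longrightarrow> c > j \<Longrightarrow>
      basis_vector (insert j (S - {c}) # top_index L) \<in> N"
    and nz: "\<forall>(l, s)\<in>set L. j \<le> l \<longrightarrow> t + of_nat (card {s \<in> S. j < s}) - s \<noteq> 0"
  shows "basis_vector (S # top_index L) \<in> N"
proof -
  let ?B = "ext_tensor n ((k, t) # L)" and ?w = "basis_vector (top_index L) :: nat set list \<Rightarrow> complex"
  let ?z = "basis_vector S :: nat set \<Rightarrow> complex" and ?d = "Suc (top_deg L j)"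
  define q :: complex where "q = of_nat (card {s \<in> S. j < s})"
  define y where "y = t + q - 1"
  define u where "u r xs = (\<Sum>c = Suc j..n. act ?B c j r (ten (cr j (an c ?z)) ?w) xs)" for r xs
  have "ten (cr j (an c ?z)) ?w \<in> N" if c: "c \<in> {Suc j..n}" for c
  proof -
    let ?e = "basis_vector (insert j (S - {c}))"
    let ?a = "if c \<in> S then cr j (an c ?z) (insert j (S - {c})) else 0"
    have "ten (cr j (an c ?z)) ?w = ten (\<lambda>x. ?a * ?e x) ?w"
      using S c by (subst cr_an_basis_vector) auto
    also have "\<dots> = (\<lambda>xs. ?a * basis_vector (insert j (S - {c}) # top_index L) xs)"
      by (simp only: ten_smult_left ten_basis_vector)
    also have "\<dots> \<in> N"
    proof (cases "c \<in> S")
      case True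
      then show ?thesis
        using c by (intro stable_smult[OF N] IH) auto
    next
      case False
      then show ?thesis
        using stable_zero[OF N] by simp
    qed
    finally show ?thesis .
  qed
  then have "u r \<in> N" for r
    unfolding u_def using j by (intro stable_sum[OF N] stable_act[OF N]) auto
  \<comment> \<open>The point \<open>y\<close> may be a pole, so \<open>lin (- t)\<close> clears the
    denominator of the first factor and \<open>top_den L j\<close> those of the others; the degree
    bound \<open>?d\<close> counts these factors.\<close>
  then have "(\<lambda>xs. reversed_eval ?d y ((top_den L j * lin (- t)) * Abs_fps (\<lambda>r. u r xs))) \<in> N" (is "?v \<in> N")
    by (rule stable_reversed_eval[OF N])
  define a where "a = q * reversed_eval (top_deg L j) y (top_num L j)"
  have "?v xs = a * basis_vector (S # top_index L) xs" for xs
  proof (cases "xs \<in> basis ?B")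
    case True
    then obtain x ys where xs: "xs = x # ys" and x: "x \<in> ext_basis n k" and ys: "ys \<in> basis (ext_tensor n L)"
      by (auto simp: basis_ext_tensor_Cons)
    let ?F = "\<lambda>p. top_den L j * ser (ext_tensor n L) p j ys (top_index L)"
    let ?G = "\<Sum>p = Suc j..n. fps_const (cr j (an p ?z) x) * ?F p"
    have "lin (- t) * Abs_fps (\<lambda>r. u r xs)
      = fps_const (q * ?z x * ?w ys) * (fps_X * top_series L j)
        + lin (- y) * (\<Sum>p = Suc j..n. fps_const (cr j (an p ?z) x) * ser (ext_tensor n L) p j ys (top_index L))"
      unfolding u_def xs q_def y_def by (rule raised_sum[OF S j x ys L])
    then have "top_den L j * lin (- t) * Abs_fps (\<lambda>r. u r xs)
      = top_den L j * (fps_const (q * ?z x * ?w ys) * (fps_X * top_series L j)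
        + lin (- y) * (\<Sum>p = Suc j..n. fps_const (cr j (an p ?z) x) * ser (ext_tensor n L) p j ys (top_index L)))"
      by (simp only: mult.assoc[of "top_den L j"])
    also have "\<dots> = fps_const (q * ?z x * ?w ys) * (fps_X * (top_den L j * top_series L j))
        + lin (- y) * (top_den L j * (\<Sum>p = Suc j..n. fps_const (cr j (an p ?z) x) * ser (ext_tensor n L) p j ys (top_index L)))"
      by (simp only: distrib_left mult.left_commute[of "top_den L j"])
    also have "top_den L j * (\<Sum>p = Suc j..n. fps_const (cr j (an p ?z) x) * ser (ext_tensor n L) p j ys (top_index L)) = ?G"
      by (simp only: sum_distrib_left mult.left_commute[of "top_den L j"])
    also have "top_den L j * top_series L j = top_num L j"
      by (rule top_den_series)
    finally have "?v xs = q * ?z x * ?w ys * reversed_eval (top_deg L j) y (top_num L j)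
        + reversed_eval ?d y (lin (- y) * ?G)"
      by (simp only: reversed_eval_add reversed_eval_const_mult reversed_eval_X_mult)
    moreover have "fps_deg_le ?G (top_deg L j)"
    proof (rule fps_deg_le_sum)
      fix p assume "p \<in> {Suc j..n}"
      then have "fps_deg_le (?F p) (top_deg L j)"
        using j ys by (intro fps_deg_le_top_den_ser) auto
      then show "fps_deg_le (fps_const (cr j (an p ?z) x) * ?F p) (top_deg L j)"
        by (simp add: fps_deg_le_def)
    qed
    \<comment> \<open>The factor \<open>lin (- y)\<close> contributes y - y.\<close>
    then have "reversed_eval ?d y (lin (- y) * ?G) = 0"
      by (subst reversed_eval_linear_mult) auto
    moreover have "?z x * ?w ys = basis_vector (S # top_index L) xs"
      by (simp add: xs basis_vector_def)
    ultimately show ?thesis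
      by (simp add: a_def)
  next
    case False
    then have "u r xs = 0" for r
      by (simp add: u_def act_def)
    moreover have "xs \<noteq> S # top_index L"
      using False S L by (auto simp: top_index_in_basis)
    ultimately show ?thesis
      by (simp add: reversed_eval_def basis_vector_def fps_mult_nth)
  qed
  then have "?v = (\<lambda>xs. a * basis_vector (S # top_index L) xs)"
    by (rule ext)
  then have "(\<lambda>xs. a * basis_vector (S # top_index L) xs) \<in> N"
    using \<open>?v \<in> N\<close> by simp
  then have "(\<lambda>xs. 1 / a * (a * basis_vector (S # top_index L) xs)) \<in> N"
    by (rule stable_smult[OF N])
  moreover have "a \<noteq> 0"
  proof -
    have "finite {s \<in> S. j < s}"
      using S by (auto dest: ext_basis_finite)
    then have "q \<noteq> 0"
      using q by (simp add: q_def)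
    moreover have "\<forall>(l, s)\<in>set L. j \<le> l \<longrightarrow> y + 1 - s \<noteq> 0"
      using nz by (simp add: y_def q_def)
    ultimately show ?thesis
      by (simp add: a_def reversed_eval_top_num_nonzero)
  qed
  ultimately show ?thesis
    by simp
qed

text \<open>For the parameters of the theorem, t + k is the entry of \<lambda> + \<rho> plus 1/2.
  The constant cancels in differences, so this is dominance, in a form that passes to the tail of
  the list.\<close>

definition ordered_shifts :: "(nat \<times> complex) list \<Rightarrow> bool" where
  "ordered_shifts = sorted_wrt (\<lambda>(k, t) (l, s). \<forall>i::nat. i \<ge> 1 \<longrightarrow> t + of_nat k - (s + of_nat l) \<noteq> - of_nat i)"

text \<open>Descending induction on an index j with 1, ..., j - 1 in S: if j is missing, exchanging
  any larger c in S for j gives a set containing 1, ..., j, which is already reached.\<close>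

lemma first_factor:
  assumes N: "stable n (ext_tensor n ((k, t) # L)) N"
    and L: "sized n ((k, t) # L)" "ordered_shifts ((k, t) # L)"
    and top: "basis_vector (top_index ((k, t) # L)) \<in> N"
    and S: "S \<in> ext_basis n k"
  shows "basis_vector (S # top_index L) \<in> N"
proof -
  \<comment> \<open>For \<open>d = 0\<close> the condition forces S = {1..k}; for
    \<open>d = k\<close> the required interval is empty and every S is covered.\<close>
  have "basis_vector (S # top_index L) \<in> N" if "S \<in> ext_basis n k" "{1..<Suc k - d} \<subseteq> S" "d \<le> k" for d S
    using that
  proof (induction d arbitrary: S)
    case 0
    then have "{1..k} \<subseteq> S" "card S = k" "finite S"
      by (auto simp: ext_basis_def intro: finite_subset)
    then have "S = {1..k}"
      by (metis card_subset_eq card_atLeastAtMost diff_Suc_1)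
    then show ?case
      using top by simp
  next
    case (Suc d)
    define j where "j = k - d"
    have j: "1 \<le> j" "j \<le> k" "k - j = d" "Suc k - Suc d = j" "Suc k - d = Suc j"
      using Suc.prems by (auto simp: j_def)
    have fin: "finite S" and card: "card S = k"
      using Suc.prems by (auto simp: ext_basis_def intro: finite_subset)
    show ?case
    proof (cases "j \<in> S")
      case True
      then have "{1..<Suc j} \<subseteq> S"
        using Suc.prems j by (auto simp: less_Suc_eq)
      then show ?thesis
        using Suc j by auto
    next
      case False
      have S_split: "S = {1..<j} \<union> {s \<in> S. j < s}"
      proof (intro equalityI subsetI)
        fix s assume "s \<in> S"
        then show "s \<in> {1..<j} \<union> {s \<in> S. j < s}"
          using False Suc.prems by (cases "s = j") (auto simp: ext_basis_def)
      qed (use Suc.prems j in auto)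
      have "card S = card {1..<j} + card {s \<in> S. j < s}"
        by (subst S_split, subst card_Un_disjoint) (use fin in auto)
      then have q: "card {s \<in> S. j < s} = Suc d"
        using card j by simp
      show ?thesis
      proof (rule first_factor_step[OF N])
        show "{s \<in> S. j < s} \<noteq> {}"
          using q by (metis card.empty nat.distinct(1))
        show "basis_vector (insert j (S - {c}) # top_index L) \<in> N" if c: "c \<in> S" "c > j" for c
        proof (rule Suc.IH)
          have "card (insert j (S - {c})) = k"
            using c False fin card card_gt_0_iff[of S] by (auto simp: card_insert_if)
          moreover have "j \<le> n"
            using j L by simp
          ultimately show "insert j (S - {c}) \<in> ext_basis n k"
            using Suc.prems j by (auto simp: ext_basis_def)
          show "{1..<Suc k - d} \<subseteq> insert j (S - {c})"
            using Suc.prems j c by (auto simp: less_Suc_eq)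
        qed (use Suc.prems in simp)
        show "\<forall>(l, s)\<in>set L. j \<le> l \<longrightarrow> t + of_nat (card {s \<in> S. j < s}) - s \<noteq> 0"
        proof (clarify)
          fix l s assume ls: "(l, s) \<in> set L" "j \<le> l" and eq: "t + of_nat (card {s \<in> S. j < s}) - s = 0"
          have "of_nat (Suc d) = of_nat k - of_nat j + (1 :: complex)"
            using j by (simp add: of_nat_diff[symmetric])
          moreover have "t + of_nat k - (s + of_nat l)
              = (t + of_nat (Suc d) - s) - of_nat (Suc d) + of_nat k - of_nat l"
            by simp
          \<comment> \<open>With q = k - j + 1, vanishing of t + q - s would put the difference of
            shifts at -(l - j + 1), a negative integer because l \<ge> j.\<close>
          ultimately have "t + of_nat k - (s + of_nat l) = - (of_nat l - of_nat j + 1)"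
            using eq q by (simp only:) simp
          also have "\<dots> = - of_nat (l - j + 1)"
            using ls by (simp add: of_nat_diff)
          finally have "t + of_nat k - (s + of_nat l) = - of_nat (l - j + 1)" .
          moreover have "\<forall>i::nat. i \<ge> 1 \<longrightarrow> t + of_nat k - (s + of_nat l) \<noteq> - of_nat i"
            using L(2) ls(1) unfolding ordered_shifts_def sorted_wrt.simps by blast
          ultimately show False
            by (metis le_add2)
        qed
      qed (use L Suc.prems False j in auto)
    qed
  qed
  from this[of S k] S show ?thesis
    by simp
qed

theorem top_vector_cyclic:
  assumes "sized n L" "ordered_shifts L"
  shows "cyclic_vector n (ext_tensor n L) (basis_vector (top_index L))"
  using assms
proof (induction L rule: top_index.induct)
  case 1
  show ?case
    unfolding cyclic_vector_def
  proof (intro allI impI)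
    fix N assume "stable n (ext_tensor n []) N" "basis_vector (top_index []) \<in> N"
    then show "supported (ext_tensor n []) \<subseteq> N"
      by (intro stable_basis_vectors) (auto simp: basis_ext_tensor_Nil)
  qed
next
  case (2 k t L)
  then have IH: "cyclic_vector n (ext_tensor n L) (basis_vector (top_index L))"
    by (simp add: ordered_shifts_def)
  show ?case
    unfolding cyclic_vector_def
  proof (intro allI impI)
    fix N assume N: "stable n (ext_tensor n ((k, t) # L)) N" and "basis_vector (top_index ((k, t) # L)) \<in> N"
    then have S: "basis_vector (S # top_index L) \<in> N" if "S \<in> ext_basis n k" for S
      using that 2 by (intro first_factor) auto
    show "supported (ext_tensor n ((k, t) # L)) \<subseteq> N"
    proof (rule cyclic_vector_tensor[OF N IH])
      fix v assume v: "v \<in> supported (Phi n k t)"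
      have "ten v (basis_vector (top_index L))
          = (\<lambda>xs. \<Sum>S\<in>ext_basis n k. v S * basis_vector (S # top_index L) xs)"
      proof
        fix xs
        show "ten v (basis_vector (top_index L)) xs
          = (\<Sum>S\<in>ext_basis n k. v S * basis_vector (S # top_index L) xs)"
        proof (cases xs)
          case (Cons x ys)
          have "(\<Sum>S\<in>ext_basis n k. v S * basis_vector (S # top_index L) xs)
              = (\<Sum>S\<in>ext_basis n k. if x = S then v S * basis_vector (top_index L) ys else 0)"
            by (intro sum.cong) (auto simp: Cons basis_vector_def)
          then show ?thesis
            using v by (auto simp: Cons supported_def basis_Phi)
        qed (simp add: basis_vector_def)
      qed
      also have "\<dots> \<in> N"
        using S by (intro stable_sum[OF N] stable_smult[OF N])
      finally show "ten v (basis_vector (top_index L)) \<in> N" .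
    qed
  qed
qed

section \<open>Vacuum expectations\<close>

lemma act_commutation:
  assumes B: "yangian_entries n B"
    and "i \<in> {1..n}" "j \<in> {1..n}" "k \<in> {1..n}" "l \<in> {1..n}"
  shows "act B i j (Suc r) (act B k l s f) x - act B k l s (act B i j (Suc r) f) x
      - (act B i j r (act B k l (Suc s) f) x - act B k l (Suc s) (act B i j r f) x)
    = act B k j r (act B i l s f) x - act B k j s (act B i l r f) x"
proof (cases "x \<in> basis B")
  case True
  have comp: "act B i j r (act B k l s f) x
      = (\<Sum>z\<in>basis B. (\<Sum>y\<in>basis B. coef B i j r x y * coef B k l s y z) * f z)" for i j k l r s
  proof -
    have "act B i j r (act B k l s f) x
        = (\<Sum>y\<in>basis B. \<Sum>z\<in>basis B. coef B i j r x y * coef B k l s y z * f z)"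
      using True by (simp add: act_def sum_distrib_left mult.assoc)
    also have "\<dots> = (\<Sum>z\<in>basis B. \<Sum>y\<in>basis B. coef B i j r x y * coef B k l s y z * f z)"
      by (rule sum.swap)
    finally show ?thesis
      by (simp add: sum_distrib_right)
  qed
  have "(\<Sum>y\<in>basis B. coef B i j (Suc r) x y * coef B k l s y z)
      - (\<Sum>y\<in>basis B. coef B k l s x y * coef B i j (Suc r) y z)
      - ((\<Sum>y\<in>basis B. coef B i j r x y * coef B k l (Suc s) y z)
         - (\<Sum>y\<in>basis B. coef B k l (Suc s) x y * coef B i j r y z))
    = (\<Sum>y\<in>basis B. coef B k j r x y * coef B i l s y z)
      - (\<Sum>y\<in>basis B. coef B k j s x y * coef B i l r y z)" if "z \<in> basis B" for z
    using assms True that unfolding yangian_entries_def sum_subtractf by blast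
  then show ?thesis
    unfolding comp sum_subtractf[symmetric] left_diff_distrib[symmetric] by (intro sum.cong) auto
next
  case False
  then show ?thesis
    by (simp add: act_def)
qed

lemma act_0:
  assumes B: "yangian_entries n B" and "i \<in> {1..n}" "j \<in> {1..n}" "f \<in> supported B"
  shows "act B i j 0 f = (if i = j then f else (\<lambda>_. 0))"
proof
  fix x
  show "act B i j 0 f x = (if i = j then f else (\<lambda>_. 0)) x"
  proof (cases "x \<in> basis B")
    case True
    then have "act B i j 0 f x = (\<Sum>y\<in>basis B. (if i = j \<and> x = y then 1 else 0) * f y)"
      using assms unfolding act_def yangian_entries_def by (auto intro: sum.cong)
    then show ?thesis
      using True B sum_delta_left[of "basis B" x "i = j" f] by (simp add: yangian_entries_def)
  next
    case False
    then show ?thesis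
      using assms by (auto simp: act_def supported_def)
  qed
qed

section \<open>Words in the generators and their expectations\<close>

type_synonym word = "(nat \<times> nat \<times> nat) list"

fun wact :: "'b based_space \<Rightarrow> word \<Rightarrow> ('b \<Rightarrow> complex) \<Rightarrow> 'b \<Rightarrow> complex" where
  "wact B [] f = f"
| "wact B ((i, j, r) # w) f = act B i j r (wact B w f)"

definition word_ok :: "nat \<Rightarrow> word \<Rightarrow> bool" where
  "word_ok n w \<longleftrightarrow> (\<forall>(i, j, r)\<in>set w. i \<in> {1..n} \<and> j \<in> {1..n})"

lemma word_ok_simps [simp]:
  "word_ok n []"
  "word_ok n ((i, j, r) # w) \<longleftrightarrow> i \<in> {1..n} \<and> j \<in> {1..n} \<and> word_ok n w"
  "word_ok n (v @ w) \<longleftrightarrow> word_ok n v \<and> word_ok n w"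
  by (simp_all add: word_ok_def ball_Un)

lemma wact_append: "wact B (v @ w) f = wact B v (wact B w f)"
proof (induction v)
  case (Cons x v)
  then show ?case
    by (cases x) simp
qed simp

lemma wact_add: "wact B w (\<lambda>x. f x + g x) = (\<lambda>x. wact B w f x + wact B w g x)"
  by (induction B w f rule: wact.induct) (auto simp: act_add)

lemma wact_smult: "wact B w (\<lambda>x. c * f x) = (\<lambda>x. c * wact B w f x)"
  by (induction B w f rule: wact.induct) (auto simp: act_smult)

lemma wact_zero: "wact B w (\<lambda>_. 0) = (\<lambda>_. 0)"
  using wact_smult[of B w 0] by simp

lemma wact_diff: "wact B w (\<lambda>x. f x - g x) = (\<lambda>x. wact B w f x - wact B w g x)"
  using wact_add[of B w f "\<lambda>x. - 1 * g x"] wact_smult[of B w "- 1" g] by simp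

lemma wact_supported: "f \<in> supported B \<Longrightarrow> wact B w f \<in> supported B"
  by (cases w) (auto simp: act_supported)

lemma wact_commutation:
  assumes B: "yangian_entries n B"
    and "i \<in> {1..n}" "j \<in> {1..n}" "k \<in> {1..n}" "l \<in> {1..n}"
  shows "wact B (a @ (i, j, Suc r) # (k, l, s) # b) f x - wact B (a @ (k, l, s) # (i, j, Suc r) # b) f x
      - (wact B (a @ (i, j, r) # (k, l, Suc s) # b) f x - wact B (a @ (k, l, Suc s) # (i, j, r) # b) f x)
    = wact B (a @ (k, j, r) # (i, l, s) # b) f x - wact B (a @ (k, j, s) # (i, l, r) # b) f x"
proof -
  let ?g = "wact B b f"
  have "(\<lambda>x. act B i j (Suc r) (act B k l s ?g) x - act B k l s (act B i j (Suc r) ?g) x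
      - (act B i j r (act B k l (Suc s) ?g) x - act B k l (Suc s) (act B i j r ?g) x))
    = (\<lambda>x. act B k j r (act B i l s ?g) x - act B k j s (act B i l r ?g) x)"
    using act_commutation[OF assms] by (intro ext)
  then have "wact B a (\<lambda>x. act B i j (Suc r) (act B k l s ?g) x - act B k l s (act B i j (Suc r) ?g) x
      - (act B i j r (act B k l (Suc s) ?g) x - act B k l (Suc s) (act B i j r ?g) x)) x
    = wact B a (\<lambda>x. act B k j r (act B i l s ?g) x - act B k j s (act B i l r ?g) x) x"
    by (rule arg_cong)
  then show ?thesis
    by (simp only: wact_append wact_diff wact.simps)
qed

text \<open>
  In a word the letters commute up to words of smaller total degree, so a functional which
  vanishes on the right multiples of raising letters, etc., is determined by its value
  on the empty word.
\<close>

definition word_size :: "word \<Rightarrow> nat" where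
  "word_size w = (\<Sum>(i, j, r)\<leftarrow>w. Suc r)"

lemma word_size_simps [simp]:
  "word_size [] = 0" "word_size ((i, j, r) # w) = Suc r + word_size w"
  "word_size (v @ w) = word_size v + word_size w"
  by (simp_all add: word_size_def)

lemma word_functional_zero:
  fixes \<delta> :: "word \<Rightarrow> complex"
  assumes rel: "\<And>a b i j k l r s. i \<in> {1..n} \<Longrightarrow> j \<in> {1..n} \<Longrightarrow> k \<in> {1..n} \<Longrightarrow> l \<in> {1..n} \<Longrightarrow>
       \<delta> (a @ (i, j, Suc r) # (k, l, s) # b) - \<delta> (a @ (k, l, s) # (i, j, Suc r) # b)
      - (\<delta> (a @ (i, j, r) # (k, l, Suc s) # b) - \<delta> (a @ (k, l, Suc s) # (i, j, r) # b))
    = \<delta> (a @ (k, j, r) # (i, l, s) # b) - \<delta> (a @ (k, j, s) # (i, l, r) # b)"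
    and zero: "\<And>a b i j. i \<in> {1..n} \<Longrightarrow> j \<in> {1..n} \<Longrightarrow>
       \<delta> (a @ (i, j, 0) # b) = (if i = j then \<delta> (a @ b) else 0)"
    and raise: "\<And>a i j r. i \<in> {1..n} \<Longrightarrow> j \<in> {1..n} \<Longrightarrow> i < j \<Longrightarrow> \<delta> (a @ [(i, j, r)]) = 0"
    and diag: "\<And>a i r. i \<in> {1..n} \<Longrightarrow> \<delta> (a @ [(i, i, r)]) = \<Lambda> i r * \<delta> a"
    and lower: "\<And>a i j r. i \<in> {1..n} \<Longrightarrow> j \<in> {1..n} \<Longrightarrow> j < i \<Longrightarrow> \<delta> ((i, j, r) # a) = 0"
    and empty: "\<delta> [] = 0"
    and w: "word_ok n w"
  shows "\<delta> w = 0"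
  using w
proof (induction "word_size w" arbitrary: w rule: less_induct)
  case less
  \<comment> \<open>The relation shifts one unit of degree from the first letter to the second,
    modulo words of smaller size; after r shifts the first letter is T^(0), a scalar.\<close>
  have swap: "\<delta> (a @ (i, j, r) # (k, l, s) # b) = \<delta> (a @ (k, l, s) # (i, j, r) # b)"
    if "word_ok n (a @ (i, j, r) # (k, l, s) # b)" "word_size (a @ (i, j, r) # (k, l, s) # b) = word_size w"
    for a b i j k l r s
    using that
  proof (induction r arbitrary: s)
    case 0
    then show ?case
      using zero[of i j a "(k, l, s) # b"] zero[of i j "a @ [(k, l, s)]" b] by simp
  next
    case (Suc r)
    have "\<delta> (a @ (i, j, r) # (k, l, Suc s) # b) = \<delta> (a @ (k, l, Suc s) # (i, j, r) # b)"
      using Suc.prems by (intro Suc.IH) auto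
    moreover have "\<delta> (a @ (k, j, r) # (i, l, s) # b) = 0" "\<delta> (a @ (k, j, s) # (i, l, r) # b) = 0"
      using Suc.prems by (auto intro!: less.hyps)
    ultimately show ?case
      using rel[of i j k l a r s b] Suc.prems by simp
  qed
  have move: "\<delta> (a @ x # b) = \<delta> (a @ b @ [x])"
    if "word_ok n (a @ x # b)" "word_size (a @ x # b) = word_size w" for a b x
    using that
  proof (induction b arbitrary: a)
    case (Cons y b)
    obtain i j r k l s where xy: "x = (i, j, r)" "y = (k, l, s)"
      by (metis prod_cases3)
    then have "\<delta> (a @ x # y # b) = \<delta> ((a @ [y]) @ x # b)"
      using Cons.prems swap[of a i j r k l s b] by simp
    also have "\<dots> = \<delta> ((a @ [y]) @ b @ [x])"
      using Cons.prems xy by (intro Cons.IH) auto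
    finally show ?case
      by simp
  qed simp
  show ?case
  \<comment> \<open>A raising or diagonal letter is moved to the right end, where it acts on the
    highest vector. If all letters lower, the leftmost one already has no component along that
    vector.\<close>
  proof (cases "\<exists>(i, j, r)\<in>set w. i \<le> j")
    case True
    then obtain i j r a b where ij: "i \<le> j" and split: "w = a @ (i, j, r) # b"
      by (auto dest: split_list)
    have ok: "i \<in> {1..n}" "j \<in> {1..n}" "word_ok n (a @ b)"
      using less.prems by (auto simp: split)
    have "\<delta> w = \<delta> ((a @ b) @ [(i, j, r)])"
      using less.prems move[of a "(i, j, r)" b] by (simp add: split)
    \<comment> \<open>Deleting a letter shortens the word in \<open>word_size\<close> even for r =
      0, because degree r is counted as \<open>Suc r\<close>.\<close>
    moreover have "\<delta> (a @ b) = 0"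
      using ok by (intro less.hyps) (auto simp: split)
    ultimately show ?thesis
      using ij ok raise[of i j "a @ b" r] diag[of i "a @ b" r] by (cases "i = j") auto
  next
    case False
    show ?thesis
    proof (cases w)
      case (Cons x v)
      obtain i j r where x: "x = (i, j, r)"
        by (metis prod_cases3)
      then show ?thesis
        using Cons False less.prems by (auto intro!: lower)
    qed (simp add: empty)
  qed
qed

text \<open>The basis vector at \<open>p\<close> is a highest vector of weight
  \<open>\<Lambda>\<close>; the last clause is the dual statement that the coordinate functional at
  \<open>p\<close> annihilates all images of lowering operators.\<close>

definition vacuum :: "nat \<Rightarrow> 'b based_space \<Rightarrow> 'b \<Rightarrow> (nat \<Rightarrow> nat \<Rightarrow> complex) \<Rightarrow> bool" where
  "vacuum n B p \<Lambda> \<longleftrightarrow> yangian_entries n B \<and> p \<in> basis B \<and>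
     (\<forall>i\<in>{1..n}. \<forall>j\<in>{1..n}. \<forall>r. i < j \<longrightarrow> act B i j r (basis_vector p) = (\<lambda>_. 0)) \<and>
     (\<forall>i\<in>{1..n}. \<forall>r. act B i i r (basis_vector p) = (\<lambda>x. \<Lambda> i r * basis_vector p x)) \<and>
     (\<forall>i\<in>{1..n}. \<forall>j\<in>{1..n}. \<forall>r f. j < i \<longrightarrow> act B i j r f p = 0)"

lemma basis_vector_supported: "y \<in> basis B \<Longrightarrow> basis_vector y \<in> supported B"
  by (auto simp: basis_vector_def supported_def)

text \<open>The difference of the two expectations obeys all the linear rules of
  \<open>word_functional_zero\<close>, and on the empty word it is 1 - 1 = 0.\<close>

lemma vacuum_expectation_unique:
  assumes B: "vacuum n B p \<Lambda>" and B': "vacuum n B' p' \<Lambda>" and w: "word_ok n w"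
  shows "wact B w (basis_vector p) p = wact B' w (basis_vector p') p'"
proof -
  define \<delta> where "\<delta> w = wact B w (basis_vector p) p - wact B' w (basis_vector p') p'" for w
  have "\<delta> w = 0"
  proof (rule word_functional_zero[where \<Lambda> = \<Lambda>, OF _ _ _ _ _ _ w])
    show "\<delta> (a @ (i, j, Suc r) # (k, l, s) # b) - \<delta> (a @ (k, l, s) # (i, j, Suc r) # b)
      - (\<delta> (a @ (i, j, r) # (k, l, Suc s) # b) - \<delta> (a @ (k, l, Suc s) # (i, j, r) # b))
      = \<delta> (a @ (k, j, r) # (i, l, s) # b) - \<delta> (a @ (k, j, s) # (i, l, r) # b)"
      if "i \<in> {1..n}" "j \<in> {1..n}" "k \<in> {1..n}" "l \<in> {1..n}" for a b i j k l r s
    proof -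
      have diff: "x1 - y1 - (x2 - y2) - ((x3 - y3) - (x4 - y4)) = (x5 - y5) - (x6 - y6)"
        if "x1 - x2 - (x3 - x4) = x5 - x6" "y1 - y2 - (y3 - y4) = y5 - y6"
        for x1 x2 x3 x4 x5 x6 y1 y2 y3 y4 y5 y6 :: complex
        using that by (simp add: algebra_simps)
      show ?thesis
        unfolding \<delta>_def using B B' that
        by (intro diff wact_commutation[where n = n]) (auto simp: vacuum_def)
    qed
    show "\<delta> (a @ (i, j, 0) # b) = (if i = j then \<delta> (a @ b) else 0)"
      if "i \<in> {1..n}" "j \<in> {1..n}" for a b i j
    proof -
      have "act B i j 0 (wact B b (basis_vector p)) = (if i = j then wact B b (basis_vector p) else (\<lambda>_. 0))"
        using B that
        by (intro act_0[where n = n] wact_supported basis_vector_supported) (auto simp: vacuum_def)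
      moreover have "act B' i j 0 (wact B' b (basis_vector p')) = (if i = j then wact B' b (basis_vector p') else (\<lambda>_. 0))"
        using B' that
        by (intro act_0[where n = n] wact_supported basis_vector_supported) (auto simp: vacuum_def)
      ultimately show ?thesis
        by (simp add: \<delta>_def wact_append wact_zero)
    qed
  qed (use B B' in \<open>auto simp: \<delta>_def wact_append wact_zero wact_smult vacuum_def basis_vector_def algebra_simps\<close>)
  then show ?thesis
    by (simp add: \<delta>_def)
qed

section \<open>Contravariant duality\<close>

lemma top_index_rev: "top_index (rev L) = rev (top_index L)"
  by (simp add: top_index_eq_map rev_map)

lemma sized_rev [simp]: "sized n (rev L) \<longleftrightarrow> sized n L"
  by (simp add: sized_def)

lemma top_series_append: "top_series (L @ L') i = top_series L i * top_series L' i"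
  by (induction L i rule: top_series.induct) (auto simp: mult.assoc)

lemma top_series_rev: "top_series (rev L) i = top_series L i"
proof (induction L i rule: top_series.induct)
  case (2 k t L i)
  then show ?case
    by (simp add: top_series_append mult.commute del: top_series.simps(2)) (simp add: mult.commute)
qed simp

lemma vacuum_ext_tensor:
  assumes L: "sized n L"
  shows "vacuum n (ext_tensor n L) (top_index L) (\<lambda>i. fps_nth (top_series L i))"
  unfolding vacuum_def
proof (intro conjI ballI allI impI yangian_entries_ext_tensor top_index_in_basis L)
  have top: "top_index L \<in> basis (ext_tensor n L)"
    using L by (rule top_index_in_basis)
  fix i r assume i: "i \<in> {1..n}"
  show "act (ext_tensor n L) i i r (basis_vector (top_index L))
      = (\<lambda>x. fps_nth (top_series L i) r * basis_vector (top_index L) x)"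
  proof
    fix x
    show "act (ext_tensor n L) i i r (basis_vector (top_index L)) x
      = fps_nth (top_series L i) r * basis_vector (top_index L) x"
    proof (cases "x \<in> basis (ext_tensor n L)")
      case True
      then have "coef (ext_tensor n L) i i r x (top_index L) = fps_nth (if x = top_index L then top_series L i else 0) r"
        using ser_top_diag[OF i True] by (metis ser_nth)
      then show ?thesis
        using True top by (simp add: act_basis_vector) (simp add: basis_vector_def)
    next
      case False
      then show ?thesis
        using top by (auto simp: act_def basis_vector_def)
    qed
  qed
  fix j assume j: "j \<in> {1..n}"
  show "act (ext_tensor n L) i j r (basis_vector (top_index L)) = (\<lambda>_. 0)" if "i < j"
  proof
    fix x
    have "coef (ext_tensor n L) i j r x (top_index L) = 0"
      using ser_top_raise[OF i that, of L x] by (metis ser_nth fps_zero_nth)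
    then show "act (ext_tensor n L) i j r (basis_vector (top_index L)) x = 0"
      using top by (cases "x \<in> basis (ext_tensor n L)") (simp_all add: act_basis_vector, simp add: act_def)
  qed
  show "act (ext_tensor n L) i j r f (top_index L) = 0" if "j < i" for f
  proof -
    have "coef (ext_tensor n L) i j r (top_index L) y = 0" if y: "y \<in> basis (ext_tensor n L)" for y
    proof -
      \<comment> \<open>Transposition turns a lowering operator into a raising operator on the
        reversed tensor product, whose highest vector it kills.\<close>
      have "coef (ext_tensor n L) i j r (top_index L) y
          = coef (ext_tensor n (rev L)) j i r (rev y) (top_index (rev L))"
        using coef_ext_tensor_rev[OF y top j i] by (simp add: top_index_rev)
      also have "\<dots> = 0"
        using ser_top_raise[OF j \<open>j < i\<close>, of "rev L" "rev y"] by (metis ser_nth fps_zero_nth)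
      finally show ?thesis .
    qed
    then show ?thesis
      by (simp add: act_def)
  qed
qed

text \<open>The contravariant pairing of \<open>T\<close> with \<open>S\<close>: T_ij on one side is
  adjoint to T_ji on the other. The reversal matches the opposite order of the factors.\<close>

definition pairing :: "nat \<Rightarrow> (nat \<times> complex) list \<Rightarrow> (nat set list \<Rightarrow> complex) \<Rightarrow> (nat set list \<Rightarrow> complex) \<Rightarrow> complex" where
  "pairing n L u f = (\<Sum>x\<in>basis (ext_tensor n L). u (rev x) * f x)"

lemma pairing_act:
  assumes "i \<in> {1..n}" "j \<in> {1..n}"
  shows "pairing n L (act (ext_tensor n (rev L)) i j r u) f = pairing n L u (act (ext_tensor n L) j i r f)"
proof -
  let ?Z = "basis (ext_tensor n L)"
  have "pairing n L (act (ext_tensor n (rev L)) i j r u) f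
      = (\<Sum>x\<in>?Z. (\<Sum>y\<in>?Z. coef (ext_tensor n (rev L)) i j r (rev x) (rev y) * u (rev y)) * f x)"
    by (simp add: pairing_def act_def sum_basis_ext_tensor_rev)
  also have "\<dots> = (\<Sum>x\<in>?Z. \<Sum>y\<in>?Z. u (rev y) * (coef (ext_tensor n L) j i r y x * f x))"
    using assms by (simp add: coef_ext_tensor_rev sum_distrib_left mult_ac)
  also have "\<dots> = (\<Sum>y\<in>?Z. \<Sum>x\<in>?Z. u (rev y) * (coef (ext_tensor n L) j i r y x * f x))"
    by (rule sum.swap)
  also have "\<dots> = pairing n L u (act (ext_tensor n L) j i r f)"
    by (simp add: pairing_def act_def sum_distrib_left)
  finally show ?thesis .
qed

lemma pairing_basis_vector:
  assumes "y \<in> basis (ext_tensor n L)"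
  shows "pairing n L u (basis_vector y) = u (rev y)"
  using assms sum_delta_right[of "basis (ext_tensor n L)" y "\<lambda>x. u (rev x)" True]
  by (simp add: pairing_def basis_vector_def)

text \<open>The annihilator in \<open>S\<close> of the submodule generated by \<open>u\<close> is
  stable. The hypothesis puts the highest vector into it, so by cyclicity it is everything, and the
  pairing is non-degenerate.\<close>

lemma cocyclic:
  assumes cyc: "cyclic_vector n (ext_tensor n L) (basis_vector (top_index L))" and L: "sized n L"
    and u: "u \<in> supported (ext_tensor n (rev L))"
    and zero: "\<And>w. word_ok n w \<Longrightarrow> wact (ext_tensor n (rev L)) w u (top_index (rev L)) = 0"
  shows "u = (\<lambda>_. 0)"
proof -
  let ?T = "ext_tensor n (rev L)"
  define N where "N = {f. \<forall>w. word_ok n w \<longrightarrow> pairing n L (wact ?T w u) f = 0}"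
  have "stable n (ext_tensor n L) N"
    unfolding stable_def
  proof (intro conjI ballI allI)
    fix i j r f assume ij: "i \<in> {1..n}" "j \<in> {1..n}" and f: "f \<in> N"
    show "act (ext_tensor n L) i j r f \<in> N"
      unfolding N_def
    proof (intro CollectI allI impI)
      fix w assume w: "word_ok n w"
      have "pairing n L (wact ?T w u) (act (ext_tensor n L) i j r f) = pairing n L (wact ?T ((j, i, r) # w) u) f"
        using ij by (simp add: pairing_act)
      also have "\<dots> = 0"
        using f w ij by (simp add: N_def del: wact.simps)
      finally show "pairing n L (wact ?T w u) (act (ext_tensor n L) i j r f) = 0" .
    qed
  next
    fix f g assume "f \<in> N" "g \<in> N"
    then show "(\<lambda>x. f x + g x) \<in> N"
      by (simp add: N_def pairing_def distrib_left sum.distrib)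
  next
    fix c f assume "f \<in> N"
    moreover have "pairing n L v (\<lambda>x. c * f x) = c * pairing n L v f" for v
      by (simp add: pairing_def sum_distrib_left mult_ac)
    ultimately show "(\<lambda>x. c * f x) \<in> N"
      by (simp add: N_def)
  qed (simp add: N_def pairing_def)
  moreover have "basis_vector (top_index L) \<in> N"
    using zero L by (simp add: N_def pairing_basis_vector top_index_in_basis top_index_rev)
  ultimately have N: "supported (ext_tensor n L) \<subseteq> N"
    using cyc by (auto simp: cyclic_vector_def)
  show ?thesis
  proof
    fix x
    show "u x = 0"
    proof (cases "x \<in> basis ?T")
      case True
      then have x: "rev x \<in> basis (ext_tensor n L)"
        by (rule rev_in_basis_ext_tensor[of "rev x" n L, unfolded rev_rev_ident, THEN iffD1])
      have "basis_vector (rev x) \<in> N"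
        by (rule subsetD[OF N basis_vector_supported[OF x]])
      then have "word_ok n [] \<longrightarrow> pairing n L (wact ?T [] u) (basis_vector (rev x)) = 0"
        unfolding N_def by blast
      then show ?thesis
        using x by (simp add: pairing_basis_vector)
    next
      case False
      then show ?thesis
        using u by (simp add: supported_def)
    qed
  qed
qed

section \<open>Existence of the intertwining operator\<close>

lemma carrier_space_of [simp]: "carrier (space_of B) = supported B"
  and zero_space_of [simp]: "\<zero>\<^bsub>space_of B\<^esub> = (\<lambda>_. 0)"
  and add_space_of [simp]: "f \<oplus>\<^bsub>space_of B\<^esub> g = (\<lambda>x. f x + g x)"
  and smult_space_of [simp]: "c \<odot>\<^bsub>space_of B\<^esub> f = (\<lambda>x. c * f x)"
  and gen_space_of [simp]: "gen (space_of B) = act B"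
  by (auto simp: space_of_def supported_def act_def fun_eq_iff)

lemma linear_map_iff:
  "linear_map (space_of B) (space_of B') K \<longleftrightarrow> K \<in> supported B \<rightarrow> supported B' \<and>
     (\<forall>f\<in>supported B. \<forall>g\<in>supported B. K (\<lambda>x. f x + g x) = (\<lambda>x. K f x + K g x)) \<and>
     (\<forall>c. \<forall>f\<in>supported B. K (\<lambda>x. c * f x) = (\<lambda>x. c * K f x))"
  by (simp add: linear_map_def)

lemma linear_map_add:
  assumes "linear_map (space_of B) (space_of B') K" "f \<in> supported B" "g \<in> supported B"
  shows "K (\<lambda>x. f x + g x) = (\<lambda>x. K f x + K g x)"
  using assms by (simp add: linear_map_iff)

lemma linear_map_smult:
  assumes "linear_map (space_of B) (space_of B') K" "f \<in> supported B"
  shows "K (\<lambda>x. c * f x) = (\<lambda>x. c * K f x)"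
  using assms by (simp add: linear_map_iff)

lemma linear_map_zero:
  assumes "linear_map (space_of B) (space_of B') K"
  shows "K (\<lambda>_. 0) = (\<lambda>_. 0)"
  using linear_map_smult[OF assms, of "\<lambda>_. 0" 0] by (simp add: supported_def)

lemma linear_map_supported:
  "linear_map (space_of B) (space_of B') K \<Longrightarrow> f \<in> supported B \<Longrightarrow> K f \<in> supported B'"
  by (auto simp: linear_map_iff)

lemma intertwiner_iff:
  "intertwiner n (space_of B) (space_of B') K \<longleftrightarrow> linear_map (space_of B) (space_of B') K \<and>
     (\<forall>i\<in>{1..n}. \<forall>j\<in>{1..n}. \<forall>r. \<forall>f\<in>supported B. K (act B i j r f) = act B' i j r (K f))"
  by (simp add: intertwiner_def)

text \<open>The submodule of the direct sum generated by the pair of highest vectors. It is the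
  graph of the intended operator once it is known to be single-valued.\<close>

inductive_set module_graph ::
    "nat \<Rightarrow> 'b based_space \<Rightarrow> 'c based_space \<Rightarrow> ('b \<Rightarrow> complex) \<Rightarrow> ('c \<Rightarrow> complex) \<Rightarrow>
      (('b \<Rightarrow> complex) \<times> ('c \<Rightarrow> complex)) set"
  for n B B' v v'
where
  base: "(v, v') \<in> module_graph n B B' v v'"
| add: "(f, g) \<in> module_graph n B B' v v' \<Longrightarrow> (f', g') \<in> module_graph n B B' v v' \<Longrightarrow>
    (\<lambda>x. f x + f' x, \<lambda>x. g x + g' x) \<in> module_graph n B B' v v'"
| smult: "(f, g) \<in> module_graph n B B' v v' \<Longrightarrow> (\<lambda>x. c * f x, \<lambda>x. c * g x) \<in> module_graph n B B' v v'"
| act: "(f, g) \<in> module_graph n B B' v v' \<Longrightarrow> i \<in> {1..n} \<Longrightarrow> j \<in> {1..n} \<Longrightarrow>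
    (act B i j r f, act B' i j r g) \<in> module_graph n B B' v v'"

lemma supported_add: "f \<in> supported B \<Longrightarrow> g \<in> supported B \<Longrightarrow> (\<lambda>x. f x + g x) \<in> supported B"
  and supported_smult: "f \<in> supported B \<Longrightarrow> (\<lambda>x. c * f x) \<in> supported B"
  and supported_zero: "(\<lambda>_. 0) \<in> supported B"
  by (auto simp: supported_def)

text \<open>Cyclicity makes the graph total. It is single-valued because a pair (0, u) has equal
  vacuum expectations in both components for every word, so those of \<open>u\<close> vanish and
  \<open>cocyc\<close> gives u = 0.\<close>

lemma intertwiner_exists:
  assumes B: "vacuum n B p \<Lambda>" and B': "vacuum n B' p' \<Lambda>"
    and cyc: "cyclic_vector n B (basis_vector p)"
    and cocyc: "\<And>u. u \<in> supported B' \<Longrightarrow> (\<And>w. word_ok n w \<Longrightarrow> wact B' w u p' = 0) \<Longrightarrow> u = (\<lambda>_. 0)"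
  shows "\<exists>K. intertwiner n (space_of B) (space_of B') K \<and> K (basis_vector p) = basis_vector p'"
proof -
  define G where "G = module_graph n B B' (basis_vector p) (basis_vector p')"
  note G_intros = module_graph.intros[where v = "basis_vector p" and v' = "basis_vector p'" and B = B and B' = B' and n = n, folded G_def]
  have supp: "f \<in> supported B \<and> g \<in> supported B'" if "(f, g) \<in> G" for f g
    using that B B' unfolding G_def
    by induction (auto simp: vacuum_def basis_vector_supported supported_add supported_smult act_supported)
  have words: "wact B w f p = wact B' w g p'" if "(f, g) \<in> G" "word_ok n w" for f g w
    using that unfolding G_def
  proof (induction arbitrary: w)
    case base
    then show ?case
      using B B' by (rule_tac vacuum_expectation_unique)
  next
    case (act f g i j r)
    then show ?case
      using act.IH[of "w @ [(i, j, r)]"] by (simp add: wact_append)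
  qed (auto simp: wact_add wact_smult)
  have single: "g = g'" if "(f, g) \<in> G" "(f, g') \<in> G" for f g g'
  proof -
    have "(\<lambda>x. - 1 * f x, \<lambda>x. - 1 * g' x) \<in> G"
      by (rule G_intros) (rule that)
    then have "(\<lambda>x. f x + - 1 * f x, \<lambda>x. g x + - 1 * g' x) \<in> G"
      using that by (intro G_intros)
    then have diff: "(\<lambda>_. 0, \<lambda>x. g x - g' x) \<in> G"
      by simp
    have "(\<lambda>x. g x - g' x) = (\<lambda>_. 0)"
    proof (rule cocyc)
      show "(\<lambda>x. g x - g' x) \<in> supported B'"
        using supp[OF diff] by simp
      show "wact B' w (\<lambda>x. g x - g' x) p' = 0" if "word_ok n w" for w
        using words[OF diff that] by (simp add: wact_zero)
    qed
    then show ?thesis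
      by (simp add: fun_eq_iff)
  qed
  have "stable n B (Domain G)"
    unfolding stable_def
  proof (intro conjI ballI allI)
    have "(\<lambda>x. 0 * basis_vector p x, \<lambda>x. 0 * basis_vector p' x) \<in> G"
      by (intro G_intros)
    then show "(\<lambda>_. 0) \<in> Domain G"
      by (auto intro: DomainI)
  qed (blast intro: G_intros)+
  moreover have "basis_vector p \<in> Domain G"
    by (auto intro: G_intros)
  ultimately have dom: "supported B \<subseteq> Domain G"
    using cyc by (auto simp: cyclic_vector_def)
  define K where "K f = (THE g. (f, g) \<in> G)" for f
  have K_eq: "K f = g" if "(f, g) \<in> G" for f g
    using that single unfolding K_def by blast
  have K: "(f, K f) \<in> G" if "f \<in> supported B" for f
    using that dom K_eq by blast
  have "intertwiner n (space_of B) (space_of B') K"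
    unfolding intertwiner_iff linear_map_iff
  proof (intro conjI ballI allI)
    show "K \<in> supported B \<rightarrow> supported B'"
      using K supp by blast
  qed (intro K_eq G_intros K; assumption)+
  moreover have "K (basis_vector p) = basis_vector p'"
    by (intro K_eq G_intros)
  ultimately show ?thesis
    by blast
qed

text \<open>The set on which \<open>K'\<close> agrees with the multiple of \<open>K\<close> is
  stable and contains the cyclic vector.\<close>

lemma intertwiner_determined:
  assumes cyc: "cyclic_vector n B v" and v: "v \<in> supported B"
    and K: "intertwiner n (space_of B) (space_of B') K" and K': "intertwiner n (space_of B) (space_of B') K'"
    and eq: "K' v = (\<lambda>x. c * K v x)" and f: "f \<in> supported B"
  shows "K' f = (\<lambda>x. c * K f x)"
proof -
  define N where "N = {f \<in> supported B. K' f = (\<lambda>x. c * K f x)}"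
  have "stable n B N"
    unfolding stable_def
  proof (intro conjI ballI allI)
    show "(\<lambda>_. 0) \<in> N"
      using K K' by (simp add: N_def intertwiner_iff linear_map_zero[of B B'] supported_zero)
  qed (use K K' in \<open>simp_all add: N_def intertwiner_iff linear_map_iff supported_add supported_smult
      act_supported act_smult algebra_simps\<close>)
  moreover have "v \<in> N"
    using v eq by (simp add: N_def)
  ultimately show ?thesis
    using cyc f by (auto simp: cyclic_vector_def N_def)
qed

section \<open>Weights\<close>

text \<open>T_ii^(1) is primitive for the coproduct, so the actions of E_ii on the single factors
  add up.\<close>

lemma coef_ext_tensor_diag_1:
  assumes "i \<in> {1..n}" "xs \<in> basis (ext_tensor n L)" "ys \<in> basis (ext_tensor n L)"
  shows "coef (ext_tensor n L) i i 1 xs ys = (if xs = ys then of_nat (length (filter (\<lambda>x. i \<in> x) xs)) else 0)"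
  using assms
proof (induction L arbitrary: xs ys)
  case Nil
  then show ?case
    by (simp add: basis_ext_tensor_Nil ext_tensor_def tensor_def)
next
  case (Cons q L)
  obtain k t where q: "q = (k, t)"
    by force
  then obtain x xs' y ys' where xs: "xs = x # xs'" and ys: "ys = y # ys'"
    using Cons.prems by (auto simp: basis_ext_tensor_Cons)
  have mem: "x \<in> ext_basis n k" "y \<in> ext_basis n k" "xs' \<in> basis (ext_tensor n L)" "ys' \<in> basis (ext_tensor n L)"
    using Cons.prems by (auto simp: q xs ys)
  have Ph: "coef (Phi n k t) i p 0 x y = (if i = p \<and> x = y then 1 else 0)"
      "coef (Phi n k t) i p (Suc 0) x y = ext_E i p x y" for p
    by (simp_all add: Phi_def)
  have coef0: "coef (ext_tensor n L) p i 0 xs' ys' = (if p = i \<and> xs' = ys' then 1 else 0)" if "p \<in> {1..n}" for p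
    using yangian_entries_ext_tensor[of n L] mem that Cons.prems(1) unfolding yangian_entries_def by blast
  have diag: "ext_E i i x y = (if x = y \<and> i \<in> x then 1 else 0)"
    by (auto simp: ext_E_as_signs insert_absorb jw_sign_remove[OF ext_basis_finite[OF mem(2)]])
  have "coef (ext_tensor n (q # L)) i i 1 xs ys
      = (\<Sum>p = 1..n. coef (Phi n k t) i p 0 x y * coef (ext_tensor n L) p i 1 xs' ys'
           + coef (Phi n k t) i p 1 x y * coef (ext_tensor n L) p i 0 xs' ys')"
    by (simp add: q xs ys coef_ext_tensor_Cons)
  also have "\<dots> = (\<Sum>p = 1..n. if p = i then (if x = y then coef (ext_tensor n L) i i 1 xs' ys' else 0)
        + (if xs' = ys' then ext_E i i x y else 0) else 0)"
    by (intro sum.cong refl) (auto simp: Ph coef0)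
  also have "\<dots> = (if x = y then coef (ext_tensor n L) i i 1 xs' ys' else 0) + (if xs' = ys' then ext_E i i x y else 0)"
    using Cons.prems(1) by (simp only: sum.delta finite_atLeastAtMost if_True)
  also have "coef (ext_tensor n L) i i 1 xs' ys' = (if xs' = ys' then of_nat (length (filter (\<lambda>x. i \<in> x) xs')) else 0)"
    using Cons.prems mem by (intro Cons.IH) auto
  finally show ?case
    using diag by (auto simp: xs ys)
qed

definition total :: "nat set list \<Rightarrow> nat" where
  "total xs = (\<Sum>x\<leftarrow>xs. \<Sum>x)"

lemma sum_weighted_counts:
  assumes "\<forall>x\<in>set xs. x \<subseteq> {1..n}"
  shows "(\<Sum>i = 1..n. i * length (filter (\<lambda>x. i \<in> x) xs)) = total xs"
  using assms
proof (induction xs)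
  case (Cons x xs)
  have "(\<Sum>i = 1..n. i * length (filter (\<lambda>x. i \<in> x) (x # xs)))
      = (\<Sum>i = 1..n. (if i \<in> x then i else 0) + i * length (filter (\<lambda>x. i \<in> x) xs))"
    by (intro sum.cong) auto
  also have "\<dots> = (\<Sum>i\<in>{1..n} \<inter> x. i) + (\<Sum>i = 1..n. i * length (filter (\<lambda>x. i \<in> x) xs))"
    by (simp only: sum.distrib sum.inter_restrict finite_atLeastAtMost)
  also have "{1..n} \<inter> x = x"
    using Cons.prems by auto
  finally show ?case
    using Cons by (simp add: total_def)
qed (simp add: total_def)

text \<open>The Cartan element summing i E_ii. Its eigenvalue \<open>total\<close> takes its minimum
  only at the highest vector, so this single operator separates that vector from all other basis
  vectors.\<close>

definition weight_op :: "nat \<Rightarrow> 'b based_space \<Rightarrow> ('b \<Rightarrow> complex) \<Rightarrow> 'b \<Rightarrow> complex" where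
  "weight_op n B f = (\<lambda>x. \<Sum>i = 1..n. of_nat i * act B i i 1 f x)"

lemma weight_op_ext_tensor:
  assumes f: "f \<in> supported (ext_tensor n L)"
  shows "weight_op n (ext_tensor n L) f = (\<lambda>x. of_nat (total x) * f x)"
proof
  fix x
  show "weight_op n (ext_tensor n L) f x = of_nat (total x) * f x"
  proof (cases "x \<in> basis (ext_tensor n L)")
    case True
    then have sub: "\<forall>s\<in>set x. s \<subseteq> {1..n}"
      by (fastforce simp: in_basis_ext_tensor_iff list_all2_conv_all_nth in_set_conv_nth ext_basis_def)
    have "act (ext_tensor n L) i i 1 f x = of_nat (length (filter (\<lambda>s. i \<in> s) x)) * f x" if "i \<in> {1..n}" for i
    proof -
      have "coef (ext_tensor n L) i i 1 x y * f y = (if x = y then of_nat (length (filter (\<lambda>s. i \<in> s) x)) * f y else 0)"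
        if "y \<in> basis (ext_tensor n L)" for y
        using coef_ext_tensor_diag_1[OF \<open>i \<in> {1..n}\<close> True that] by simp
      then have "act (ext_tensor n L) i i 1 f x
          = (\<Sum>y\<in>basis (ext_tensor n L). if x = y then of_nat (length (filter (\<lambda>s. i \<in> s) x)) * f y else 0)"
        using True unfolding act_def by (simp only: if_True cong: sum.cong)
      then show ?thesis
        using True by simp
    qed
    then have "weight_op n (ext_tensor n L) f x
        = of_nat (\<Sum>i = 1..n. i * length (filter (\<lambda>s. i \<in> s) x)) * f x"
      by (simp add: weight_op_def sum_distrib_right mult.assoc)
    then show ?thesis
      by (simp only: sum_weighted_counts[OF sub])
  next
    case False
    then show ?thesis
      using f by (simp add: weight_op_def act_def supported_def)
  qed
qed

text \<open>Outside their intersection, x and {1..k} have equally many elements; those of x are at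
  least k + 1, those of {1..k} at most k.\<close>

lemma sum_minimal:
  assumes "x \<in> ext_basis n k" "x \<noteq> {1..k}"
  shows "\<Sum>{1..k} < \<Sum>x"
proof -
  have fin: "finite x" and card: "card x = k" and pos: "\<forall>s\<in>x. s \<ge> 1"
    using assms by (auto simp: ext_basis_def intro: finite_subset)
  define m where "m = card (x - {1..k})"
  have "card (x - {1..k}) + card (x \<inter> {1..k}) = k" "card ({1..k} - x) + card (x \<inter> {1..k}) = k"
    using fin card card_Diff_subset_Int[of x "{1..k}"] card_Diff_subset_Int[of "{1..k}" x]
      card_mono[of x "x \<inter> {1..k}"] card_mono[of "{1..k}" "x \<inter> {1..k}"]
    by (auto simp: Int_commute)
  then have m: "card ({1..k} - x) = m"
    by (simp add: m_def)
  have "m \<noteq> 0"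
  proof
    assume "m = 0"
    then have "x \<subseteq> {1..k}"
      using fin by (simp add: m_def)
    then show False
      using assms card by (metis card_atLeastAtMost card_subset_eq diff_Suc_1 finite_atLeastAtMost)
  qed
  have "\<Sum>({1..k} - x) \<le> card ({1..k} - x) * k"
    using sum_bounded_above[of "{1..k} - x" "\<lambda>s. s" k] by auto
  moreover have "Suc k \<le> s" if "s \<in> x - {1..k}" for s
    using that pos by (cases "s \<le> k") auto
  then have "m * Suc k \<le> \<Sum>(x - {1..k})"
    using sum_bounded_below[of "x - {1..k}" "Suc k" "\<lambda>s. s"] by (simp add: m_def del: mult_Suc_right)
  ultimately have "\<Sum>({1..k} - x) < \<Sum>(x - {1..k})"
    using m \<open>m \<noteq> 0\<close> by simp
  moreover have "\<Sum>{1..k} = \<Sum>({1..k} - x) + \<Sum>(x \<inter> {1..k})"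
    using sum.Int_Diff[of "{1..k}" "\<lambda>s. s" x] by (simp add: Int_commute)
  moreover have "\<Sum>x = \<Sum>(x - {1..k}) + \<Sum>(x \<inter> {1..k})"
    using sum.Int_Diff[OF fin, of "\<lambda>s. s" "{1..k}"] by simp
  ultimately show ?thesis
    by linarith
qed

lemma total_minimal:
  assumes "xs \<in> basis (ext_tensor n L)"
  shows "total (top_index L) \<le> total xs \<and> (total xs = total (top_index L) \<longrightarrow> xs = top_index L)"
  using assms
proof (induction L arbitrary: xs rule: top_index.induct)
  case 1
  then show ?case
    by (simp add: basis_ext_tensor_Nil)
next
  case (2 k t L)
  then obtain x ys where xs: "xs = x # ys" and x: "x \<in> ext_basis n k" and ys: "ys \<in> basis (ext_tensor n L)"
    by (auto simp: basis_ext_tensor_Cons)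
  show ?case
    using sum_minimal[OF x] 2(1)[OF ys] by (cases "x = {1..k}") (auto simp: xs total_def)
qed

text \<open>Interpolation: the product of \<open>weight_op\<close> minus c, over all eigenvalues c
  other than the minimal one, preserves \<open>N\<close> and projects onto the highest vector up to
  a non-zero factor.\<close>

lemma stable_top_projection:
  assumes N: "stable n (ext_tensor n L) N" and u: "u \<in> N" "u \<in> supported (ext_tensor n L)"
    and nz: "u (top_index L) \<noteq> 0"
  shows "basis_vector (top_index L) \<in> N"
proof -
  let ?B = "ext_tensor n L"
  let ?W = "total ` (basis ?B - {top_index L})"
  have *: "(\<lambda>x. (\<Prod>c\<in>A. of_nat (total x) - of_nat c) * u x) \<in> N" if "finite A" for A
    using that
  proof (induction A)
    case (insert c A)
    let ?f = "\<lambda>x. (\<Prod>c\<in>A. of_nat (total x) - of_nat c) * u x"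
    have "?f \<in> supported ?B"
      using u by (simp add: supported_def)
    moreover have "weight_op n ?B ?f \<in> N"
      unfolding weight_op_def
      by (intro stable_sum[OF N] stable_smult[OF N] stable_act[OF N] insert.IH)
    ultimately have "(\<lambda>x. of_nat (total x) * ?f x - of_nat c * ?f x) \<in> N"
      using insert by (intro stable_diff[OF N] stable_smult[OF N]) (simp_all add: weight_op_ext_tensor)
    then show ?case
      using insert by (simp add: algebra_simps)
  qed (use u in simp)
  define a where "a = (\<Prod>c\<in>?W. of_nat (total (top_index L)) - of_nat c) * u (top_index L)"
  have "(\<lambda>x. (\<Prod>c\<in>?W. of_nat (total x) - of_nat c) * u x) = (\<lambda>x. a * basis_vector (top_index L) x)"
  proof
    fix x
    show "(\<Prod>c\<in>?W. of_nat (total x) - of_nat c) * u x = a * basis_vector (top_index L) x"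
    proof (cases "x = top_index L \<or> x \<notin> basis ?B")
      case True
      then show ?thesis
        using u nz by (auto simp: a_def basis_vector_def supported_def)
    next
      case False
      then have "(\<Prod>c\<in>?W. of_nat (total x) - of_nat c) = (0 :: complex)"
        by (intro prod_zero) auto
      then show ?thesis
        using False by (simp add: basis_vector_def)
    qed
  qed
  then have "(\<lambda>x. a * basis_vector (top_index L) x) \<in> N"
    using *[of ?W] by simp
  then have "(\<lambda>x. 1 / a * (a * basis_vector (top_index L) x)) \<in> N"
    by (rule stable_smult[OF N])
  moreover have "a \<noteq> 0"
    using nz total_minimal[of _ n L] by (fastforce simp: a_def)
  ultimately show ?thesis
    by simp
qed

lemma total_rev: "total (rev xs) = total xs"
  by (simp add: total_def rev_map[symmetric] sum_list_rev)

lemma intertwiner_total: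
  assumes K: "intertwiner n (space_of (ext_tensor n L)) (space_of (ext_tensor n L')) K"
    and f: "f \<in> supported (ext_tensor n L)"
  shows "K (\<lambda>x. of_nat (total x) * f x) = (\<lambda>x. of_nat (total x) * K f x)"
proof -
  let ?B = "ext_tensor n L" and ?B' = "ext_tensor n L'"
  have lin: "linear_map (space_of ?B) (space_of ?B') K"
    using K by (simp add: intertwiner_iff)
  have sum: "K (\<lambda>x. \<Sum>i\<in>A. of_nat i * act ?B i i 1 f x) = (\<lambda>x. \<Sum>i\<in>A. of_nat i * act ?B' i i 1 (K f) x)"
    if "finite A" "A \<subseteq> {1..n}" for A
    using that
  proof (induction A)
    case (insert i A)
    have s: "(\<lambda>x. of_nat i * act ?B i i 1 f x) \<in> supported ?B" "(\<lambda>x. \<Sum>i\<in>A. of_nat i * act ?B i i 1 f x) \<in> supported ?B"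
      by (auto simp: supported_def act_def)
    have "K (\<lambda>x. of_nat i * act ?B i i 1 f x + (\<Sum>i\<in>A. of_nat i * act ?B i i 1 f x))
      = (\<lambda>x. K (\<lambda>x. of_nat i * act ?B i i 1 f x) x + K (\<lambda>x. \<Sum>i\<in>A. of_nat i * act ?B i i 1 f x) x)"
      by (rule linear_map_add[OF lin s])
    also have "K (\<lambda>x. of_nat i * act ?B i i 1 f x) = (\<lambda>x. of_nat i * K (act ?B i i 1 f) x)"
      by (rule linear_map_smult[OF lin act_supported])
    also have "K (act ?B i i 1 f) = act ?B' i i 1 (K f)"
      using K f insert.prems by (simp add: intertwiner_iff)
    finally show ?case
      using insert by simp
  qed (simp add: linear_map_zero[OF lin])
  have "K f \<in> supported ?B'"
    using lin f by (auto simp: linear_map_iff)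
  then show ?thesis
    using sum[of "{1..n}"] weight_op_ext_tensor[OF f] weight_op_ext_tensor[of "K f" n L']
    by (simp add: weight_op_def)
qed

text \<open>An intertwining operator preserves the eigenvalues of \<open>weight_op\<close>, and the
  minimal one has multiplicity one in the target. Hence the operator is fixed up to a scalar even
  where the modules are reducible.\<close>

lemma intertwiner_top:
  assumes K: "intertwiner n (space_of (ext_tensor n L)) (space_of (ext_tensor n (rev L))) K" and L: "sized n L"
  shows "K (basis_vector (top_index L)) = (\<lambda>x. K (basis_vector (top_index L)) (top_index (rev L)) * basis_vector (top_index (rev L)) x)"
proof
  fix x
  let ?e = "basis_vector (top_index L) :: nat set list \<Rightarrow> complex"
  have e: "?e \<in> supported (ext_tensor n L)"
    using L by (simp add: basis_vector_supported top_index_in_basis)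
  have lin: "linear_map (space_of (ext_tensor n L)) (space_of (ext_tensor n (rev L))) K"
    using K by (simp add: intertwiner_iff)
  have "(\<lambda>x. of_nat (total x) * ?e x) = (\<lambda>x. of_nat (total (top_index L)) * ?e x)"
    by (auto simp: basis_vector_def)
  then have "(\<lambda>x. of_nat (total x) * K ?e x) = (\<lambda>x. of_nat (total (top_index L)) * K ?e x)"
    using intertwiner_total[OF K e] by (simp add: linear_map_smult[OF lin e])
  then have "of_nat (total x) * K ?e x = of_nat (total (top_index L)) * K ?e x"
    by (rule fun_cong)
  then have *: "total x = total (top_index L)" if "K ?e x \<noteq> 0"
    using that by simp
  have "x = top_index (rev L)" if nz: "K ?e x \<noteq> 0"
  proof -
    have "K ?e \<in> supported (ext_tensor n (rev L))"
      using lin e by (auto simp: linear_map_iff)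
    then have "x \<in> basis (ext_tensor n (rev L))"
      using nz by (auto simp: supported_def)
    then show ?thesis
      using total_minimal *[OF nz] by (metis top_index_rev total_rev)
  qed
  then show "K ?e x = K ?e (top_index (rev L)) * basis_vector (top_index (rev L)) x"
    by (auto simp: basis_vector_def)
qed

section \<open>Polynomial functions\<close>

lemma polynomial_fun_uminus: "polynomial_fun m p \<Longrightarrow> polynomial_fun m (\<lambda>\<mu>. - p \<mu>)"
  using polynomial_fun.mult[OF polynomial_fun.const[of m "-1"]] by simp

lemma polynomial_fun_diff:
  "polynomial_fun m p \<Longrightarrow> polynomial_fun m q \<Longrightarrow> polynomial_fun m (\<lambda>\<mu>. p \<mu> - q \<mu>)"
  using polynomial_fun.add[OF _ polynomial_fun_uminus] by fastforce

lemma polynomial_fun_sum: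
  "(\<And>a. a \<in> A \<Longrightarrow> polynomial_fun m (p a)) \<Longrightarrow> polynomial_fun m (\<lambda>\<mu>. \<Sum>a\<in>A. p a \<mu>)"
  by (induction A rule: infinite_finite_induct) (auto intro: polynomial_fun.intros)

lemma polynomial_fun_prod:
  "(\<And>a. a \<in> A \<Longrightarrow> polynomial_fun m (p a)) \<Longrightarrow> polynomial_fun m (\<lambda>\<mu>. \<Prod>a\<in>A. p a \<mu>)"
  by (induction A rule: infinite_finite_induct) (auto intro: polynomial_fun.intros)

lemma polynomial_fun_power: "polynomial_fun m p \<Longrightarrow> polynomial_fun m (\<lambda>\<mu>. p \<mu> ^ k)"
  by (induction k) (auto intro: polynomial_fun.intros)

lemmas polynomial_fun_intros = polynomial_fun.intros polynomial_fun_diff polynomial_fun_sum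
  polynomial_fun_prod polynomial_fun_power

section \<open>Density of the generic points\<close>

lemma polynomial_fun_line:
  assumes "polynomial_fun m p"
  shows "\<exists>P. \<forall>z. p (\<lambda>a. x a + z * d a) = poly P z"
  using assms
proof induction
  case (const c)
  show ?case
    by (rule exI[of _ "[:c:]"]) simp
next
  case (coord a)
  show ?case
    by (rule exI[of _ "[:x a, d a:]"]) simp
next
  case (add p q)
  then show ?case
    by (metis poly_add)
next
  case (mult p q)
  then show ?case
    by (metis poly_mult)
qed

text \<open>On the line through \<open>x\<close> and \<open>y\<close> both functions become non-zero
  polynomials in one variable.\<close>

lemma polynomial_fun_no_zero_divisors:
  assumes p: "polynomial_fun m p" "p x \<noteq> 0" and q: "polynomial_fun m q" "q y \<noteq> 0"
  shows "\<exists>z. p z * q z \<noteq> 0"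
proof -
  obtain P where P: "p (\<lambda>a. x a + z * (y a - x a)) = poly P z" for z
    using polynomial_fun_line[OF p(1), of x "\<lambda>a. y a - x a"] by blast
  obtain Q where Q: "q (\<lambda>a. x a + z * (y a - x a)) = poly Q z" for z
    using polynomial_fun_line[OF q(1), of x "\<lambda>a. y a - x a"] by blast
  have "poly P 0 \<noteq> 0" "poly Q 1 \<noteq> 0"
    using P[of 0] Q[of 1] p q by auto
  then have "P * Q \<noteq> 0"
    by auto
  then obtain z where "poly (P * Q) z \<noteq> 0"
    using poly_all_0_iff_0 by blast
  then show ?thesis
    using P[of z] Q[of z] by (metis poly_mult)
qed

text \<open>Genericity excludes infinitely many hyperplanes, but a non-zero imaginary part avoids
  all integer differences at once. Along an imaginary direction with distinct components each pair
  of coordinates then excludes at most one N, and \<open>p\<close> excludes finitely many.\<close>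

lemma polynomial_fun_generic:
  assumes p: "polynomial_fun m p" "p x \<noteq> 0"
  shows "\<exists>\<mu>. generic m \<mu> \<and> p \<mu> \<noteq> 0"
proof -
  define pt where "pt z = (\<lambda>a. x a + z * (of_nat a * \<i>))" for z
  obtain P where P: "p (pt z) = poly P z" for z
    using polynomial_fun_line[OF p(1), of x "\<lambda>a. of_nat a * \<i>"] unfolding pt_def by blast
  have "P \<noteq> 0"
    using P[of 0] p by (auto simp: pt_def)
  define bad where "bad a b = {N :: nat. Im (x a - x b) + real N * (real a - real b) = 0}" for a b
  have "finite (bad a b)" if "a \<noteq> b" for a b
  proof (rule finite_subset)
    show "bad a b \<subseteq> {N. real N = - Im (x a - x b) / (real a - real b)}"
      using that by (auto simp: bad_def field_simps)
    show "finite {N. real N = - Im (x a - x b) / (real a - real b)}"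
    proof (cases "\<exists>N. real N = - Im (x a - x b) / (real a - real b)")
      case True
      then obtain N where "real N = - Im (x a - x b) / (real a - real b)"
        by blast
      then have "{N. real N = - Im (x a - x b) / (real a - real b)} = {N}"
        by (auto simp flip: of_nat_eq_iff[where 'a = real])
      then show ?thesis
        by simp
    qed simp
  qed
  then have fin: "finite (\<Union>a\<in>{1..m}. \<Union>b\<in>{1..m} - {a}. bad a b)"
    by auto
  have fin': "finite (of_nat -` {z. poly P z = 0} :: nat set)"
    using \<open>P \<noteq> 0\<close> by (intro finite_vimageI poly_roots_finite) (auto simp: inj_on_def)
  obtain N :: nat where N: "N \<notin> (\<Union>a\<in>{1..m}. \<Union>b\<in>{1..m} - {a}. bad a b) \<union> of_nat -` {z. poly P z = 0}"
    using ex_new_if_finite[OF infinite_UNIV_nat finite_UnI[OF fin fin']] by (elim exE)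
  have "generic m (pt (of_nat N))"
    unfolding generic_def
  proof (intro ballI impI)
    fix a b assume ab: "a \<in> {1..m}" "b \<in> {1..m}" "a \<noteq> b"
    then have "N \<notin> bad a b"
      using N by blast
    moreover have "Im (pt (of_nat N) a - pt (of_nat N) b) = Im (x a - x b) + real N * (real a - real b)"
      by (simp add: pt_def algebra_simps)
    ultimately have "Im (pt (of_nat N) a - pt (of_nat N) b) \<noteq> 0"
      by (simp add: bad_def)
    moreover have "Im z = 0" if "z \<in> \<int>" for z :: complex
      using that by (auto elim: Ints_cases)
    ultimately show "pt (of_nat N) a - pt (of_nat N) b \<notin> \<int>"
      by blast
  qed
  moreover have "p (pt (of_nat N)) \<noteq> 0"
    using N P by auto
  ultimately show ?thesis
    by blast
qed

lemma generic_exists: "\<exists>\<mu>. generic m \<mu>"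
  using polynomial_fun_generic[OF polynomial_fun.const[of m 1]] by auto

lemma generic_dominant:
  assumes "generic m \<mu>"
  shows "shifted_dominant m \<nu> \<mu>"
  unfolding shifted_dominant_def Let_def dominant_def
proof (intro ballI allI impI notI)
  fix a b k :: nat assume ab: "a \<in> {1..m}" "b \<in> {1..m}" "a < b" and "k \<ge> 1"
    and eq: "\<mu> a + of_nat (\<nu> a) + rho m a - (\<mu> b + of_nat (\<nu> b) + rho m b) = - of_nat k"
  have "\<mu> a - \<mu> b = - of_nat k - of_nat (\<nu> a) + of_nat (\<nu> b) + of_nat a - of_nat b"
    using eq by (simp add: rho_def algebra_simps)
  also have "\<dots> \<in> \<int>"
    by (intro Ints_add Ints_diff Ints_minus Ints_of_nat)
  finally show False
    using assms ab by (auto simp: generic_def)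
qed

text \<open>
  The polynomial \<open>s\<close> excludes a hypersurface, which may contain \<open>\<mu>\<close>, where the fractions occurring in
  \<open>rational_regular_on\<close> need not have the denominator \<open>q\<close>.
\<close>

definition rational_germ :: "nat \<Rightarrow> (nat \<Rightarrow> complex) \<Rightarrow> ((nat \<Rightarrow> complex) \<Rightarrow> complex) \<Rightarrow> bool" where
  "rational_germ m \<mu> g \<longleftrightarrow> (\<exists>p q s. polynomial_fun m p \<and> polynomial_fun m q \<and> polynomial_fun m s \<and>
     q \<mu> \<noteq> 0 \<and> (\<exists>x. s x \<noteq> 0) \<and> g \<mu> = p \<mu> / q \<mu> \<and>
     (\<forall>x. generic m x \<longrightarrow> s x \<noteq> 0 \<longrightarrow> q x \<noteq> 0 \<and> g x = p x / q x))"

lemma rational_germ_polynomial: "polynomial_fun m p \<Longrightarrow> rational_germ m \<mu> p"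
  unfolding rational_germ_def
  by (rule exI[of _ p], rule exI[of _ "\<lambda>_. 1"], rule exI[of _ "\<lambda>_. 1"]) (auto intro: polynomial_fun.const)

lemma
  assumes "rational_germ m \<mu> g" "rational_germ m \<mu> h"
  shows rational_germ_add: "rational_germ m \<mu> (\<lambda>x. g x + h x)"
    and rational_germ_mult: "rational_germ m \<mu> (\<lambda>x. g x * h x)"
proof -
  obtain p q s where g: "polynomial_fun m p" "polynomial_fun m q" "polynomial_fun m s" "q \<mu> \<noteq> 0"
    "\<exists>x. s x \<noteq> 0" "g \<mu> = p \<mu> / q \<mu>" "\<forall>x. generic m x \<longrightarrow> s x \<noteq> 0 \<longrightarrow> q x \<noteq> 0 \<and> g x = p x / q x"
    using assms(1) unfolding rational_germ_def by blast
  obtain p' q' s' where h: "polynomial_fun m p'" "polynomial_fun m q'" "polynomial_fun m s'" "q' \<mu> \<noteq> 0"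
    "\<exists>x. s' x \<noteq> 0" "h \<mu> = p' \<mu> / q' \<mu>" "\<forall>x. generic m x \<longrightarrow> s' x \<noteq> 0 \<longrightarrow> q' x \<noteq> 0 \<and> h x = p' x / q' x"
    using assms(2) unfolding rational_germ_def by blast
  have "\<exists>x. s x * s' x \<noteq> 0"
    using g h polynomial_fun_no_zero_divisors by metis
  note gh = this g h
  show "rational_germ m \<mu> (\<lambda>x. g x + h x)"
    unfolding rational_germ_def using gh
    by (intro exI[of _ "\<lambda>x. p x * q' x + p' x * q x"] exI[of _ "\<lambda>x. q x * q' x"] exI[of _ "\<lambda>x. s x * s' x"])
       (auto intro!: polynomial_fun.intros simp: add_frac_eq)
  show "rational_germ m \<mu> (\<lambda>x. g x * h x)"
    unfolding rational_germ_def using gh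
    by (intro exI[of _ "\<lambda>x. p x * p' x"] exI[of _ "\<lambda>x. q x * q' x"] exI[of _ "\<lambda>x. s x * s' x"])
       (auto intro!: polynomial_fun.intros)
qed

lemma rational_germ_sum:
  "(\<And>a. a \<in> A \<Longrightarrow> rational_germ m \<mu> (g a)) \<Longrightarrow> rational_germ m \<mu> (\<lambda>x. \<Sum>a\<in>A. g a x)"
  by (induction A rule: infinite_finite_induct)
     (auto intro: rational_germ_add rational_germ_polynomial polynomial_fun.const)

text \<open>If the value at \<open>\<mu>\<close> were non-zero, then so would be the numerator, and
  by density some generic point would avoid the zeros of both the numerator and
  \<open>s\<close>.\<close>

lemma rational_germ_eq_0:
  assumes "rational_germ m \<mu> g" "\<And>x. generic m x \<Longrightarrow> g x = 0"
  shows "g \<mu> = 0"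
proof (rule ccontr)
  assume "g \<mu> \<noteq> 0"
  obtain p q s where g: "polynomial_fun m p" "polynomial_fun m q" "polynomial_fun m s" "q \<mu> \<noteq> 0"
    "\<exists>x. s x \<noteq> 0" "g \<mu> = p \<mu> / q \<mu>" "\<forall>x. generic m x \<longrightarrow> s x \<noteq> 0 \<longrightarrow> q x \<noteq> 0 \<and> g x = p x / q x"
    using assms(1) unfolding rational_germ_def by blast
  then have "p \<mu> \<noteq> 0"
    using \<open>g \<mu> \<noteq> 0\<close> by auto
  then obtain y where "p y * s y \<noteq> 0"
    using g polynomial_fun_no_zero_divisors by metis
  then obtain x where "generic m x" "p x * s x \<noteq> 0"
    using g polynomial_fun_generic[of m "\<lambda>x. p x * s x" y] by (auto intro: polynomial_fun.mult)
  then show False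
    using assms(2) g by fastforce
qed

text \<open>The fraction chosen at \<open>\<mu>\<close> represents f at every generic point where
  its denominator and the global \<open>q\<close> are non-zero, since the fractions chosen elsewhere
  all equal p / q there.\<close>

lemma rational_germ_regular:
  assumes f: "rational_regular_on m D f" and \<mu>: "\<mu> \<in> D" and D: "\<And>x. generic m x \<Longrightarrow> x \<in> D"
  shows "rational_germ m \<mu> f"
proof -
  obtain p q where pq: "polynomial_fun m p" "polynomial_fun m q" "\<exists>x. q x \<noteq> 0"
    "\<forall>\<mu>\<in>D. regular_with_value m p q \<mu> (f \<mu>)"
    using f unfolding rational_regular_on_def by blast
  obtain p' q' where pq': "polynomial_fun m p'" "polynomial_fun m q'" "\<forall>x. p x * q' x = p' x * q x"
    "q' \<mu> \<noteq> 0" "f \<mu> = p' \<mu> / q' \<mu>"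
    using pq \<mu> unfolding regular_with_value_def by blast
  have "f x = p' x / q' x" if "generic m x" "q x * q' x \<noteq> 0" for x
  proof -
    have "x \<in> D"
      using D that by simp
    then obtain p'' q'' where "p x * q'' x = p'' x * q x" "q'' x \<noteq> 0" "f x = p'' x / q'' x"
      using pq unfolding regular_with_value_def by blast
    then have "f x = p x / q x"
      using that(2) by (simp add: frac_eq_eq)
    moreover have "p x * q' x = p' x * q x"
      using pq' by blast
    ultimately show ?thesis
      using that(2) by (simp add: frac_eq_eq)
  qed
  moreover have "\<exists>x. q x * q' x \<noteq> 0"
    using pq pq' polynomial_fun_no_zero_divisors by metis
  ultimately show ?thesis
    unfolding rational_germ_def using pq pq'
    by (intro exI[of _ p'] exI[of _ q'] exI[of _ "\<lambda>x. q x * q' x"]) (auto intro: polynomial_fun.mult)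
qed

subsection \<open>Adjugate matrices\<close>

lemma polynomial_fun_det:
  assumes "\<And>i j. i < d \<Longrightarrow> j < d \<Longrightarrow> polynomial_fun m (\<lambda>\<mu>. M \<mu> i j)"
  shows "polynomial_fun m (\<lambda>\<mu>. det (mat d d (\<lambda>(i, j). M \<mu> i j)))"
proof -
  have "det (mat d d (\<lambda>(i, j). M \<mu> i j))
      = (\<Sum>p\<in>{p. p permutes {0..<d}}. signof p * (\<Prod>i = 0..<d. M \<mu> i (p i)))" for \<mu>
    unfolding det_def by (auto intro!: sum.cong prod.cong simp: permutes_in_image)
  moreover have "polynomial_fun m (\<lambda>\<mu>. \<Sum>p\<in>{p. p permutes {0..<d}}. signof p * (\<Prod>i = 0..<d. M \<mu> i (p i)))"
  proof (intro polynomial_fun_sum polynomial_fun.mult polynomial_fun.const polynomial_fun_prod assms)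
    fix p i assume "p \<in> {p. p permutes {0..<d}}" "i \<in> {0..<d}"
    then show "i < d" "p i < d"
      using permutes_in_image[of p "{0..<d}" i] by auto
  qed
  ultimately show ?thesis
    by simp
qed

text \<open>Cramer's rule without division: after an enumeration of \<open>Y\<close> the witnesses
  are the determinant and the adjugate, polynomial in the entries. The determinant is 1 at
  \<open>\<mu>0\<close>, where the matrix is the identity.\<close>

lemma adjugate_family:
  fixes M :: "(nat \<Rightarrow> complex) \<Rightarrow> 'b \<Rightarrow> 'b \<Rightarrow> complex"
  assumes Y: "finite Y" and M: "\<And>x y. x \<in> Y \<Longrightarrow> y \<in> Y \<Longrightarrow> polynomial_fun m (\<lambda>\<mu>. M \<mu> x y)"
    and one: "\<And>x y. x \<in> Y \<Longrightarrow> y \<in> Y \<Longrightarrow> M \<mu>0 x y = (if x = y then 1 else 0)"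
  shows "\<exists>q A. polynomial_fun m q \<and> q \<mu>0 \<noteq> 0 \<and>
    (\<forall>x\<in>Y. \<forall>y\<in>Y. polynomial_fun m (\<lambda>\<mu>. A \<mu> x y)) \<and>
    (\<forall>\<mu>. \<forall>x\<in>Y. \<forall>z\<in>Y. (\<Sum>y\<in>Y. M \<mu> x y * A \<mu> y z) = (if x = z then q \<mu> else 0))"
proof -
  define d where "d = card Y"
  obtain h where h: "bij_betw h {0..<d} Y"
    using ex_bij_betw_nat_finite[OF Y] unfolding d_def by blast
  define g where "g = inv_into {0..<d} h"
  have hY: "h i \<in> Y" if "i < d" for i
    using h that by (auto simp: bij_betw_def)
  have gY: "g y < d" "h (g y) = y" if "y \<in> Y" for y
    using h that bij_betw_inv_into_right[OF h] bij_betw_inv_into[OF h] unfolding g_def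
    by (auto dest: bij_betwE)
  have gh: "g (h i) = i" if "i < d" for i
    using bij_betw_inv_into_left[OF h] that by (simp add: g_def)
  define D where "D \<mu> = mat d d (\<lambda>(i, j). M \<mu> (h i) (h j))" for \<mu>
  have D: "D \<mu> \<in> carrier_mat d d" for \<mu>
    by (simp add: D_def)
  define A where "A \<mu> x y = adj_mat (D \<mu>) $$ (g x, g y)" for \<mu> x y
  define q where "q \<mu> = det (D \<mu>)" for \<mu>
  have "polynomial_fun m q"
    unfolding q_def D_def by (intro polynomial_fun_det M hY)
  moreover have "q \<mu>0 \<noteq> 0"
  proof -
    have "D \<mu>0 = 1\<^sub>m d"
    proof (rule eq_matI)
      fix i j assume "i < dim_row (1\<^sub>m d :: complex mat)" "j < dim_col (1\<^sub>m d :: complex mat)"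
      then have ij: "i < d" "j < d"
        by auto
      then have "h i = h j \<longleftrightarrow> i = j"
        using gh by metis
      then show "D \<mu>0 $$ (i, j) = 1\<^sub>m d $$ (i, j)"
        using ij hY by (simp add: D_def one)
    qed (simp_all add: D_def)
    then show ?thesis
      by (simp add: q_def)
  qed
  moreover have "polynomial_fun m (\<lambda>\<mu>. A \<mu> x y)" if "x \<in> Y" "y \<in> Y" for x y
  proof -
    let ?s = "\<lambda>i i'. if i' < i then i' else Suc i'"
    have "A \<mu> x y = (- 1) ^ (g y + g x)
        * det (mat (d - 1) (d - 1) (\<lambda>(i', j'). M \<mu> (h (?s (g y) i')) (h (?s (g x) j'))))" for \<mu>
    proof -
      have "A \<mu> x y = cofactor (D \<mu>) (g y) (g x)"
        using that gY by (simp add: A_def adj_mat_def D_def)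
      moreover have "mat_delete (D \<mu>) (g y) (g x)
          = mat (d - 1) (d - 1) (\<lambda>(i', j'). M \<mu> (h (?s (g y) i')) (h (?s (g x) j')))"
        by (rule eq_matI) (auto simp: mat_delete_def D_def)
      ultimately show ?thesis
        by (simp add: cofactor_def)
    qed
    then show ?thesis
      using that gY by (auto intro!: polynomial_fun.mult polynomial_fun.const polynomial_fun_det M hY)
  qed
  moreover have "(\<Sum>y\<in>Y. M \<mu> x y * A \<mu> y z) = (if x = z then q \<mu> else 0)" if "x \<in> Y" "z \<in> Y" for \<mu> x z
  proof -
    have "(\<Sum>y\<in>Y. M \<mu> x y * A \<mu> y z) = (\<Sum>i\<in>{0..<d}. M \<mu> x (h i) * A \<mu> (h i) z)"
      using sum.reindex_bij_betw[OF h, of "\<lambda>y. M \<mu> x y * A \<mu> y z"] by simp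
    also have "\<dots> = (D \<mu> * adj_mat (D \<mu>)) $$ (g x, g z)"
      using that gY adj_mat(1)[OF D[of \<mu>]] D[of \<mu>]
      by (simp add: scalar_prod_def A_def gh) (simp add: D_def gY)
    also have "\<dots> = (if g x = g z then q \<mu> else 0)"
      unfolding adj_mat(2)[OF D] using that gY by (simp add: q_def)
    also have "g x = g z \<longleftrightarrow> x = z"
      using that gY by metis
    finally show ?thesis .
  qed
  ultimately show ?thesis
    by blast
qed

section \<open>Dependence on the parameters\<close>

definition param_list :: "(nat \<Rightarrow> nat) \<Rightarrow> (nat \<Rightarrow> complex) \<Rightarrow> (nat \<Rightarrow> complex) \<Rightarrow> nat list \<Rightarrow> (nat \<times> complex) list" where
  "param_list \<nu> c \<mu> as = map (\<lambda>a. (\<nu> a, \<mu> a + c a)) as"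

lemma rev_param_list: "rev (param_list \<nu> c \<mu> as) = param_list \<nu> c \<mu> (rev as)"
  by (simp add: param_list_def rev_map)

lemma basis_param_list: "basis (ext_tensor n (param_list \<nu> c \<mu> as)) = basis (ext_tensor n (param_list \<nu> c \<mu>' as))"
  by (simp add: set_eq_iff in_basis_ext_tensor_iff param_list_def list_all2_map2)

lemma top_index_param_list: "top_index (param_list \<nu> c \<mu> as) = map (\<lambda>a. {1..\<nu> a}) as"
  by (simp add: top_index_eq_map param_list_def)

lemma polynomial_fun_coef:
  assumes "set as \<subseteq> {1..m}"
  shows "polynomial_fun m (\<lambda>\<mu>. coef (ext_tensor n (param_list \<nu> c \<mu> as)) i j r xs ys)"
  using assms
proof (induction as arbitrary: i r xs ys)
  case Nil
  then show ?case
    by (simp add: param_list_def ext_tensor_def tensor_def polynomial_fun.const)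
next
  case (Cons a as)
  have "polynomial_fun m (\<lambda>\<mu>. coef (Phi n (\<nu> a) (\<mu> a + c a)) i p s x y)" for p s x y
    using Cons.prems unfolding Phi_def
    by (cases "s = 0") (auto intro!: polynomial_fun_intros)
  moreover have "polynomial_fun m (\<lambda>\<mu>. coef (ext_tensor n (param_list \<nu> c \<mu> as)) p j s xs ys)" for p s xs ys
    using Cons by simp
  ultimately show ?case
    by (simp add: param_list_def ext_tensor_def tensor_def polynomial_fun_intros)
qed

lemma polynomial_fun_wact:
  assumes "set as \<subseteq> {1..m}"
  shows "polynomial_fun m (\<lambda>\<mu>. wact (ext_tensor n (param_list \<nu> c \<mu> as)) w f x)"
proof (induction w arbitrary: x)
  case Nil
  show ?case
    by (simp add: polynomial_fun.const)
next
  case (Cons l w)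
  obtain i j r where l: "l = (i, j, r)"
    by (metis prod_cases3)
  let ?Z = "basis (ext_tensor n (param_list \<nu> c (\<lambda>_. 0) as))"
  show ?case
  proof (cases "x \<in> ?Z")
    case True
    then have "wact (ext_tensor n (param_list \<nu> c \<mu> as)) (l # w) f x
      = (\<Sum>y\<in>?Z. coef (ext_tensor n (param_list \<nu> c \<mu> as)) i j r x y
          * wact (ext_tensor n (param_list \<nu> c \<mu> as)) w f y)" for \<mu>
      unfolding l wact.simps act_def basis_param_list[of n \<nu> c \<mu> as "\<lambda>_. 0"] by simp
    then show ?thesis
      using Cons.IH polynomial_fun_coef[OF assms]
      by (simp only:) (intro polynomial_fun_sum polynomial_fun.mult)
  next
    case False
    then have "wact (ext_tensor n (param_list \<nu> c \<mu> as)) (l # w) f x = 0" for \<mu>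
      unfolding l wact.simps act_def basis_param_list[of n \<nu> c \<mu> as "\<lambda>_. 0"] by simp
    then show ?thesis
      by (simp add: polynomial_fun.const)
  qed
qed

text \<open>Elements of the free algebra on the generators, kept as syntax so that one and the same
  element acts at every parameter, with matrix entries polynomial in \<mu>.\<close>

definition word_comb :: "'b based_space \<Rightarrow> (complex \<times> word) list \<Rightarrow> ('b \<Rightarrow> complex) \<Rightarrow> 'b \<Rightarrow> complex" where
  "word_comb B cw f = (\<lambda>x. \<Sum>(c, w)\<leftarrow>cw. c * wact B w f x)"

lemma word_comb_Nil: "word_comb B [] f = (\<lambda>_. 0)"
  and word_comb_Cons: "word_comb B ((c, w) # cw) f = (\<lambda>x. c * wact B w f x + word_comb B cw f x)"
  by (simp_all add: word_comb_def)

lemma word_comb_append: "word_comb B (cw @ cw') f = (\<lambda>x. word_comb B cw f x + word_comb B cw' f x)"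
  by (simp add: word_comb_def)

lemma word_comb_smult: "word_comb B (map (\<lambda>(c', w). (c * c', w)) cw) f = (\<lambda>x. c * word_comb B cw f x)"
  by (induction cw) (auto simp: word_comb_Nil word_comb_Cons algebra_simps)

lemma word_comb_act: "word_comb B (map (\<lambda>(c, w). (c, (i, j, r) # w)) cw) f = act B i j r (word_comb B cw f)"
  by (induction cw) (auto simp: word_comb_Nil word_comb_Cons act_zero act_add act_smult)

definition word_comb_ok :: "nat \<Rightarrow> (complex \<times> word) list \<Rightarrow> bool" where
  "word_comb_ok n cw \<longleftrightarrow> (\<forall>(c, w)\<in>set cw. word_ok n w)"

lemma cyclic_vector_word_comb:
  assumes "cyclic_vector n B v" "f \<in> supported B"
  shows "\<exists>cw. word_comb_ok n cw \<and> word_comb B cw v = f"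
proof -
  define N where "N = {f. \<exists>cw. word_comb_ok n cw \<and> word_comb B cw v = f}"
  have "stable n B N"
    unfolding stable_def
  proof (intro conjI ballI allI)
    show "(\<lambda>_. 0) \<in> N"
      unfolding N_def by (intro CollectI exI[of _ "[]"]) (simp add: word_comb_ok_def word_comb_Nil)
  next
    fix f g assume "f \<in> N" "g \<in> N"
    then obtain cw cw' where "word_comb_ok n cw" "word_comb B cw v = f" "word_comb_ok n cw'" "word_comb B cw' v = g"
      by (auto simp: N_def)
    then show "(\<lambda>x. f x + g x) \<in> N"
      unfolding N_def
      by (intro CollectI exI[of _ "cw @ cw'"]) (auto simp: word_comb_ok_def word_comb_append)
  next
    fix c f assume "f \<in> N"
    then obtain cw where "word_comb_ok n cw" "word_comb B cw v = f"
      by (auto simp: N_def)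
    then show "(\<lambda>x. c * f x) \<in> N"
      unfolding N_def
      by (intro CollectI exI[of _ "map (\<lambda>(c', w). (c * c', w)) cw"])
         (auto simp: word_comb_ok_def word_comb_smult)
  next
    fix i j r f assume ij: "i \<in> {1..n}" "j \<in> {1..n}" and "f \<in> N"
    then obtain cw where "word_comb_ok n cw" "word_comb B cw v = f"
      by (auto simp: N_def)
    then show "act B i j r f \<in> N"
      unfolding N_def using ij
      by (intro CollectI exI[of _ "map (\<lambda>(c, w). (c, (i, j, r) # w)) cw"])
         (auto simp: word_comb_ok_def word_comb_act)
  qed
  moreover have "v \<in> N"
    unfolding N_def
    by (intro CollectI exI[of _ "[(1, [])]"]) (simp add: word_comb_ok_def word_comb_Cons word_comb_Nil)
  ultimately have "supported B \<subseteq> N"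
    using assms by (simp add: cyclic_vector_def)
  then show ?thesis
    using assms by (auto simp: N_def)
qed

lemma intertwiner_linear: "intertwiner n (space_of B) (space_of B') K \<Longrightarrow> linear_map (space_of B) (space_of B') K"
  by (simp add: intertwiner_iff)

lemma intertwiner_wact:
  assumes K: "intertwiner n (space_of B) (space_of B') K" and f: "f \<in> supported B" and w: "word_ok n w"
  shows "K (wact B w f) = wact B' w (K f)"
  using w
proof (induction w)
  case (Cons l w)
  obtain i j r where "l = (i, j, r)"
    by (metis prod_cases3)
  then show ?case
    using Cons K wact_supported[OF f] by (auto simp: intertwiner_iff)
qed simp

lemma intertwiner_word_comb:
  assumes K: "intertwiner n (space_of B) (space_of B') K" and f: "f \<in> supported B" and cw: "word_comb_ok n cw"
  shows "K (word_comb B cw f) = word_comb B' cw (K f)"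
  using cw
proof (induction cw)
  case Nil
  then show ?case
    using linear_map_zero[OF intertwiner_linear[OF K]] by (simp add: word_comb_Nil)
next
  case (Cons l cw)
  obtain c w where l: "l = (c, w)"
    by force
  have "word_comb B cw f \<in> supported B" "(\<lambda>x. c * wact B w f x) \<in> supported B"
    using wact_supported[OF f] by (auto simp: supported_def word_comb_def split_def)
  then have "K (word_comb B (l # cw) f) = (\<lambda>x. K (\<lambda>x. c * wact B w f x) x + K (word_comb B cw f) x)"
    unfolding l word_comb_Cons by (intro linear_map_add[OF intertwiner_linear[OF K]])
  also have "K (\<lambda>x. c * wact B w f x) = (\<lambda>x. c * K (wact B w f) x)"
    by (rule linear_map_smult[OF intertwiner_linear[OF K] wact_supported[OF f]])
  also have "K (wact B w f) = wact B' w (K f)"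
    using Cons.prems l by (intro intertwiner_wact[OF K f]) (simp add: word_comb_ok_def)
  finally show ?case
    using Cons by (simp add: l word_comb_Cons word_comb_ok_def)
qed

lemma linear_map_expand:
  assumes K: "linear_map (space_of B) (space_of B') K" and fin: "finite (basis B)" and f: "f \<in> supported B"
  shows "K f x = (\<Sum>y\<in>basis B. f y * K (basis_vector y) x)"
proof -
  have sum: "K (\<lambda>x. \<Sum>y\<in>A. f y * basis_vector y x) = (\<lambda>x. \<Sum>y\<in>A. f y * K (basis_vector y) x)"
    if "finite A" "A \<subseteq> basis B" for A
    using that
  proof (induction A)
    case empty
    then show ?case
      by (simp add: linear_map_zero[OF K])
  next
    case (insert a A)
    have a: "basis_vector a \<in> supported B"
      using insert.prems by (simp add: basis_vector_supported)
    have "(\<lambda>x. \<Sum>y\<in>A. f y * basis_vector y x) \<in> supported B"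
      using insert.prems by (auto simp: supported_def basis_vector_def intro!: sum.neutral)
    then have "K (\<lambda>x. f a * basis_vector a x + (\<Sum>y\<in>A. f y * basis_vector y x))
        = (\<lambda>x. f a * K (basis_vector a) x + K (\<lambda>x. \<Sum>y\<in>A. f y * basis_vector y x) x)"
      using linear_map_add[OF K supported_smult[OF a, of "f a"]] linear_map_smult[OF K a, of "f a"] by simp
    then show ?case
      using insert by simp
  qed
  have "K f = K (\<lambda>x. \<Sum>y\<in>basis B. f y * basis_vector y x)"
    using supported_expansion[OF fin f] by (rule arg_cong)
  then show ?thesis
    by (simp add: sum[OF fin subset_refl])
qed

text \<open>
  At \<open>\<mu>\<close> near \<open>\<mu>0\<close> the intertwining operator is determined by its values on vectors obtained
  from the highest vector by fixed elements of the Yangian which give a basis at \<open>\<mu>0\<close>;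
  Cramer's rule expresses its matrix by polynomials.
\<close>

lemma intertwiner_fractions:
  fixes n \<nu> c as
  defines "S \<equiv> \<lambda>\<mu>. ext_tensor n (param_list \<nu> c \<mu> as)" and "T \<equiv> \<lambda>\<mu>. ext_tensor n (rev (param_list \<nu> c \<mu> as))"
    and "e \<equiv> basis_vector (map (\<lambda>a. {1..\<nu> a}) as)" and "e' \<equiv> basis_vector (map (\<lambda>a. {1..\<nu> a}) (rev as))"
  assumes as: "set as \<subseteq> {1..m}" and \<nu>: "\<forall>a\<in>set as. \<nu> a \<le> n"
    and cyc: "cyclic_vector n (S \<mu>0) e"
    and K: "\<And>\<mu>. \<mu> \<in> D \<Longrightarrow> intertwiner n (space_of (S \<mu>)) (space_of (T \<mu>)) (K \<mu>) \<and> K \<mu> e = e'"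
  shows "\<exists>q p. polynomial_fun m q \<and> q \<mu>0 \<noteq> 0 \<and>
    (\<forall>y\<in>basis (S \<mu>0). \<forall>x. polynomial_fun m (p x y) \<and> (\<forall>\<mu>\<in>D. K \<mu> (basis_vector y) x * q \<mu> = p x y \<mu>))"
proof -
  let ?Y = "basis (S \<mu>0)"
  have basis: "basis (S \<mu>) = ?Y" for \<mu>
    unfolding S_def by (rule basis_param_list)
  have "sized n (param_list \<nu> c \<mu> as)" for \<mu>
    using \<nu> by (auto simp: sized_def param_list_def)
  then have e: "e \<in> supported (S \<mu>)" for \<mu>
    unfolding e_def S_def top_index_param_list[of \<nu> c \<mu> as, symmetric]
    by (intro basis_vector_supported top_index_in_basis)
  have fin: "finite ?Y"
    by (simp add: S_def)
  have "\<forall>y\<in>?Y. \<exists>cw. word_comb_ok n cw \<and> word_comb (S \<mu>0) cw e = basis_vector y"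
    by (intro ballI cyclic_vector_word_comb[OF cyc] basis_vector_supported)
  then obtain cw where cw: "\<And>y. y \<in> ?Y \<Longrightarrow> word_comb_ok n (cw y) \<and> word_comb (S \<mu>0) (cw y) e = basis_vector y"
    by metis
  define M where "M \<mu> x y = word_comb (S \<mu>) (cw y) e x" for \<mu> x y
  define M' where "M' \<mu> x y = word_comb (T \<mu>) (cw y) e' x" for \<mu> x y
  have poly_comb: "polynomial_fun m (\<lambda>\<mu>. word_comb (ext_tensor n (param_list \<nu> c \<mu> bs)) l f x)"
    if "set bs \<subseteq> {1..m}" for bs l f x
  proof (induction l)
    case (Cons a l)
    then show ?case
      by (cases a) (auto simp: word_comb_Cons intro!: polynomial_fun.intros polynomial_fun_wact that)
  qed (simp add: word_comb_Nil polynomial_fun.const)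
  obtain q A where q: "polynomial_fun m q" "q \<mu>0 \<noteq> 0"
    and A: "\<And>x y. x \<in> ?Y \<Longrightarrow> y \<in> ?Y \<Longrightarrow> polynomial_fun m (\<lambda>\<mu>. A \<mu> x y)"
    and MA: "\<And>\<mu> x z. x \<in> ?Y \<Longrightarrow> z \<in> ?Y \<Longrightarrow> (\<Sum>y\<in>?Y. M \<mu> x y * A \<mu> y z) = (if x = z then q \<mu> else 0)"
  proof -
    have "\<exists>q A. polynomial_fun m q \<and> q \<mu>0 \<noteq> 0 \<and>
      (\<forall>x\<in>?Y. \<forall>y\<in>?Y. polynomial_fun m (\<lambda>\<mu>. A \<mu> x y)) \<and>
      (\<forall>\<mu>. \<forall>x\<in>?Y. \<forall>z\<in>?Y. (\<Sum>y\<in>?Y. M \<mu> x y * A \<mu> y z) = (if x = z then q \<mu> else 0))"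
    proof (rule adjugate_family[OF fin])
      show "polynomial_fun m (\<lambda>\<mu>. M \<mu> x y)" for x y
        unfolding M_def S_def using as by (rule poly_comb)
      show "M \<mu>0 x y = (if x = y then 1 else 0)" if "y \<in> ?Y" for x y
        using cw[OF that] by (simp add: M_def basis_vector_def)
    qed
    then show thesis
      using that by blast
  qed
  \<comment> \<open>Writing K for the matrix of \<open>K \<mu>\<close>, intertwining says K M = M'.
    Multiplication by the adjugate gives K q = M' A.\<close>
  define p where "p x z \<mu> = (\<Sum>y\<in>?Y. M' \<mu> x y * A \<mu> y z)" for x z \<mu>
  have "polynomial_fun m (p x z)" if "z \<in> ?Y" for x z
  proof -
    have "polynomial_fun m (\<lambda>\<mu>. M' \<mu> x y)" for y
      unfolding M'_def T_def rev_param_list using as by (intro poly_comb) simp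
    then show ?thesis
      unfolding p_def using that by (intro polynomial_fun_sum polynomial_fun.mult A)
  qed
  moreover have "K \<mu> (basis_vector z) x * q \<mu> = p x z \<mu>" if z: "z \<in> ?Y" and \<mu>: "\<mu> \<in> D" for x z \<mu>
  proof -
    have lin: "linear_map (space_of (S \<mu>)) (space_of (T \<mu>)) (K \<mu>)"
      using K[OF \<mu>] intertwiner_linear by blast
    have "M' \<mu> x y = (\<Sum>v\<in>?Y. M \<mu> v y * K \<mu> (basis_vector v) x)" if "y \<in> ?Y" for y
    proof -
      have "M' \<mu> x y = K \<mu> (word_comb (S \<mu>) (cw y) e) x"
        using intertwiner_word_comb[OF conjunct1[OF K[OF \<mu>]] e conjunct1[OF cw[OF that]]] K[OF \<mu>]
        by (simp add: M'_def)
      also have "\<dots> = (\<Sum>v\<in>?Y. M \<mu> v y * K \<mu> (basis_vector v) x)"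
      proof -
        have "word_comb (S \<mu>) (cw y) e \<in> supported (S \<mu>)"
          using wact_supported[OF e] by (auto simp: supported_def word_comb_def split_def)
        then show ?thesis
          using linear_map_expand[OF lin _ , of "word_comb (S \<mu>) (cw y) e" x] fin
          by (simp add: M_def basis[of \<mu>])
      qed
      finally show ?thesis .
    qed
    then have "p x z \<mu> = (\<Sum>y\<in>?Y. (\<Sum>v\<in>?Y. M \<mu> v y * K \<mu> (basis_vector v) x) * A \<mu> y z)"
      by (simp add: p_def)
    also have "\<dots> = (\<Sum>y\<in>?Y. \<Sum>v\<in>?Y. K \<mu> (basis_vector v) x * (M \<mu> v y * A \<mu> y z))"
      by (simp add: sum_distrib_left mult_ac)
    also have "\<dots> = (\<Sum>v\<in>?Y. K \<mu> (basis_vector v) x * (\<Sum>y\<in>?Y. M \<mu> v y * A \<mu> y z))"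
      by (subst sum.swap) (simp add: sum_distrib_left)
    also have "\<dots> = (\<Sum>v\<in>?Y. if v = z then K \<mu> (basis_vector v) x * q \<mu> else 0)"
      using z by (intro sum.cong) (auto simp: MA)
    finally show ?thesis
      using z fin by simp
  qed
  ultimately show ?thesis
    using q by blast
qed

text \<open>Fractions found separately at the points of \<open>D\<close> represent one rational
  function: cross-multiplied they agree at all generic points, hence everywhere by density.\<close>

lemma rational_regular_on_fractions:
  assumes D: "\<And>\<mu>. generic m \<mu> \<Longrightarrow> \<mu> \<in> D"
    and fr: "\<And>\<mu>. \<mu> \<in> D \<Longrightarrow> \<exists>q p. polynomial_fun m q \<and> polynomial_fun m p \<and> q \<mu> \<noteq> 0 \<and> (\<forall>x\<in>D. f x * q x = p x)"
  shows "rational_regular_on m D f"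
proof -
  \<comment> \<open>Any point of \<open>D\<close> would do to fix the global fraction p / q; a
    generic one is known to exist.\<close>
  obtain \<mu>' where "generic m \<mu>'"
    using generic_exists by blast
  then obtain q p where pq: "polynomial_fun m q" "polynomial_fun m p" "q \<mu>' \<noteq> 0" "\<forall>x\<in>D. f x * q x = p x"
    using fr[OF D] by blast
  have "regular_with_value m p q \<mu> (f \<mu>)" if \<mu>: "\<mu> \<in> D" for \<mu>
  proof -
    obtain q' p' where pq': "polynomial_fun m q'" "polynomial_fun m p'" "q' \<mu> \<noteq> 0" "\<forall>x\<in>D. f x * q' x = p' x"
      using fr[OF \<mu>] by blast
    have "p x * q' x = p' x * q x" for x
    proof (rule ccontr)
      assume "p x * q' x \<noteq> p' x * q x"
      then obtain y where y: "generic m y" "p y * q' y - p' y * q y \<noteq> 0"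
        using polynomial_fun_generic[OF polynomial_fun_diff[OF polynomial_fun.mult[OF pq(2) pq'(1)]
            polynomial_fun.mult[OF pq'(2) pq(1)]], of x] by auto
      then have "f y * q y = p y" "f y * q' y = p' y"
        using pq pq' D by auto
      then have "p y * q' y - p' y * q y = 0"
        by (metis mult.assoc mult.commute right_minus_eq)
      then show False
        using y by simp
    qed
    moreover have "f \<mu> = p' \<mu> / q' \<mu>"
      using pq' \<mu> by (metis nonzero_mult_div_cancel_right)
    ultimately show ?thesis
      unfolding regular_with_value_def using pq' by blast
  qed
  then show ?thesis
    unfolding rational_regular_on_def using pq by blast
qed

section \<open>The quotient by the kernel\<close>

lemma cring_complex_ring: "cring complex_ring"
proof (rule cringI)
  show "abelian_group complex_ring"
  proof (rule abelian_groupI)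
    fix x assume "x \<in> carrier complex_ring"
    show "\<exists>y\<in>carrier complex_ring. y \<oplus>\<^bsub>complex_ring\<^esub> x = \<zero>\<^bsub>complex_ring\<^esub>"
      by (rule bexI[of _ "- x"]) (simp_all add: complex_ring_def)
  qed (simp_all add: complex_ring_def)
  show "comm_monoid complex_ring"
    by (rule comm_monoidI) (simp_all add: complex_ring_def)
qed (simp add: complex_ring_def algebra_simps)

lemma a_kernel_space_of:
  "a_kernel (space_of B) (space_of B') K = {f \<in> supported B. K f = (\<lambda>_. 0)}"
  by (simp add: a_kernel_def')

locale stable_subspace =
  fixes n :: nat and B :: "'b based_space" and Ker :: "('b \<Rightarrow> complex) set"
  assumes entries: "yangian_entries n B" and stable: "stable n B Ker" and subset: "Ker \<subseteq> supported B"
begin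

definition coset :: "('b \<Rightarrow> complex) \<Rightarrow> ('b \<Rightarrow> complex) set" where
  "coset f = {g \<in> supported B. (\<lambda>x. g x - f x) \<in> Ker}"

abbreviation Q where "Q \<equiv> quotient_space (space_of B) Ker"

lemma a_r_coset_eq:
  assumes "f \<in> supported B"
  shows "Ker +>\<^bsub>space_of B\<^esub> f = coset f"
proof -
  have "g \<in> (\<Union>h\<in>Ker. {\<lambda>x. h x + f x}) \<longleftrightarrow> g \<in> coset f" for g
  proof
    assume "g \<in> (\<Union>h\<in>Ker. {\<lambda>x. h x + f x})"
    then obtain h where "h \<in> Ker" "g = (\<lambda>x. h x + f x)"
      by blast
    then show "g \<in> coset f"
      using subset assms by (auto simp: coset_def supported_def)
  next
    assume "g \<in> coset f"
    then have "(\<lambda>x. g x - f x) \<in> Ker" "g = (\<lambda>x. (g x - f x) + f x)"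
      by (auto simp: coset_def)
    then show "g \<in> (\<Union>h\<in>Ker. {\<lambda>x. h x + f x})"
      by blast
  qed
  then show ?thesis
    by (auto simp: a_r_coset_def')
qed

lemma coset_eq_iff:
  assumes "f \<in> supported B" "g \<in> supported B"
  shows "coset f = coset g \<longleftrightarrow> (\<lambda>x. f x - g x) \<in> Ker"
proof
  assume "coset f = coset g"
  moreover have "f \<in> coset f"
    using assms stable_zero[OF stable] by (simp add: coset_def)
  ultimately show "(\<lambda>x. f x - g x) \<in> Ker"
    by (simp add: coset_def)
next
  assume fg: "(\<lambda>x. f x - g x) \<in> Ker"
  have "(\<lambda>x. h x - f x) \<in> Ker \<longleftrightarrow> (\<lambda>x. h x - g x) \<in> Ker" for h
  proof
    assume "(\<lambda>x. h x - f x) \<in> Ker"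
    then show "(\<lambda>x. h x - g x) \<in> Ker"
      using stable_add[OF stable _ fg] by fastforce
  next
    assume "(\<lambda>x. h x - g x) \<in> Ker"
    then show "(\<lambda>x. h x - f x) \<in> Ker"
      using stable_diff[OF stable _ fg] by fastforce
  qed
  then show "coset f = coset g"
    by (simp add: coset_def)
qed

lemma coset_self: "f \<in> supported B \<Longrightarrow> f \<in> coset f"
  using stable_zero[OF stable] by (simp add: coset_def)

lemma coset_memD: "g \<in> coset f \<Longrightarrow> g \<in> supported B \<and> (\<lambda>x. g x - f x) \<in> Ker"
  by (simp add: coset_def)

lemma coset_zero: "coset (\<lambda>_. 0) = Ker"
  using subset by (auto simp: coset_def)

lemma carrier_Q: "carrier Q = coset ` supported B"
  by (auto simp: quotient_space_def A_RCOSETS_def' a_r_coset_eq)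

lemma zero_Q: "\<zero>\<^bsub>Q\<^esub> = coset (\<lambda>_. 0)"
  by (simp add: quotient_space_def coset_zero)

text \<open>Operations on the quotient are unions over representatives; when \<open>F\<close>
  respects the subspace all members of the union are the same coset.\<close>

lemma Union_coset:
  assumes f: "f \<in> supported B" and F: "\<And>g. g \<in> supported B \<Longrightarrow> F g \<in> supported B"
    and diff: "\<And>g. g \<in> supported B \<Longrightarrow> (\<lambda>x. g x - f x) \<in> Ker \<Longrightarrow> (\<lambda>x. F g x - F f x) \<in> Ker"
  shows "(\<Union>g\<in>coset f. Ker +>\<^bsub>space_of B\<^esub> F g) = coset (F f)"
proof -
  have "Ker +>\<^bsub>space_of B\<^esub> F g = coset (F f)" if "g \<in> coset f" for g
    using coset_memD[OF that] f F diff by (simp add: a_r_coset_eq coset_eq_iff)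
  then show ?thesis
    using coset_self[OF f] by blast
qed

lemma add_Q:
  assumes "f \<in> supported B" "g \<in> supported B"
  shows "coset f \<oplus>\<^bsub>Q\<^esub> coset g = coset (\<lambda>x. f x + g x)"
proof -
  have "h \<in> (\<Union>a\<in>coset f. \<Union>b\<in>coset g. {\<lambda>x. a x + b x}) \<longleftrightarrow> h \<in> coset (\<lambda>x. f x + g x)" for h
  proof
    assume "h \<in> (\<Union>a\<in>coset f. \<Union>b\<in>coset g. {\<lambda>x. a x + b x})"
    then obtain a b where ab: "a \<in> coset f" "b \<in> coset g" "h = (\<lambda>x. a x + b x)"
      by blast
    then have "(\<lambda>x. (a x - f x) + (b x - g x)) \<in> Ker"
      by (intro stable_add[OF stable]) (auto dest: coset_memD)
    then show "h \<in> coset (\<lambda>x. f x + g x)"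
      using ab by (auto simp: coset_def supported_def algebra_simps)
  next
    assume h: "h \<in> coset (\<lambda>x. f x + g x)"
    define a where "a = (\<lambda>x. h x - g x)"
    have "a \<in> coset f"
      using h assms by (auto simp: coset_def a_def supported_def algebra_simps)
    moreover have "h = (\<lambda>x. a x + g x)"
      by (simp add: a_def)
    ultimately show "h \<in> (\<Union>a\<in>coset f. \<Union>b\<in>coset g. {\<lambda>x. a x + b x})"
      using coset_self[OF assms(2)] by blast
  qed
  then show ?thesis
    by (auto simp: quotient_space_def set_add_def')
qed

lemma smult_Q:
  assumes "f \<in> supported B"
  shows "c \<odot>\<^bsub>Q\<^esub> coset f = coset (\<lambda>x. c * f x)"
proof -
  have "(\<lambda>x. c * g x - c * f x) \<in> Ker" if "(\<lambda>x. g x - f x) \<in> Ker" for g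
    using stable_smult[OF stable that, of c] by (simp add: algebra_simps)
  then show ?thesis
    using assms Union_coset[of f "\<lambda>g x. c * g x"] by (simp add: quotient_space_def supported_smult)
qed

lemma gen_Q:
  assumes "i \<in> {1..n}" "j \<in> {1..n}" "f \<in> supported B"
  shows "gen Q i j r (coset f) = coset (act B i j r f)"
proof -
  have "(\<lambda>x. act B i j r g x - act B i j r f x) \<in> Ker" if "(\<lambda>x. g x - f x) \<in> Ker" for g
    using stable_act[OF stable that assms(1,2), of r] wact_diff[of B "[(i, j, r)]" g f] by simp
  then show ?thesis
    using assms Union_coset[of f "act B i j r"] by (simp add: quotient_space_def act_supported)
qed

lemma abelian_group_Q: "abelian_group Q"
proof (rule abelian_groupI)
  fix x assume "x \<in> carrier Q"
  then obtain f where f: "f \<in> supported B" "x = coset f"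
    by (auto simp: carrier_Q)
  then have "coset (\<lambda>x. - 1 * f x) \<oplus>\<^bsub>Q\<^esub> x = \<zero>\<^bsub>Q\<^esub>"
    using supported_smult[OF f(1), of "- 1"] by (simp add: add_Q zero_Q)
  moreover have "coset (\<lambda>x. - 1 * f x) \<in> carrier Q"
    using supported_smult[OF f(1), of "- 1"] by (simp add: carrier_Q)
  ultimately show "\<exists>y\<in>carrier Q. y \<oplus>\<^bsub>Q\<^esub> x = \<zero>\<^bsub>Q\<^esub>"
    by blast
qed (auto simp: carrier_Q add_Q zero_Q supported_add supported_zero algebra_simps)

lemma module_Q: "module complex_ring Q"
proof (rule moduleI[OF cring_complex_ring abelian_group_Q])
qed (auto simp: carrier_Q add_Q smult_Q supported_add supported_smult complex_ring_def algebra_simps)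

lemma minus_Q:
  assumes "f \<in> supported B" "g \<in> supported B"
  shows "coset f \<ominus>\<^bsub>Q\<^esub> coset g = coset (\<lambda>x. f x - g x)"
proof -
  have g': "(\<lambda>x. - 1 * g x) \<in> supported B"
    by (rule supported_smult[OF assms(2)])
  have "coset (\<lambda>x. - 1 * g x) \<oplus>\<^bsub>Q\<^esub> coset g = \<zero>\<^bsub>Q\<^esub>"
    using assms g' by (simp add: add_Q zero_Q)
  then have "\<ominus>\<^bsub>Q\<^esub> coset g = coset (\<lambda>x. - 1 * g x)"
    using assms g' by (intro abelian_group.minus_equality[OF abelian_group_Q]) (auto simp: carrier_Q)
  then show ?thesis
    using assms g' by (simp add: a_minus_def add_Q)
qed

lemma yangian_module_Q: "yangian_module n Q"
  unfolding yangian_module_def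
proof (intro conjI ballI allI)
  show "module complex_ring Q"
    by (rule module_Q)
next
  fix i j r assume ij: "i \<in> {1..n}" "j \<in> {1..n}"
  show "linear_map Q Q (gen Q i j r)"
    unfolding linear_map_def carrier_Q using ij
    by (auto simp: gen_Q add_Q smult_Q act_add act_smult act_supported supported_add supported_smult)
next
  fix i j v assume ij: "i \<in> {1..n}" "j \<in> {1..n}" and "v \<in> carrier Q"
  then show "gen Q i j 0 v = (if i = j then v else \<zero>\<^bsub>Q\<^esub>)"
    by (auto simp: carrier_Q gen_Q act_0[OF entries] zero_Q)
next
  fix i j k l r s v
  assume ijkl: "i \<in> {1..n}" "j \<in> {1..n}" "k \<in> {1..n}" "l \<in> {1..n}" and "v \<in> carrier Q"
  then obtain f where f: "f \<in> supported B" "v = coset f"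
    by (auto simp: carrier_Q)
  note supp = act_supported supported_add supported_smult
  have sd: "(\<lambda>x. g x - h x) \<in> supported B" if "g \<in> supported B" "h \<in> supported B" for g h
    using that by (simp add: supported_def)
  show "(gen Q i j (Suc r) (gen Q k l s v) \<ominus>\<^bsub>Q\<^esub> gen Q k l s (gen Q i j (Suc r) v)) \<ominus>\<^bsub>Q\<^esub>
        (gen Q i j r (gen Q k l (Suc s) v) \<ominus>\<^bsub>Q\<^esub> gen Q k l (Suc s) (gen Q i j r v))
        = gen Q k j r (gen Q i l s v) \<ominus>\<^bsub>Q\<^esub> gen Q k j s (gen Q i l r v)"
    using ijkl f by (simp add: gen_Q minus_Q act_supported sd act_commutation[OF entries])
qed

lemma coset_eq_zero_iff: "f \<in> supported B \<Longrightarrow> coset f = \<zero>\<^bsub>Q\<^esub> \<longleftrightarrow> f \<in> Ker"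
  using coset_eq_iff[OF _ supported_zero, of f] by (simp add: zero_Q)

text \<open>The preimage of a submodule of the quotient is stable, so it either lies in
  \<open>Ker\<close> or is everything by \<open>maximal\<close>.\<close>

lemma irreducible_Q:
  assumes nonzero: "\<exists>f\<in>supported B. f \<notin> Ker"
    and maximal: "\<And>M f. stable n B M \<Longrightarrow> M \<subseteq> supported B \<Longrightarrow> f \<in> M \<Longrightarrow> f \<notin> Ker \<Longrightarrow> M = supported B"
  shows "irreducible_yangian_module n Q"
  unfolding irreducible_yangian_module_def
proof (intro conjI allI impI yangian_module_Q)
  show "carrier Q \<noteq> {\<zero>\<^bsub>Q\<^esub>}"
    using nonzero coset_eq_zero_iff by (auto simp: carrier_Q)
next
  fix N assume N: "yangian_submodule n N Q"
  then have sub: "submodule N complex_ring Q"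
    and inv: "\<And>i j r v. i \<in> {1..n} \<Longrightarrow> j \<in> {1..n} \<Longrightarrow> v \<in> N \<Longrightarrow> gen Q i j r v \<in> N"
    by (auto simp: yangian_submodule_def)
  have N_carrier: "N \<subseteq> carrier Q" and N_add: "\<And>u v. u \<in> N \<Longrightarrow> v \<in> N \<Longrightarrow> u \<oplus>\<^bsub>Q\<^esub> v \<in> N"
    and N_smult: "\<And>c v. v \<in> N \<Longrightarrow> c \<odot>\<^bsub>Q\<^esub> v \<in> N" and N_zero: "\<zero>\<^bsub>Q\<^esub> \<in> N"
    using module.submoduleE[OF module_Q sub] subgroup.one_closed[OF submodule.axioms(1)[OF sub]]
    by (auto simp: complex_ring_def)
  define M where "M = {f \<in> supported B. coset f \<in> N}"
  have M: "stable n B M"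
    unfolding stable_def
  proof (intro conjI ballI allI)
    show "(\<lambda>_. 0) \<in> M"
      using N_zero by (simp add: M_def zero_Q supported_zero)
  next
    fix f g assume "f \<in> M" "g \<in> M"
    then show "(\<lambda>x. f x + g x) \<in> M"
      using N_add[of "coset f" "coset g"] by (simp add: M_def add_Q supported_add)
  next
    fix c f assume "f \<in> M"
    then show "(\<lambda>x. c * f x) \<in> M"
      using N_smult[of "coset f" c] by (simp add: M_def smult_Q supported_smult)
  next
    fix i j r f assume "i \<in> {1..n}" "j \<in> {1..n}" "f \<in> M"
    then show "act B i j r f \<in> M"
      using inv[of i j "coset f" r] by (simp add: M_def gen_Q act_supported)
  qed
  have N_eq: "N = coset ` M"
    using N_carrier by (auto simp: M_def carrier_Q)
  show "N = {\<zero>\<^bsub>Q\<^esub>} \<or> N = carrier Q"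
  proof (cases "M \<subseteq> Ker")
    case True
    then have "coset f = \<zero>\<^bsub>Q\<^esub>" if "f \<in> M" for f
      using that coset_eq_zero_iff[of f] by (auto simp: M_def)
    then show ?thesis
      using N_zero by (auto simp: N_eq)
  next
    case False
    then have "M = supported B"
      using maximal[OF M] by (auto simp: M_def)
    then show ?thesis
      by (simp add: N_eq carrier_Q)
  qed
qed

end

lemma intertwiner_kernel_stable:
  assumes K: "intertwiner n (space_of B) (space_of B') K"
  shows "stable n B {f \<in> supported B. K f = (\<lambda>_. 0)}"
  unfolding stable_def
proof (intro conjI ballI allI)
  show "(\<lambda>_. 0) \<in> {f \<in> supported B. K f = (\<lambda>_. 0)}"
    using linear_map_zero[OF intertwiner_linear[OF K]] by (simp add: supported_zero)
qed (use K in \<open>auto simp: intertwiner_iff linear_map_iff supported_add supported_smult act_supported act_zero\<close>)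

text \<open>All other basis vectors have a different \<open>total\<close>, so their images have no
  component along the highest vector of the target.\<close>

lemma intertwiner_top_coefficient:
  assumes K: "intertwiner n (space_of (ext_tensor n L)) (space_of (ext_tensor n (rev L))) K"
    and L: "sized n L" and u: "u \<in> supported (ext_tensor n L)"
  shows "K u (top_index (rev L)) = u (top_index L) * K (basis_vector (top_index L)) (top_index (rev L))"
proof -
  let ?S = "ext_tensor n L" and ?t = "top_index (rev L)"
  note lin = intertwiner_linear[OF K]
  have "K (basis_vector y) ?t = 0" if y: "y \<in> basis ?S" "y \<noteq> top_index L" for y
  proof -
    have e: "basis_vector y \<in> supported ?S"
      using y by (simp add: basis_vector_supported)
    have "(\<lambda>x. of_nat (total x) * basis_vector y x) = (\<lambda>x. of_nat (total y) * basis_vector y x)"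
      by (auto simp: basis_vector_def)
    then have "(\<lambda>x. of_nat (total x) * K (basis_vector y) x) = (\<lambda>x. of_nat (total y) * K (basis_vector y) x)"
      using intertwiner_total[OF K e] by (simp add: linear_map_smult[OF lin e])
    then have "of_nat (total ?t) * K (basis_vector y) ?t = of_nat (total y) * K (basis_vector y) ?t"
      by (rule fun_cong)
    moreover have "total y \<noteq> total ?t"
      using total_minimal[OF y(1)] y(2) by (simp add: top_index_rev total_rev)
    ultimately show ?thesis
      by simp
  qed
  moreover have "K u ?t = (\<Sum>y\<in>basis ?S. u y * K (basis_vector y) ?t)"
    using linear_map_expand[OF lin _ u] by simp
  ultimately have "K u ?t = (\<Sum>y\<in>{top_index L}. u y * K (basis_vector y) ?t)"
    using L by (simp only:) (intro sum.mono_neutral_right, auto simp: top_index_in_basis)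
  then show ?thesis
    by simp
qed

theorem quotient_irreducible:
  assumes L: "sized n L" "ordered_shifts L"
    and K: "intertwiner n (space_of (ext_tensor n L)) (space_of (ext_tensor n (rev L))) K"
    and nz: "nonzero_map (space_of (ext_tensor n L)) (space_of (ext_tensor n (rev L))) K"
  defines "Q \<equiv> quotient_space (space_of (ext_tensor n L))
      (a_kernel (space_of (ext_tensor n L)) (space_of (ext_tensor n (rev L))) K)"
  shows "irreducible_yangian_module n Q"
    and "\<exists>v\<in>carrier Q. v \<noteq> \<zero>\<^bsub>Q\<^esub> \<and>
      (\<forall>i\<in>{1..n}. \<forall>j\<in>{1..n}. \<forall>r. i < j \<longrightarrow> gen Q i j r v = \<zero>\<^bsub>Q\<^esub>) \<and>
      (\<forall>i\<in>{1..n}. \<forall>r. gen Q i i r v = fps_nth (top_series L i) r \<odot>\<^bsub>Q\<^esub> v)"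
proof -
  let ?S = "ext_tensor n L" and ?T = "ext_tensor n (rev L)"
  let ?e = "basis_vector (top_index L) :: nat set list \<Rightarrow> complex"
  define Ker where "Ker = {f \<in> supported ?S. K f = (\<lambda>_. 0)}"
  interpret stable_subspace n ?S Ker
    by unfold_locales
      (use intertwiner_kernel_stable[OF K] in \<open>auto simp: Ker_def yangian_entries_ext_tensor\<close>)
  have Q: "Q = quotient_space (space_of ?S) Ker"
    by (simp add: Q_def a_kernel_space_of Ker_def)
  have e: "?e \<in> supported ?S"
    using L by (simp add: basis_vector_supported top_index_in_basis)
  have cyc: "cyclic_vector n ?S ?e"
    using L by (rule top_vector_cyclic)
  \<comment> \<open>As K f is non-zero, some word gives it a non-zero highest component. By
    \<open>intertwiner_top_coefficient\<close> the same word applied to f has one too; projection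
    puts the highest vector into M, and cyclicity finishes.\<close>
  have maximal: "M = supported ?S"
    if M: "stable n ?S M" "M \<subseteq> supported ?S" and f: "f \<in> M" "f \<notin> Ker" for M f
  proof -
    have Kf: "K f \<in> supported ?T"
      using f M linear_map_supported[OF intertwiner_linear[OF K]] by blast
    have "K f \<noteq> (\<lambda>_. 0)"
      using f M by (auto simp: Ker_def)
    then obtain w where w: "word_ok n w" "wact ?T w (K f) (top_index (rev L)) \<noteq> 0"
      using cocyclic[OF cyc L(1) Kf] by blast
    have wf: "wact ?S w f \<in> M"
      using w(1)
    proof (induction w)
      case (Cons l w)
      obtain i j r where "l = (i, j, r)"
        by (metis prod_cases3)
      then show ?case
        using Cons by (simp add: stable_act[OF M(1)])
    qed (simp add: f)
    then have wf': "wact ?S w f \<in> supported ?S"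
      using M by blast
    have "K (wact ?S w f) (top_index (rev L)) \<noteq> 0"
      using w f M intertwiner_wact[OF K _ w(1), of f] by auto
    then have "wact ?S w f (top_index L) \<noteq> 0"
      using intertwiner_top_coefficient[OF K L(1) wf'] by auto
    then have "?e \<in> M"
      using stable_top_projection[OF M(1) wf wf'] by blast
    then show ?thesis
      using cyc M by (auto simp: cyclic_vector_def)
  qed
  have "\<exists>f\<in>supported ?S. f \<notin> Ker"
    using nz by (auto simp: nonzero_map_def Ker_def)
  then show "irreducible_yangian_module n Q"
    unfolding Q using maximal by (rule irreducible_Q)
  have "?e \<notin> Ker"
  proof
    assume "?e \<in> Ker"
    then have "supported ?S \<subseteq> Ker"
      using cyc stable by (auto simp: cyclic_vector_def)
    then show False
      using \<open>\<exists>f\<in>supported ?S. f \<notin> Ker\<close> by blast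
  qed
  then have "coset ?e \<noteq> \<zero>\<^bsub>Q\<^esub>"
    unfolding Q using e by (simp add: coset_eq_zero_iff)
  moreover have "coset ?e \<in> carrier Q"
    unfolding Q using e by (simp add: carrier_Q)
  moreover note vacuum_ext_tensor[OF L(1), unfolded vacuum_def]
  ultimately show "\<exists>v\<in>carrier Q. v \<noteq> \<zero>\<^bsub>Q\<^esub> \<and>
      (\<forall>i\<in>{1..n}. \<forall>j\<in>{1..n}. \<forall>r. i < j \<longrightarrow> gen Q i j r v = \<zero>\<^bsub>Q\<^esub>) \<and>
      (\<forall>i\<in>{1..n}. \<forall>r. gen Q i i r v = fps_nth (top_series L i) r \<odot>\<^bsub>Q\<^esub> v)"
    unfolding Q using e by (intro bexI[of _ "coset ?e"]) (auto simp: gen_Q smult_Q zero_Q)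
qed

section \<open>Drinfeld polynomials\<close>

lemma poly_in_x_pCons: "poly_in_x (pCons a p) = fls_const a + fls_X_inv * poly_in_x p"
  by (simp add: poly_in_x_def map_poly_pCons)

lemma poly_in_x_0 [simp]: "poly_in_x 0 = 0"
  by (simp add: poly_in_x_def)

lemma poly_in_x_1 [simp]: "poly_in_x 1 = 1"
  by (simp add: poly_in_x_def)

lemma poly_in_x_add: "poly_in_x (p + q) = poly_in_x p + poly_in_x q"
  by (induction p q rule: poly_induct2) (simp_all add: poly_in_x_pCons fls_plus_const algebra_simps flip: fls_plus_const)

lemma poly_in_x_smult: "poly_in_x (Polynomial.smult a p) = fls_const a * poly_in_x p"
  by (induction p) (simp_all add: poly_in_x_pCons fls_const_mult_const algebra_simps)

lemma poly_in_x_mult: "poly_in_x (p * q) = poly_in_x p * poly_in_x q"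
  by (induction p) (simp_all add: mult_pCons_left poly_in_x_add poly_in_x_smult poly_in_x_pCons algebra_simps)

lemma poly_in_x_prod: "poly_in_x (\<Prod>a\<in>A. f a) = (\<Prod>a\<in>A. poly_in_x (f a))"
  by (induction A rule: infinite_finite_induct) (simp_all add: poly_in_x_mult)

text \<open>This is 1 + 1/(x - t) = (x + 1 - t)/(x - t). Passing from \<open>lin\<close> to
  polynomials in x multiplies numerator and denominator by x.\<close>

lemma fps_to_fls_top_factor:
  "fps_to_fls (1 + fps_X * geo t) = poly_in_x [:1 - t, 1:] / poly_in_x [:- t, 1:]"
proof -
  have shift: "poly_in_x [:c, 1:] = fls_X_inv * fps_to_fls (lin c)" for c
  proof -
    have "fls_X_inv * fls_X = (1 :: complex fls)"
      by (metis fls_inverse_X left_inverse fls_X_nonzero)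
    then have "fls_X_inv * (fls_const c * fls_X) = fls_const c"
      by (simp add: mult.left_commute[of fls_X_inv])
    then show ?thesis
      by (simp add: poly_in_x_pCons fls_times_fps_to_fls distrib_left)
  qed
  have "lin (- t) * (1 + fps_X * geo t) = lin (1 - t)"
    using top_den_series[of "[(1, t)]" 1] by simp
  then have eq: "fps_to_fls (lin (- t)) * fps_to_fls (1 + fps_X * geo t) = fps_to_fls (lin (1 - t))"
    by (simp only: fls_times_fps_to_fls[symmetric])
  have "fps_nth (lin (- t)) 0 = 1"
    by simp
  then have "fps_to_fls (lin (- t)) \<noteq> 0"
    by (metis fps_to_fls_eq_0_iff fps_zero_nth zero_neq_one)
  then show ?thesis
    unfolding shift eq[symmetric] by simp
qed

text \<open>The eigenvalue for i involves the factors with k \<ge> i, that for i + 1 those with k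
  \<ge> i + 1; they differ by the factors with k = i.\<close>

lemma top_series_ratio:
  "top_series L i = top_series L (Suc i) * (\<Prod>(k, t)\<leftarrow>L. if k = i then 1 + fps_X * geo t else 1)"
  by (induction L i rule: top_series.induct) (auto simp: mult_ac)

lemma top_series_nonzero: "fps_nth (top_series L i) 0 = 1"
  by (induction L i rule: top_series.induct) auto

section \<open>The intertwining operators of the theorem\<close>

definition shift :: "nat \<Rightarrow> nat \<Rightarrow> complex" where
  "shift m a = rho m a + 1 / 2"

definition params :: "nat \<Rightarrow> (nat \<Rightarrow> nat) \<Rightarrow> (nat \<Rightarrow> complex) \<Rightarrow> (nat \<times> complex) list" where
  "params m \<nu> \<mu> = param_list \<nu> (shift m) \<mu> [1..<Suc m]"

lemma source_eq: "source n m \<nu> \<mu> = ext_tensor n (params m \<nu> \<mu>)"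
  by (simp add: source_def ext_tensor_def params_def param_list_def factor_def[abs_def] shift_def
      comp_def add.assoc del: upt_Suc)

lemma target_eq: "target n m \<nu> \<mu> = ext_tensor n (rev (params m \<nu> \<mu>))"
  by (simp add: target_def ext_tensor_def params_def param_list_def factor_def[abs_def] shift_def
      comp_def add.assoc rev_map del: upt_Suc)

lemma sized_params: "\<forall>a\<in>{1..m}. \<nu> a \<le> n \<Longrightarrow> sized n (params m \<nu> \<mu>)"
  by (auto simp: sized_def params_def param_list_def simp del: upt_Suc)

lemma ordered_shifts_params:
  assumes "shifted_dominant m \<nu> \<mu>"
  shows "ordered_shifts (params m \<nu> \<mu>)"
proof -
  have "\<mu> a + shift m a + of_nat (\<nu> a) - (\<mu> b + shift m b + of_nat (\<nu> b)) \<noteq> - of_nat i"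
    if "a \<in> {1..m}" "b \<in> {1..m}" "a < b" "i \<ge> 1" for a b i :: nat
  proof -
    have "\<mu> a + of_nat (\<nu> a) + rho m a - (\<mu> b + of_nat (\<nu> b) + rho m b) \<noteq> - of_nat i"
      using assms that by (auto simp: shifted_dominant_def dominant_def Let_def)
    then show ?thesis
      by (simp add: shift_def algebra_simps)
  qed
  then have "sorted_wrt (\<lambda>a b. \<forall>i::nat. i \<ge> 1 \<longrightarrow>
      \<mu> a + shift m a + of_nat (\<nu> a) - (\<mu> b + shift m b + of_nat (\<nu> b)) \<noteq> - of_nat i) [1..<Suc m]"
    by (intro sorted_wrt_mono_rel[OF _ sorted_wrt_upt]) (auto simp del: upt_Suc)
  then show ?thesis
    by (simp add: ordered_shifts_def params_def param_list_def sorted_wrt_map del: upt_Suc)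
qed

definition top_source :: "nat \<Rightarrow> (nat \<Rightarrow> nat) \<Rightarrow> nat set list \<Rightarrow> complex" where
  "top_source m \<nu> = basis_vector (map (\<lambda>a. {1..\<nu> a}) [1..<Suc m])"

definition top_target :: "nat \<Rightarrow> (nat \<Rightarrow> nat) \<Rightarrow> nat set list \<Rightarrow> complex" where
  "top_target m \<nu> = basis_vector (map (\<lambda>a. {1..\<nu> a}) (rev [1..<Suc m]))"

lemma top_source_eq: "top_source m \<nu> = basis_vector (top_index (params m \<nu> \<mu>))"
  by (simp add: top_source_def params_def top_index_param_list del: upt_Suc)

lemma top_target_eq: "top_target m \<nu> = basis_vector (top_index (rev (params m \<nu> \<mu>)))"
  by (simp add: top_target_def params_def rev_param_list top_index_param_list del: upt_Suc)

context
  fixes n m :: nat and \<nu> :: "nat \<Rightarrow> nat"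
  assumes \<nu>: "\<forall>a\<in>{1..m}. \<nu> a \<le> n"
begin

lemma top_source_supported: "top_source m \<nu> \<in> supported (source n m \<nu> \<mu>)"
  unfolding source_eq top_source_eq[of m \<nu> \<mu>]
  by (intro basis_vector_supported top_index_in_basis sized_params \<nu>)

lemma cyclic_source:
  assumes "shifted_dominant m \<nu> \<mu>"
  shows "cyclic_vector n (source n m \<nu> \<mu>) (top_source m \<nu>)"
  unfolding source_eq top_source_eq[of m \<nu> \<mu>]
  by (intro top_vector_cyclic sized_params \<nu> ordered_shifts_params assms)

lemma canonical_intertwiner_exists:
  assumes "shifted_dominant m \<nu> \<mu>"
  shows "\<exists>K. intertwiner n (Source n m \<nu> \<mu>) (Target n m \<nu> \<mu>) K \<and> K (top_source m \<nu>) = top_target m \<nu>"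
  unfolding source_eq target_eq top_source_eq[of m \<nu> \<mu>] top_target_eq[of m \<nu> \<mu>]
proof (rule intertwiner_exists)
  let ?L = "params m \<nu> \<mu>"
  have L: "sized n ?L"
    by (intro sized_params \<nu>)
  show "vacuum n (ext_tensor n ?L) (top_index ?L) (\<lambda>i. fps_nth (top_series ?L i))"
    by (rule vacuum_ext_tensor[OF L])
  show "vacuum n (ext_tensor n (rev ?L)) (top_index (rev ?L)) (\<lambda>i. fps_nth (top_series ?L i))"
    using vacuum_ext_tensor[of n "rev ?L"] L by (simp add: top_series_rev)
  show cyc: "cyclic_vector n (ext_tensor n ?L) (basis_vector (top_index ?L))"
    by (intro top_vector_cyclic L ordered_shifts_params assms)
  show "u = (\<lambda>_. 0)" if "u \<in> supported (ext_tensor n (rev ?L))"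
    and "\<And>w. word_ok n w \<Longrightarrow> wact (ext_tensor n (rev ?L)) w u (top_index (rev ?L)) = 0" for u
    by (rule cocyclic[OF cyc L that])
qed

text \<open>Prescribing the image of the highest vector, instead of choosing multipliers point by
  point, makes the operator non-zero at all dominant points and turns its entries into values of one
  rational function.\<close>

definition canonical :: "(nat \<Rightarrow> complex) \<Rightarrow> (nat set list \<Rightarrow> complex) \<Rightarrow> nat set list \<Rightarrow> complex" where
  "canonical \<mu> = (SOME K. intertwiner n (Source n m \<nu> \<mu>) (Target n m \<nu> \<mu>) K \<and>
     K (top_source m \<nu>) = top_target m \<nu>)"

lemma canonical:
  assumes "shifted_dominant m \<nu> \<mu>"
  shows canonical_intertwiner: "intertwiner n (Source n m \<nu> \<mu>) (Target n m \<nu> \<mu>) (canonical \<mu>)"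
    and canonical_top: "canonical \<mu> (top_source m \<nu>) = top_target m \<nu>"
  using someI_ex[OF canonical_intertwiner_exists[OF assms]] unfolding canonical_def by auto

lemma top_target_nonzero: "top_target m \<nu> \<noteq> (\<lambda>_. 0)"
  by (auto simp: top_target_def basis_vector_def fun_eq_iff)

lemma canonical_nonzero:
  assumes "shifted_dominant m \<nu> \<mu>"
  shows "nonzero_map (Source n m \<nu> \<mu>) (Target n m \<nu> \<mu>) (canonical \<mu>)"
  unfolding nonzero_map_def
  using top_source_supported top_target_nonzero canonical_top[OF assms] by (intro bexI[of _ "top_source m \<nu>"]) auto

lemma intertwiner_multiple:
  assumes \<mu>: "shifted_dominant m \<nu> \<mu>" and J: "intertwiner n (Source n m \<nu> \<mu>) (Target n m \<nu> \<mu>) J"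
  shows "\<exists>b. \<forall>f\<in>supported (source n m \<nu> \<mu>). J f = (\<lambda>x. b * canonical \<mu> f x)"
proof -
  have "\<exists>b. J (top_source m \<nu>) = (\<lambda>x. b * top_target m \<nu> x)"
    using intertwiner_top[of n "params m \<nu> \<mu>" J] J sized_params[OF \<nu>]
    unfolding source_eq target_eq top_source_eq[of m \<nu> \<mu>] top_target_eq[of m \<nu> \<mu>] by blast
  then obtain b where "J (top_source m \<nu>) = (\<lambda>x. b * canonical \<mu> (top_source m \<nu>) x)"
    using canonical_top[OF \<mu>] by auto
  then show ?thesis
    using intertwiner_determined[OF cyclic_source[OF \<mu>] top_source_supported canonical_intertwiner[OF \<mu>] J]
    by blast
qed

lemma nonzero_intertwiner_multiple:
  assumes \<mu>: "shifted_dominant m \<nu> \<mu>" and J: "nonzero_intertwiner n (Source n m \<nu> \<mu>) (Target n m \<nu> \<mu>) J"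
  shows "\<exists>b. b \<noteq> 0 \<and> (\<forall>f\<in>supported (source n m \<nu> \<mu>). J f = (\<lambda>x. b * canonical \<mu> f x))"
proof -
  obtain b where b: "\<forall>f\<in>supported (source n m \<nu> \<mu>). J f = (\<lambda>x. b * canonical \<mu> f x)"
    using intertwiner_multiple[OF \<mu>] J unfolding nonzero_intertwiner_def by blast
  moreover have "b \<noteq> 0"
    using J b by (auto simp: nonzero_intertwiner_def nonzero_map_def)
  ultimately show ?thesis
    by blast
qed

text \<open>Cyclicity at a dominant \<open>\<mu>0\<close> yields a fraction with denominator
  non-zero at \<open>\<mu>0\<close> whose identity with the entry holds at all dominant points,
  which is what allows the local fractions to be glued.\<close>

lemma canonical_rational:
  assumes y: "y \<in> basis (source n m \<nu> (\<lambda>_. 0))"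
  shows "rational_regular_on m {\<mu>. shifted_dominant m \<nu> \<mu>} (\<lambda>\<mu>. canonical \<mu> (basis_vector y) x)"
proof (rule rational_regular_on_fractions)
  fix \<mu>0 assume "\<mu>0 \<in> {\<mu>. shifted_dominant m \<nu> \<mu>}"
  then have \<mu>0: "shifted_dominant m \<nu> \<mu>0"
    by simp
  have "\<exists>q p. polynomial_fun m q \<and> q \<mu>0 \<noteq> 0 \<and>
    (\<forall>y\<in>basis (ext_tensor n (param_list \<nu> (shift m) \<mu>0 [1..<Suc m])). \<forall>x. polynomial_fun m (p x y) \<and>
      (\<forall>\<mu>\<in>{\<mu>. shifted_dominant m \<nu> \<mu>}. canonical \<mu> (basis_vector y) x * q \<mu> = p x y \<mu>))"
  proof (rule intertwiner_fractions)
    show "cyclic_vector n (ext_tensor n (param_list \<nu> (shift m) \<mu>0 [1..<Suc m]))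
        (basis_vector (map (\<lambda>a. {1..\<nu> a}) [1..<Suc m]))"
      using cyclic_source[OF \<mu>0] unfolding source_eq params_def top_source_def .
  next
    fix \<mu> assume "\<mu> \<in> {\<mu>. shifted_dominant m \<nu> \<mu>}"
    then show "intertwiner n (space_of (ext_tensor n (param_list \<nu> (shift m) \<mu> [1..<Suc m])))
        (space_of (ext_tensor n (rev (param_list \<nu> (shift m) \<mu> [1..<Suc m])))) (canonical \<mu>) \<and>
      canonical \<mu> (basis_vector (map (\<lambda>a. {1..\<nu> a}) [1..<Suc m]))
        = basis_vector (map (\<lambda>a. {1..\<nu> a}) (rev [1..<Suc m]))"
      using canonical[of \<mu>] unfolding source_eq target_eq params_def top_source_def top_target_def by blast
  qed (use \<nu> in auto)
  moreover have "basis (ext_tensor n (param_list \<nu> (shift m) \<mu>0 [1..<Suc m])) = basis (source n m \<nu> (\<lambda>_. 0))"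
    unfolding source_eq params_def by (rule basis_param_list)
  ultimately show "\<exists>q p. polynomial_fun m q \<and> polynomial_fun m p \<and> q \<mu>0 \<noteq> 0 \<and>
      (\<forall>\<mu>\<in>{\<mu>. shifted_dominant m \<nu> \<mu>}. canonical \<mu> (basis_vector y) x * q \<mu> = p \<mu>)"
    using y by metis
qed (use generic_dominant in blast)

lemma normalized_family_canonical: "normalized_family n m \<nu> canonical"
  unfolding normalized_family_def
  by (intro conjI allI impI ballI canonical_rational canonical_nonzero)
     (auto intro: canonical_intertwiner generic_dominant intertwiner_linear)

end

section \<open>From generic to dominant parameters\<close>

text \<open>In this form the intertwining property is a system of finite sums of products of
  polynomials in \<mu> with entries of the operator, so density applies to each equation.\<close>

lemma intertwiner_iff_matrix:
  assumes K: "linear_map (space_of B) (space_of B') K" and fin: "finite (basis B)" "finite (basis B')"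
  shows "intertwiner n (space_of B) (space_of B') K \<longleftrightarrow>
    (\<forall>i\<in>{1..n}. \<forall>j\<in>{1..n}. \<forall>r. \<forall>y\<in>basis B. \<forall>x\<in>basis B'.
      (\<Sum>z\<in>basis B. coef B i j r z y * K (basis_vector z) x)
      = (\<Sum>z\<in>basis B'. coef B' i j r x z * K (basis_vector y) z))" (is "_ \<longleftrightarrow> ?R")
proof
  assume I: "intertwiner n (space_of B) (space_of B') K"
  show ?R
  proof (intro ballI allI)
    fix i j r y x assume ij: "i \<in> {1..n}" "j \<in> {1..n}" and y: "y \<in> basis B" and x: "x \<in> basis B'"
    have "K (act B i j r (basis_vector y)) x = act B' i j r (K (basis_vector y)) x"
      using I ij basis_vector_supported[OF y] by (simp add: intertwiner_iff)
    then show "(\<Sum>z\<in>basis B. coef B i j r z y * K (basis_vector z) x)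
      = (\<Sum>z\<in>basis B'. coef B' i j r x z * K (basis_vector y) z)"
      using x y fin by (simp add: linear_map_expand[OF K fin(1) act_supported] act_basis_vector)
        (simp add: act_def)
  qed
next
  assume R: ?R
  show "intertwiner n (space_of B) (space_of B') K"
    unfolding intertwiner_iff
  proof (intro conjI ballI allI K ext)
    fix i j r f x assume ij: "i \<in> {1..n}" "j \<in> {1..n}" and f: "f \<in> supported B"
    show "K (act B i j r f) x = act B' i j r (K f) x"
    proof (cases "x \<in> basis B'")
      case True
      have "K (act B i j r f) x = (\<Sum>z\<in>basis B. (\<Sum>y\<in>basis B. coef B i j r z y * f y) * K (basis_vector z) x)"
        by (simp add: linear_map_expand[OF K fin(1) act_supported]) (simp add: act_def)
      also have "\<dots> = (\<Sum>z\<in>basis B. \<Sum>y\<in>basis B. f y * (coef B i j r z y * K (basis_vector z) x))"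
        by (simp add: sum_distrib_left mult_ac)
      also have "\<dots> = (\<Sum>y\<in>basis B. f y * (\<Sum>z\<in>basis B. coef B i j r z y * K (basis_vector z) x))"
        by (subst sum.swap) (simp add: sum_distrib_left)
      also have "\<dots> = (\<Sum>y\<in>basis B. f y * (\<Sum>z\<in>basis B'. coef B' i j r x z * K (basis_vector y) z))"
        using R ij True by (intro sum.cong) auto
      also have "\<dots> = (\<Sum>y\<in>basis B. \<Sum>z\<in>basis B'. coef B' i j r x z * (f y * K (basis_vector y) z))"
        by (simp add: sum_distrib_left mult_ac)
      also have "\<dots> = (\<Sum>z\<in>basis B'. coef B' i j r x z * (\<Sum>y\<in>basis B. f y * K (basis_vector y) z))"
        by (subst sum.swap) (simp add: sum_distrib_left)
      also have "\<dots> = act B' i j r (K f) x"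
        using True by (simp add: act_def linear_map_expand[OF K fin(1) f])
      finally show ?thesis .
    next
      case False
      then show ?thesis
        using linear_map_supported[OF K act_supported[of B i j r f]] by (simp add: act_def supported_def)
    qed
  qed
qed

text \<open>Each matrix equation is a rational germ at \<open>\<mu>\<close> that vanishes at the
  generic points, hence also at \<open>\<mu>\<close>. The quotient theorem thus covers every
  normalized family, not only \<open>canonical\<close>.\<close>

lemma normalized_family_intertwiner:
  assumes I: "normalized_family n m \<nu> I" and \<mu>: "shifted_dominant m \<nu> \<mu>"
  shows "intertwiner n (Source n m \<nu> \<mu>) (Target n m \<nu> \<mu>) (I \<mu>)"
proof -
  let ?Y = "basis (source n m \<nu> (\<lambda>_. 0))" and ?X = "basis (target n m \<nu> (\<lambda>_. 0))"
  have basis: "basis (source n m \<nu> x) = ?Y" "basis (target n m \<nu> x) = ?X" for x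
    unfolding source_eq target_eq params_def rev_param_list by (rule basis_param_list)+
  have fin: "finite (basis (source n m \<nu> x))" "finite (basis (target n m \<nu> x))" for x
    by (simp_all add: source_eq target_eq)
  have poly: "polynomial_fun m (\<lambda>\<mu>. coef (source n m \<nu> \<mu>) i j r x y)"
      "polynomial_fun m (\<lambda>\<mu>. coef (target n m \<nu> \<mu>) i j r x y)" for i j r x y
    unfolding source_eq target_eq params_def rev_param_list by (intro polynomial_fun_coef; auto)+
  have germ: "rational_germ m \<mu> (\<lambda>\<mu>. I \<mu> (basis_vector y) x)" if "y \<in> ?Y" "x \<in> ?X" for x y
    using I that \<mu> unfolding normalized_family_def
    by (intro rational_germ_regular[where D = "{\<mu>. shifted_dominant m \<nu> \<mu>}"]) (auto intro: generic_dominant)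
  have lin: "linear_map (Source n m \<nu> x) (Target n m \<nu> x) (I x)" if "shifted_dominant m \<nu> x" for x
    using I that unfolding normalized_family_def by blast
  have matrix: "intertwiner n (Source n m \<nu> \<mu>) (Target n m \<nu> \<mu>) (I \<mu>) \<longleftrightarrow>
      (\<forall>i\<in>{1..n}. \<forall>j\<in>{1..n}. \<forall>r. \<forall>y\<in>?Y. \<forall>x\<in>?X.
        (\<Sum>z\<in>?Y. coef (source n m \<nu> \<mu>) i j r z y * I \<mu> (basis_vector z) x)
        = (\<Sum>z\<in>?X. coef (target n m \<nu> \<mu>) i j r x z * I \<mu> (basis_vector y) z))"
    if "shifted_dominant m \<nu> \<mu>" for \<mu>
    using intertwiner_iff_matrix[OF lin[OF that] fin, of n] by (simp only: basis[of \<mu>])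
  show ?thesis
    unfolding matrix[OF \<mu>]
  proof (intro ballI allI)
    fix i j r y x assume ij: "i \<in> {1..n}" "j \<in> {1..n}" and y: "y \<in> ?Y" and x: "x \<in> ?X"
    define g where "g \<mu> = (\<Sum>z\<in>?Y. coef (source n m \<nu> \<mu>) i j r z y * I \<mu> (basis_vector z) x)
        + (\<Sum>z\<in>?X. (- 1 * coef (target n m \<nu> \<mu>) i j r x z) * I \<mu> (basis_vector y) z)" for \<mu>
    have "rational_germ m \<mu> g"
      unfolding g_def using x y
      by (intro rational_germ_add rational_germ_sum rational_germ_mult germ
          rational_germ_polynomial polynomial_fun.mult polynomial_fun.const poly)
    moreover have "g x' = 0" if "generic m x'" for x'
    proof -
      have "intertwiner n (Source n m \<nu> x') (Target n m \<nu> x') (I x')"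
        using I that unfolding normalized_family_def by blast
      then show ?thesis
        using matrix[OF generic_dominant[OF that]] ij x y by (simp add: g_def sum_negf)
    qed
    ultimately have "g \<mu> = 0"
      by (rule rational_germ_eq_0)
    then show "(\<Sum>z\<in>?Y. coef (source n m \<nu> \<mu>) i j r z y * I \<mu> (basis_vector z) x)
        = (\<Sum>z\<in>?X. coef (target n m \<nu> \<mu>) i j r x z * I \<mu> (basis_vector y) z)"
      by (simp add: g_def sum_negf)
  qed
qed

lemma fps_to_fls_prod: "fps_to_fls (\<Prod>a\<in>A. f a) = (\<Prod>a\<in>A. fps_to_fls (f a))"
  by (induction A rule: infinite_finite_induct) (simp_all add: fls_times_fps_to_fls)

text \<open>With t = \<mu>_a + \<rho>_a + 1/2, the factor (x + 1 - t)/(x - t) is a linear polynomial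
  with root \<mu>_a + \<rho>_a taken at x + 1/2 and x - 1/2; this is the purpose of the 1/2 in the
  parameters.\<close>

lemma top_series_params_ratio:
  fixes \<mu> m \<nu>
  defines "P \<equiv> \<lambda>i. \<Prod>a | a \<in> {1..m} \<and> \<nu> a = i. [: - (\<mu> a + rho m a), 1 :]"
  shows "fps_to_fls (top_series (params m \<nu> \<mu>) i) / fps_to_fls (top_series (params m \<nu> \<mu>) (Suc i))
    = poly_in_x (P i \<circ>\<^sub>p [:1/2, 1:]) / poly_in_x (P i \<circ>\<^sub>p [:-1/2, 1:])"
proof -
  let ?L = "params m \<nu> \<mu>" and ?A = "{a. a \<in> {1..m} \<and> \<nu> a = i}" and ?t = "\<lambda>a. \<mu> a + shift m a"
  have "(\<Prod>(k, t)\<leftarrow>?L. if k = i then 1 + fps_X * geo t else 1)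
      = (\<Prod>a\<leftarrow>[1..<Suc m]. if \<nu> a = i then 1 + fps_X * geo (?t a) else 1)"
    by (simp add: params_def param_list_def comp_def del: upt_Suc)
  also have "\<dots> = (\<Prod>a\<in>{1..m}. if \<nu> a = i then 1 + fps_X * geo (?t a) else 1)"
    using prod.distinct_set_conv_list[of "[1..<Suc m]" "\<lambda>a. if \<nu> a = i then 1 + fps_X * geo (?t a) else 1"]
    by (simp add: atLeastLessThanSuc_atLeastAtMost del: upt_Suc)
  also have "\<dots> = (\<Prod>a\<in>?A. 1 + fps_X * geo (?t a))"
    using prod.inter_filter[of "{1..m}" "\<lambda>a. 1 + fps_X * geo (?t a)" "\<lambda>a. \<nu> a = i"] by simp
  finally have ratio: "top_series ?L i = top_series ?L (Suc i) * (\<Prod>a\<in>?A. 1 + fps_X * geo (?t a))"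
    using top_series_ratio[of ?L i] by simp
  have "top_series ?L (Suc i) \<noteq> 0"
    using top_series_nonzero[of ?L "Suc i"] by auto
  then have "fps_to_fls (top_series ?L i) / fps_to_fls (top_series ?L (Suc i))
      = fps_to_fls (\<Prod>a\<in>?A. 1 + fps_X * geo (?t a))"
    by (simp add: ratio fls_times_fps_to_fls fps_to_fls_eq_0_iff)
  also have "\<dots> = (\<Prod>a\<in>?A. poly_in_x [:1 - ?t a, 1:]) / (\<Prod>a\<in>?A. poly_in_x [:- ?t a, 1:])"
    by (simp only: fps_to_fls_prod fps_to_fls_top_factor prod_dividef)
  also have "(\<Prod>a\<in>?A. poly_in_x [:1 - ?t a, 1:]) = poly_in_x (P i \<circ>\<^sub>p [:1/2, 1:])"
    unfolding P_def pcompose_prod poly_in_x_prod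
    by (intro prod.cong) (auto simp: pcompose_pCons shift_def algebra_simps)
  also have "(\<Prod>a\<in>?A. poly_in_x [:- ?t a, 1:]) = poly_in_x (P i \<circ>\<^sub>p [:-1/2, 1:])"
    unfolding P_def pcompose_prod poly_in_x_prod
    by (intro prod.cong) (auto simp: pcompose_pCons shift_def algebra_simps)
  finally show ?thesis .
qed

theorem mainTheorem1:
  fixes n m :: nat and \<nu> :: "nat \<Rightarrow> nat"
  assumes "n \<ge> 2" and "m \<ge> 1" and "\<forall>a\<in>{1..m}. \<nu> a \<in> {1..n - 1}"
  shows
    "(\<forall>\<mu>. generic m \<mu> \<longrightarrow>
        (\<exists>J. nonzero_intertwiner n (Source n m \<nu> \<mu>) (Target n m \<nu> \<mu>) J) \<and>
        (\<forall>J J'. nonzero_intertwiner n (Source n m \<nu> \<mu>) (Target n m \<nu> \<mu>) J \<and>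
                nonzero_intertwiner n (Source n m \<nu> \<mu>) (Target n m \<nu> \<mu>) J' \<longrightarrow>
           (\<exists>c. c \<noteq> 0 \<and> (\<forall>v\<in>carrier (Source n m \<nu> \<mu>). J' v = c \<odot>\<^bsub>Target n m \<nu> \<mu>\<^esub> J v))))
     \<and>
     (\<forall>J. (\<forall>\<mu>. generic m \<mu> \<longrightarrow>
             nonzero_intertwiner n (Source n m \<nu> \<mu>) (Target n m \<nu> \<mu>) (J \<mu>)) \<longrightarrow>
        (\<exists>c I. (\<forall>\<mu>. generic m \<mu> \<longrightarrow> c \<mu> \<noteq> 0 \<and>
                  (\<forall>v\<in>carrier (Source n m \<nu> \<mu>). I \<mu> v = c \<mu> \<odot>\<^bsub>Target n m \<nu> \<mu>\<^esub> J \<mu> v)) \<and>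
               normalized_family n m \<nu> I))
     \<and>
     (\<forall>I. normalized_family n m \<nu> I \<longrightarrow>
        (\<forall>\<mu>. shifted_dominant m \<nu> \<mu> \<longrightarrow>
           (let Q = quotient_space (Source n m \<nu> \<mu>)
                      (a_kernel (Source n m \<nu> \<mu>) (Target n m \<nu> \<mu>) (I \<mu>))
            in irreducible_yangian_module n Q \<and>
               drinfeld_polynomials n Q
                 (\<lambda>i. \<Prod>a | a \<in> {1..m} \<and> \<nu> a = i. [: - (\<mu> a + rho m a), 1 :]))))"
proof -
  have \<nu>: "\<forall>a\<in>{1..m}. \<nu> a \<le> n"
    using assms by auto
  let ?K = "canonical n m \<nu>"
  show ?thesis
  proof (intro conjI allI impI)
    fix \<mu> assume "generic m \<mu>"
    then have \<mu>: "shifted_dominant m \<nu> \<mu>"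
      by (rule generic_dominant)
    show "\<exists>J. nonzero_intertwiner n (Source n m \<nu> \<mu>) (Target n m \<nu> \<mu>) J"
      using canonical_intertwiner[OF \<nu> \<mu>] canonical_nonzero[OF \<nu> \<mu>] by (auto simp: nonzero_intertwiner_def)
    fix J J' assume "nonzero_intertwiner n (Source n m \<nu> \<mu>) (Target n m \<nu> \<mu>) J \<and>
        nonzero_intertwiner n (Source n m \<nu> \<mu>) (Target n m \<nu> \<mu>) J'"
    then obtain b b' where "b \<noteq> 0" "\<forall>f\<in>supported (source n m \<nu> \<mu>). J f = (\<lambda>x. b * ?K \<mu> f x)"
      "b' \<noteq> 0" "\<forall>f\<in>supported (source n m \<nu> \<mu>). J' f = (\<lambda>x. b' * ?K \<mu> f x)"
      using nonzero_intertwiner_multiple[OF \<nu> \<mu>] by meson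
    then show "\<exists>c. c \<noteq> 0 \<and> (\<forall>v\<in>carrier (Source n m \<nu> \<mu>). J' v = c \<odot>\<^bsub>Target n m \<nu> \<mu>\<^esub> J v)"
      by (intro exI[of _ "b' / b"]) simp
  next
    fix J assume J: "\<forall>\<mu>. generic m \<mu> \<longrightarrow> nonzero_intertwiner n (Source n m \<nu> \<mu>) (Target n m \<nu> \<mu>) (J \<mu>)"
    have "\<forall>\<mu>. \<exists>b. generic m \<mu> \<longrightarrow> b \<noteq> 0 \<and> (\<forall>f\<in>supported (source n m \<nu> \<mu>). J \<mu> f = (\<lambda>x. b * ?K \<mu> f x))"
      using nonzero_intertwiner_multiple[OF \<nu> generic_dominant] J by meson
    then obtain b where b: "\<And>\<mu>. generic m \<mu> \<Longrightarrow> b \<mu> \<noteq> 0"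
      "\<And>\<mu> f. generic m \<mu> \<Longrightarrow> f \<in> supported (source n m \<nu> \<mu>) \<Longrightarrow> J \<mu> f = (\<lambda>x. b \<mu> * ?K \<mu> f x)"
      by metis
    show "\<exists>c I. (\<forall>\<mu>. generic m \<mu> \<longrightarrow> c \<mu> \<noteq> 0 \<and>
        (\<forall>v\<in>carrier (Source n m \<nu> \<mu>). I \<mu> v = c \<mu> \<odot>\<^bsub>Target n m \<nu> \<mu>\<^esub> J \<mu> v)) \<and> normalized_family n m \<nu> I"
    proof (intro exI conjI)
      \<comment> \<open>The same family serves for every given \<open>J\<close>; only the
        multipliers, the inverses of \<open>b\<close>, depend on \<open>J\<close>.\<close>
      show "normalized_family n m \<nu> ?K"
        by (rule normalized_family_canonical[OF \<nu>])
      show "\<forall>\<mu>. generic m \<mu> \<longrightarrow> 1 / b \<mu> \<noteq> 0 \<and>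
          (\<forall>v\<in>carrier (Source n m \<nu> \<mu>). ?K \<mu> v = (1 / b \<mu>) \<odot>\<^bsub>Target n m \<nu> \<mu>\<^esub> J \<mu> v)"
        using b by simp
    qed
  next
    fix I \<mu> assume I: "normalized_family n m \<nu> I" and \<mu>: "shifted_dominant m \<nu> \<mu>"
    let ?L = "params m \<nu> \<mu>"
    let ?Q = "quotient_space (Source n m \<nu> \<mu>) (a_kernel (Source n m \<nu> \<mu>) (Target n m \<nu> \<mu>) (I \<mu>))"
    let ?P = "\<lambda>i. \<Prod>a | a \<in> {1..m} \<and> \<nu> a = i. [: - (\<mu> a + rho m a), 1 :]"
    have int: "intertwiner n (Source n m \<nu> \<mu>) (Target n m \<nu> \<mu>) (I \<mu>)"
      by (rule normalized_family_intertwiner[OF I \<mu>])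
    have nz: "nonzero_map (Source n m \<nu> \<mu>) (Target n m \<nu> \<mu>) (I \<mu>)"
      using I \<mu> unfolding normalized_family_def by blast
    note quotient = quotient_irreducible[OF sized_params[OF \<nu>] ordered_shifts_params[OF \<mu>]
        int[unfolded source_eq target_eq] nz[unfolded source_eq target_eq], folded source_eq target_eq]
    have lead: "lead_coeff (?P i) = 1" for i
      by (simp add: lead_coeff_prod)
    from quotient(2) obtain v where v: "v \<in> carrier ?Q" "v \<noteq> \<zero>\<^bsub>?Q\<^esub>"
      "\<forall>i\<in>{1..n}. \<forall>j\<in>{1..n}. \<forall>r. i < j \<longrightarrow> gen ?Q i j r v = \<zero>\<^bsub>?Q\<^esub>"
      "\<forall>i\<in>{1..n}. \<forall>r. gen ?Q i i r v = fps_nth (top_series ?L i) r \<odot>\<^bsub>?Q\<^esub> v"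
      by (elim bexE conjE)
    have "drinfeld_polynomials n ?Q ?P"
      unfolding drinfeld_polynomials_def
      by (intro bexI[OF _ v(1)] exI[of _ "top_series ?L"] conjI v(2-4) ballI lead top_series_params_ratio)
    then show "let Q = ?Q in irreducible_yangian_module n Q \<and> drinfeld_polynomials n Q ?P"
      using quotient(1) by (simp add: Let_def)
  qed
qed

end
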